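(* Let $k\ge1$, $\alpha,\beta>0$, and consider $I_{2k}$ with multiplicity $(\alpha,\beta)$. For $z=|z|e^{i\phi_1},w=|w|e^{i\phi_2}$ and $u,v\in[-1,1]$ let $a_j=|zw|\cos\big(\frac{q_{u,v}(k\phi_1,k\phi_2)+2\pi j}{k}\big)$ for $j=0,\dots,k-1$, $a_k=\mathrm{Re}(z\bar w)$, and for $\gamma>0$ $$h_\gamma(z,w,u,v)=\Phi_2^{(k+1)}(\gamma,\dots,\gamma,1;k\gamma+1;a_0,\dots,a_{k-1},a_k)=e^{a_k}\Phi_2^{(k)}(\gamma,\dots,\gamma;k\gamma+1;a_0-a_k,\dots,a_{k-1}-a_k).$$ Then $$E_\kappa(z,w)=\int_{-1}^1\int_{-1}^1\Big[h_{\alpha+\beta}(z,w,u,v)+\frac{2^{1-k}\Gamma(k(\alpha+\beta)+1)}{\Gamma(k(\alpha+\beta+1)+1)}|zw|^k\,\xi_{u-1,v-1}(k\phi_1,k\phi_2)\,h_{\alpha+\beta+1}(z,w,u,v)\Big]d\mu^\alpha(u)\,d\mu^\beta(v).$$ Equivalently, with $t_k=1-\sum_{j=0}^{k-1}t_j$ and $d\omega_\nu=\prod_{j=0}^{k-1}t_j^{\nu-1}dt_0\cdots dt_{k-1}$ on $T^k$, $$E_\kappa(z,w)=\frac{\Gamma(k(\alpha+\beta)+1)}{\Gamma(\alpha+\beta)^k}\int_{-1}^1\!\int_{-1}^1\!\int_{T^k}e^{\sum_{j=0}^ka_jt_j}d\omega_{\alpha+\beta}\,d\mu^\alpha(u)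d\mu^\beta(v)+\frac{2^{1-k}\Gamma(k(\alpha+\beta)+1)}{\Gamma(\alpha+\beta+1)^k}\int_{-1}^1\!\int_{-1}^1\!\int_{T^k}|zw|^k\xi_{u-1,v-1}(k\phi_1,k\phi_2)e^{\sum_{j=0}^ka_jt_j}d\omega_{\alpha+\beta+1}\,d\mu^\alpha(u)d\mu^\beta(v).$$
   Context: Identify $\mathbb{R}^2$ with $\mathbb{C}$, $\langle z,w\rangle=\mathrm{Re}(z\bar w)$, $z=|z|e^{i\phi_1}$, $w=|w|e^{i\phi_2}$. The dihedral group $I_{2k}$ (order $4k$) contains the reflections $z\mapsto\bar ze^{ij\pi/k}$, $j=0,\dots,2k-1$, forming two conjugacy classes ($j$ even, containing $z\mapsto\bar z$; $j$ odd); $\kappa=(\alpha,\beta)$ is $\alpha$ on the class with $j$ even and $\beta$ on the class with $j$ odd. The Dunkl kernel is $E_\kappa(z,w)=V_\kappa(e^{\langle\cdot,w\rangle})(z)$, i.e. the joint eigenfunction $T_j^{(z)}E_\kappa=w_jE_\kappa$ of the Dunkl operators with $E_\kappa(0,w)=1$. Measures on $[-1,1]$: $d\mu^\alpha(u)=\frac{\Gamma(\alpha+1/2)}{\sqrt\pi\Gamma(\alpha)}(1+u)(1-u^2)^{\alpha-1}du$. $\xi_{u,v}(\theta_1,\theta_2)=v\cos\theta_1\cos\theta_2+u\sin\theta_1\sin\theta_2$ (for any real $u,v$), $q_{u,v}=\arccos\xi_{u,v}\in[0,\pi]$ for $u,v\in[-1,1]$. The Humbert function is $\Phi_2^{(m)}(\beta_1,\dots,\beta_m;\gamma;x_1,\dots,x_m)=\sum_{j_1,\dots,j_m\ge0}\frac{(\beta_1)_{j_1}\cdots(\beta_m)_{j_m}}{(\gamma)_{j_1+\cdots+j_m}}\frac{x_1^{j_1}}{j_1!}\cdots\frac{x_m^{j_m}}{j_m!}$,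 $(\cdot)_j$ the Pochhammer symbol. $T^k=\{(t_0,\dots,t_{k-1}):t_j>0,\sum t_j<1\}$. *)

theory Defs
  imports "HOL-Analysis.Analysis" "HOL-Probability.Probability"
begin

text \<open>R^2 is identified with the complex plane; inner product Re(z * cnj w).\<close>
definition cinner :: "complex \<Rightarrow> complex \<Rightarrow> real" where
  "cinner z w = Re (z * cnj w)"

definition dih_refl :: "nat \<Rightarrow> nat \<Rightarrow> complex \<Rightarrow> complex" where
  "dih_refl k j z = cnj z * cis (real j * pi / real k)"

text \<open>A root (normal vector of the mirror) of the reflection dih_refl k j.\<close>
definition dih_root :: "nat \<Rightarrow> nat \<Rightarrow> complex" where
  "dih_root k j = \<i> * cis (real j * pi / (2 * real k))"

text \<open>Multiplicity: alpha on the class with j even (containing conjugation), beta on j odd.\<close>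
definition dih_mult :: "real \<Rightarrow> real \<Rightarrow> nat \<Rightarrow> real" where
  "dih_mult \<alpha> \<beta> j = (if even j then \<alpha> else \<beta>)"

text \<open>Dunkl operator in direction xi (one positive root per reflection).\<close>
definition dunkl_op :: "nat \<Rightarrow> real \<Rightarrow> real \<Rightarrow> complex \<Rightarrow> (complex \<Rightarrow> real) \<Rightarrow> complex \<Rightarrow> real" where
  "dunkl_op k \<alpha> \<beta> \<xi> f x =
     frechet_derivative f (at x) \<xi>
     + (\<Sum>j<2*k. dih_mult \<alpha> \<beta> j * cinner (dih_root k j) \<xi>
                  * (f x - f (dih_refl k j x)) / cinner (dih_root k j) x)"

text \<open>Points off all mirrors (where the difference quotients are literally defined).\<close>
definition dih_regular :: "nat \<Rightarrow> complex \<Rightarrow> bool" where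
  "dih_regular k x \<longleftrightarrow> (\<forall>j<2*k. cinner (dih_root k j) x \<noteq> 0)"

definition is_dunkl_kernel :: "nat \<Rightarrow> real \<Rightarrow> real \<Rightarrow> complex \<Rightarrow> (complex \<Rightarrow> real) \<Rightarrow> bool" where
  "is_dunkl_kernel k \<alpha> \<beta> w f \<longleftrightarrow>
     f 0 = 1 \<and> (\<forall>x. f differentiable (at x))
     \<and> continuous_on UNIV (\<lambda>x. frechet_derivative f (at x) 1)
     \<and> continuous_on UNIV (\<lambda>x. frechet_derivative f (at x) \<i>)
     \<and> (\<forall>x. dih_regular k x \<longrightarrow>
           dunkl_op k \<alpha> \<beta> 1 f x = cinner 1 w * f x \<and>
           dunkl_op k \<alpha> \<beta> \<i> f x = cinner \<i> w * f x)"

definition dunkl_kernel :: "nat \<Rightarrow> real \<Rightarrow> real \<Rightarrow> complex \<Rightarrow> complex \<Rightarrow> real" where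
  "dunkl_kernel k \<alpha> \<beta> z w = (THE f. is_dunkl_kernel k \<alpha> \<beta> w f) z"

definition mu_dens :: "real \<Rightarrow> real \<Rightarrow> real" where
  "mu_dens \<alpha> u = Gamma (\<alpha> + 1/2) / (sqrt pi * Gamma \<alpha>) * (1 + u) * (1 - u\<^sup>2) powr (\<alpha> - 1)"

definition xi_uv :: "real \<Rightarrow> real \<Rightarrow> real \<Rightarrow> real \<Rightarrow> real" where
  "xi_uv u v \<theta>1 \<theta>2 = v * cos \<theta>1 * cos \<theta>2 + u * sin \<theta>1 * sin \<theta>2"

definition q_uv :: "real \<Rightarrow> real \<Rightarrow> real \<Rightarrow> real \<Rightarrow> real" where
  "q_uv u v \<theta>1 \<theta>2 = arccos (xi_uv u v \<theta>1 \<theta>2)"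

definition humbert2 :: "nat \<Rightarrow> (nat \<Rightarrow> real) \<Rightarrow> real \<Rightarrow> (nat \<Rightarrow> real) \<Rightarrow> real" where
  "humbert2 m b c x =
     (\<Sum>\<^sub>\<infinity> js \<in> {js :: nat \<Rightarrow> nat. \<forall>i\<ge>m. js i = 0}.
        (\<Prod>i<m. pochhammer (b i) (js i) * x i ^ js i / fact (js i))
        / pochhammer c (\<Sum>i<m. js i))"

definition a_coef :: "nat \<Rightarrow> complex \<Rightarrow> complex \<Rightarrow> real \<Rightarrow> real \<Rightarrow> nat \<Rightarrow> real" where
  "a_coef k z w u v j =
     (if j < k then cmod z * cmod w *
        cos ((q_uv u v (real k * Arg z) (real k * Arg w) + 2 * pi * real j) / real k)
      else Re (z * cnj w))"

definition h_fun :: "nat \<Rightarrow> real \<Rightarrow> complex \<Rightarrow> complex \<Rightarrow> real \<Rightarrow> real \<Rightarrow> real" where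
  "h_fun k \<gamma> z w u v =
     humbert2 (k + 1) (\<lambda>i. if i < k then \<gamma> else 1) (real k * \<gamma> + 1) (a_coef k z w u v)"

definition simplexT :: "nat \<Rightarrow> (nat \<Rightarrow> real) set" where
  "simplexT k = {t \<in> PiE {..<k} (\<lambda>_. UNIV). (\<forall>j<k. t j > 0) \<and> (\<Sum>j<k. t j) < 1}"

end

theory Submission
  imports Defs "HOL-Computational_Algebra.Polynomial_FPS"
    "HOL-Computational_Algebra.Fundamental_Theorem_Algebra"
begin

text \<open>
  The kernel is computed through a formal Laplace transform: a power series \<open>\<Sum>\<^sub>n L\<^sub>n X\<^sup>n\<close> whose coefficients
  depend on \<open>z\<close> is summed as \<open>\<Sum>\<^sub>n L\<^sub>n / (c)\<^sub>n\<close> with \<open>c = k (\<alpha> + \<beta>) + 1\<close>. This turns the Dunkl equation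
  \<open>T\<^sub>h E = \<langle>h, w\<rangle> E\<close> into the first order identity \<open>T\<^sub>h L = \<langle>h, w\<rangle> X (X d/dX + c) L\<close>, and it turns a Humbert
  function into the series \<open>\<Prod>\<^sub>j (1 - a\<^sub>j X)\<^bsup>-\<beta>\<^sub>j\<^esup>\<close>.

  For the parameters \<open>a\<^sub>j\<close> of the theorem the product \<open>F = \<Prod>\<^sub>j (1 - a\<^sub>j X)\<close> over \<open>j < k\<close> is affine in \<open>u\<close> and \<open>v\<close>; at
  \<open>u = v = 1\<close> it is the product \<open>D\<close> of the series \<open>1 - \<langle>g z, w\<rangle> X\<close> over the rotations \<open>g\<close> of order dividing \<open>k\<close>.
  The two integrands of the theorem add up to the single series \<open>D / (1 - \<langle>z, w\<rangle> X) * F\<^bsup>-\<alpha>-\<beta>-1\<^esup>\<close>.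
  A reflection of \<open>z\<close> changes the sign of \<open>u\<close> or of \<open>v\<close> in \<open>F\<close>, so that integration by parts against \<open>\<mu>\<^sup>\<alpha>\<close> or \<open>\<mu>\<^sup>\<beta>\<close>
  expresses the reflection differences of the average of \<open>F\<^bsup>-\<alpha>-\<beta>-1\<^esup>\<close> by averages of \<open>F\<^bsup>-\<alpha>-\<beta>-2\<^esup>\<close>. What remains
  of the Dunkl equation is one polynomial identity, valid for every derivation, applied to
  \<open>h \<cdot> \<nabla> - \<langle>h, w\<rangle> X\<^sup>2 d/dX\<close>.

  The joint eigenfunction is unique because the difference \<open>d\<close> of two of them satisfies a radial equation to
  which the maximum principle applies after multiplication by \<open>exp (- C |z|)\<close>.
\<close>

unbundle no vec_syntax
unbundle fps_syntax

section \<open>Powers of formal power series\<close>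

text \<open>Composition of series is only meaningful here if \<open>f\<close> has constant coefficient 1.\<close>
definition fps_powr :: "'a::field_char_0 fps \<Rightarrow> 'a \<Rightarrow> 'a fps" where
  "fps_powr f c = fps_binomial c oo (f - 1)"

lemma fps_powr_nth_0 [simp]: "fps_powr f c $ 0 = 1"
  by (simp add: fps_powr_def)

lemma fps_powr_0 [simp]: "fps_powr f 0 = 1"
  by (simp add: fps_powr_def)

lemma fps_powr_1_left [simp]: "fps_powr 1 c = 1"
  by (simp add: fps_powr_def)

lemma fps_powr_1: "f $ 0 = 1 \<Longrightarrow> fps_powr f 1 = f"
  by (simp add: fps_powr_def fps_binomial_1 fps_compose_add_distrib)

lemma fps_powr_add: "f $ 0 = 1 \<Longrightarrow> fps_powr f (a + b) = fps_powr f a * fps_powr f b"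
  by (simp add: fps_powr_def fps_binomial_add_mult fps_compose_mult_distrib)

lemma mult_fps_powr: "f $ 0 = 1 \<Longrightarrow> f * fps_powr f c = fps_powr f (c + 1)"
  by (metis add.commute fps_powr_1 fps_powr_add)

lemma fps_powr_minus_1:
  assumes "f $ 0 = 1"
  shows "fps_powr f (- 1) = inverse f"
proof -
  have "f * fps_powr f (- 1) = 1"
    using mult_fps_powr[OF assms, of "- 1"] by simp
  then show ?thesis
    by (rule fps_inverse_unique[symmetric])
qed

lemma fps_deriv_fps_binomial:
  "fps_deriv (fps_binomial c) = fps_const c * fps_binomial (c - 1 :: 'a::field_char_0)"
  by (rule fps_ext) (simp add: gbinomial_absorption flip: of_nat_Suc add: add.commute)

lemma fps_deriv_fps_powr:
  assumes "f $ 0 = 1"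
  shows "fps_deriv (fps_powr f c) = fps_const c * fps_powr f (c - 1) * fps_deriv f"
  using assms by (simp add: fps_powr_def fps_compose_deriv fps_deriv_fps_binomial
      fps_compose_mult_distrib fps_const_compose)

lemma fps_powr_unique_ODE:
  assumes "f $ 0 = 1" "g $ 0 = 1" and ode: "f * fps_deriv g = fps_const c * fps_deriv f * g"
  shows "g = fps_powr f c"
proof -
  have shift: "f * fps_powr f (- c - 1) = fps_powr f (- c)"
    using mult_fps_powr[OF assms(1), of "- c - 1"] by simp
  have "f * fps_deriv (g * fps_powr f (- c))
      = (f * fps_deriv g) * fps_powr f (- c) - fps_const c * fps_deriv f * g * (f * fps_powr f (- c - 1))"
    by (simp add: fps_deriv_fps_powr[OF assms(1)] algebra_simps flip: fps_const_neg)
  also have "\<dots> = 0"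
    unfolding ode shift by simp
  finally have "fps_deriv (g * fps_powr f (- c)) = 0"
    using assms(1) by auto
  then have "g * fps_powr f (- c) = fps_const ((g * fps_powr f (- c)) $ 0)"
    by (metis fps_deriv_eq_0_iff)
  then have "g * fps_powr f (- c) = 1"
    using assms(2) by simp
  moreover have "fps_powr f (- c) * fps_powr f c = 1"
    using fps_powr_add[OF assms(1), of "- c" c] by simp
  ultimately show ?thesis
    by (metis mult.assoc mult_1 mult.right_neutral)
qed

lemma fps_powr_mult_distrib:
  assumes "f $ 0 = 1" "g $ 0 = 1"
  shows "fps_powr (f * g) c = fps_powr f c * fps_powr g c"
proof (rule fps_powr_unique_ODE[symmetric])
  have shift: "h * fps_powr h (c - 1) = fps_powr h c" if "h $ 0 = 1" for h
    using mult_fps_powr[OF that, of "c - 1"] by simp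
  have "f * g * fps_deriv (fps_powr f c * fps_powr g c)
     = fps_const c * ((f * fps_powr f (c - 1)) * g * fps_deriv f * fps_powr g c
        + fps_powr f c * (g * fps_powr g (c - 1)) * f * fps_deriv g)"
    using assms by (simp add: fps_deriv_fps_powr algebra_simps)
  then show "f * g * fps_deriv (fps_powr f c * fps_powr g c)
     = fps_const c * fps_deriv (f * g) * (fps_powr f c * fps_powr g c)"
    unfolding shift[OF assms(1)] shift[OF assms(2)] by (simp add: algebra_simps)
qed (use assms in auto)

lemma fps_prod_nth_0: "(prod f S :: 'a::comm_ring_1 fps) $ 0 = (\<Prod>i\<in>S. f i $ 0)"
  by (induction S rule: infinite_finite_induct) auto

lemma fps_powr_prod_distrib:
  assumes "\<And>i. i \<in> S \<Longrightarrow> f i $ 0 = 1"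
  shows "fps_powr (prod f S) c = (\<Prod>i\<in>S. fps_powr (f i) c)"
  using assms
proof (induction S rule: infinite_finite_induct)
  case (insert x S)
  then show ?case by (simp add: fps_powr_mult_distrib fps_prod_nth_0)
qed auto

abbreviation linear_factor :: "'a::comm_ring_1 \<Rightarrow> 'a fps" where
  "linear_factor a \<equiv> 1 - fps_const a * fps_X"

lemma fps_powr_linear_factor_nth:
  "fps_powr (linear_factor a) (- b) $ n = pochhammer b n * a ^ n / fact n"
proof -
  have minus_1: "linear_factor a - 1 = fps_const (- a) * fps_X"
    by (simp flip: fps_const_neg)
  show ?thesis
    unfolding fps_powr_def minus_1 fps_compose_linear
    by (simp add: gbinomial_pochhammer flip: power_mult_distrib)
qed

lemma fps_XD_mult: "fps_XD (f * g) = f * fps_XD g + fps_XD f * (g :: 'a::comm_ring_1 fps)"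
  by (simp add: fps_XD_def algebra_simps)

lemma fps_XD_fps_powr:
  assumes "f $ 0 = 1"
  shows "fps_XD (fps_powr f c) = fps_const c * fps_powr f (c - 1) * fps_XD f"
  by (simp add: fps_XD_def fps_deriv_fps_powr[OF assms] mult_ac)

lemma fps_XD_prod:
  fixes f :: "'i \<Rightarrow> 'a::comm_ring_1 fps"
  assumes "finite S"
  shows "fps_XD (\<Prod>i\<in>S. f i) = (\<Sum>i\<in>S. fps_XD (f i) * (\<Prod>j\<in>S - {i}. f j))"
  using assms
proof (induction S rule: finite_induct)
  case empty
  then show ?case by (simp add: fps_XD_def)
next
  case (insert a S)
  have "insert a S - {i} = insert a (S - {i})" if "i \<in> S" for i
    using that insert.hyps by auto
  moreover have "insert a S - {a} = S"
    using insert.hyps by auto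
  ultimately show ?case
    using insert by (simp add: fps_XD_mult sum_distrib_left algebra_simps cong: sum.cong)
qed

section \<open>Coefficientwise calculus\<close>

definition fps_continuous_on ::
  "'a::topological_space set \<Rightarrow> ('a \<Rightarrow> 'b::real_normed_field fps) \<Rightarrow> bool" where
  "fps_continuous_on S f \<longleftrightarrow> (\<forall>n. continuous_on S (\<lambda>x. f x $ n))"

lemma fps_continuous_on_nth: "fps_continuous_on S f \<Longrightarrow> continuous_on S (\<lambda>x. f x $ n)"
  by (simp add: fps_continuous_on_def)

named_theorems fps_continuous_intros

lemma fps_continuous_on_const [fps_continuous_intros]: "fps_continuous_on S (\<lambda>x. c)"
  by (simp add: fps_continuous_on_def)

lemma fps_continuous_on_fps_const [fps_continuous_intros]:
  assumes "continuous_on S f"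
  shows "fps_continuous_on S (\<lambda>x. fps_const (f x))"
  unfolding fps_continuous_on_def
proof
  show "continuous_on S (\<lambda>x. fps_const (f x) $ n)" for n
    using assms by (cases n) auto
qed

lemma fps_continuous_on_add [fps_continuous_intros]:
  "fps_continuous_on S f \<Longrightarrow> fps_continuous_on S g \<Longrightarrow> fps_continuous_on S (\<lambda>x. f x + g x)"
  by (auto simp: fps_continuous_on_def intro!: continuous_intros)

lemma fps_continuous_on_diff [fps_continuous_intros]:
  "fps_continuous_on S f \<Longrightarrow> fps_continuous_on S g \<Longrightarrow> fps_continuous_on S (\<lambda>x. f x - g x)"
  by (auto simp: fps_continuous_on_def intro!: continuous_intros)

lemma fps_continuous_on_minus [fps_continuous_intros]:
  "fps_continuous_on S f \<Longrightarrow> fps_continuous_on S (\<lambda>x. - f x)"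
  by (auto simp: fps_continuous_on_def intro!: continuous_intros)

lemma fps_continuous_on_mult [fps_continuous_intros]:
  "fps_continuous_on S f \<Longrightarrow> fps_continuous_on S g \<Longrightarrow> fps_continuous_on S (\<lambda>x. f x * g x)"
  by (auto simp: fps_continuous_on_def fps_mult_nth intro!: continuous_intros)

lemma fps_continuous_on_power [fps_continuous_intros]:
  "fps_continuous_on S f \<Longrightarrow> fps_continuous_on S (\<lambda>x. f x ^ m)"
  by (induction m) (auto intro: fps_continuous_intros)

lemma fps_continuous_on_sum [fps_continuous_intros]:
  "(\<And>i. i \<in> A \<Longrightarrow> fps_continuous_on S (f i)) \<Longrightarrow> fps_continuous_on S (\<lambda>x. \<Sum>i\<in>A. f i x)"
  by (induction A rule: infinite_finite_induct) (auto intro: fps_continuous_intros)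

lemma fps_continuous_on_prod [fps_continuous_intros]:
  "(\<And>i. i \<in> A \<Longrightarrow> fps_continuous_on S (f i)) \<Longrightarrow> fps_continuous_on S (\<lambda>x. \<Prod>i\<in>A. f i x)"
  by (induction A rule: infinite_finite_induct) (auto intro: fps_continuous_intros)

lemma fps_continuous_on_fps_powr [fps_continuous_intros]:
  assumes "fps_continuous_on S f"
  shows "fps_continuous_on S (\<lambda>x. fps_powr (f x) c)"
proof -
  have "continuous_on S (\<lambda>x. (f x - 1) ^ i $ n)" for i n
    using assms by (intro fps_continuous_on_nth fps_continuous_intros)
  then show ?thesis
    by (auto simp: fps_continuous_on_def fps_powr_def fps_compose_nth intro!: continuous_intros)
qed

definition fps_has_derivative ::
  "('a::real_normed_vector \<Rightarrow> 'b::real_normed_field fps) \<Rightarrow> ('a \<Rightarrow> 'b fps) \<Rightarrow> 'a \<Rightarrow> bool" where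
  "fps_has_derivative f f' x \<longleftrightarrow>
     (\<forall>n. ((\<lambda>x. f x $ n) has_derivative (\<lambda>h. f' h $ n)) (at x))"

lemma fps_has_derivative_nth:
  "fps_has_derivative f f' x \<Longrightarrow> ((\<lambda>x. f x $ n) has_derivative (\<lambda>h. f' h $ n)) (at x)"
  by (simp add: fps_has_derivative_def)

lemma fps_has_derivative_unique:
  "fps_has_derivative f f' x \<Longrightarrow> fps_has_derivative f f'' x \<Longrightarrow> f' h = f'' h"
  unfolding fps_has_derivative_def
  by (intro fps_ext) (metis has_derivative_unique)

lemma fps_has_derivative_imp_continuous_on:
  assumes "\<And>x. x \<in> S \<Longrightarrow> fps_has_derivative f (f' x) x"
  shows "fps_continuous_on S f"
  unfolding fps_continuous_on_def
proof
  show "continuous_on S (\<lambda>x. f x $ n)" for n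
    using assms
    by (intro continuous_at_imp_continuous_on ballI has_derivative_continuous) (auto dest: fps_has_derivative_nth)
qed

lemma fps_has_derivative_const: "fps_has_derivative (\<lambda>x. c) (\<lambda>h. 0) x"
  by (simp add: fps_has_derivative_def)

lemma fps_has_derivative_fps_const:
  assumes "(f has_derivative f') (at x)"
  shows "fps_has_derivative (\<lambda>x. fps_const (f x)) (\<lambda>h. fps_const (f' h)) x"
  unfolding fps_has_derivative_def
proof
  show "((\<lambda>x. fps_const (f x) $ n) has_derivative (\<lambda>h. fps_const (f' h) $ n)) (at x)" for n
    using assms by (cases n) auto
qed

lemma fps_has_derivative_add:
  "fps_has_derivative f f' x \<Longrightarrow> fps_has_derivative g g' x \<Longrightarrow>
    fps_has_derivative (\<lambda>x. f x + g x) (\<lambda>h. f' h + g' h) x"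
  by (auto simp: fps_has_derivative_def intro!: derivative_intros)

lemma fps_has_derivative_diff:
  "fps_has_derivative f f' x \<Longrightarrow> fps_has_derivative g g' x \<Longrightarrow>
    fps_has_derivative (\<lambda>x. f x - g x) (\<lambda>h. f' h - g' h) x"
  by (auto simp: fps_has_derivative_def intro!: derivative_intros)

lemma fps_has_derivative_sum:
  "(\<And>i. i \<in> A \<Longrightarrow> fps_has_derivative (f i) (f' i) x) \<Longrightarrow>
    fps_has_derivative (\<lambda>x. \<Sum>i\<in>A. f i x) (\<lambda>h. \<Sum>i\<in>A. f' i h) x"
  by (induction A rule: infinite_finite_induct) (auto intro: fps_has_derivative_const fps_has_derivative_add)

lemma fps_has_derivative_mult:
  assumes "fps_has_derivative f f' x" "fps_has_derivative g g' x"
  shows "fps_has_derivative (\<lambda>x. f x * g x) (\<lambda>h. f x * g' h + f' h * g x) x"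
  unfolding fps_has_derivative_def
proof
  fix n
  have "((\<lambda>x. \<Sum>i=0..n. f x $ i * g x $ (n - i)) has_derivative
      (\<lambda>h. \<Sum>i=0..n. f x $ i * g' h $ (n - i) + f' h $ i * g x $ (n - i))) (at x)"
    using assms by (intro has_derivative_sum has_derivative_mult fps_has_derivative_nth)
  then show "((\<lambda>x. (f x * g x) $ n) has_derivative (\<lambda>h. (f x * g' h + f' h * g x) $ n)) (at x)"
    by (simp add: fps_mult_nth sum.distrib)
qed

lemma fps_has_derivative_mult_left:
  "fps_has_derivative f f' x \<Longrightarrow> fps_has_derivative (\<lambda>x. c * f x) (\<lambda>h. c * f' h) x"
  using fps_has_derivative_mult[OF fps_has_derivative_const] by fastforce

lemma fps_has_derivative_mult_right:
  "fps_has_derivative f f' x \<Longrightarrow> fps_has_derivative (\<lambda>x. f x * c) (\<lambda>h. f' h * c) x"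
  using fps_has_derivative_mult[OF _ fps_has_derivative_const] by fastforce

lemma fps_has_derivative_prod:
  assumes "finite S" "\<And>i. i \<in> S \<Longrightarrow> fps_has_derivative (f i) (f' i) x"
  shows "fps_has_derivative (\<lambda>x. \<Prod>i\<in>S. f i x) (\<lambda>h. \<Sum>i\<in>S. f' i h * (\<Prod>j\<in>S - {i}. f j x)) x"
  using assms
proof (induction S rule: finite_induct)
  case empty
  then show ?case by (simp add: fps_has_derivative_const)
next
  case (insert a S)
  have "insert a S - {i} = insert a (S - {i})" if "i \<in> S" for i
    using that insert.hyps by auto
  moreover have "insert a S - {a} = S"
    using insert.hyps by auto
  ultimately have "(\<Sum>i\<in>insert a S. f' i h * (\<Prod>j\<in>insert a S - {i}. f j x))
      = f a x * (\<Sum>i\<in>S. f' i h * (\<Prod>j\<in>S - {i}. f j x)) + f' a h * (\<Prod>i\<in>S. f i x)" for h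
    using insert.hyps by (simp add: sum_distrib_left algebra_simps cong: sum.cong)
  then show ?case
    using insert fps_has_derivative_mult[of "f a" "f' a" x "\<lambda>x. \<Prod>i\<in>S. f i x"]
    by (simp only: prod.insert insert_iff simp_thms)
qed

lemma fps_has_derivative_power:
  assumes "fps_has_derivative f f' x"
  shows "fps_has_derivative (\<lambda>x. f x ^ m) (\<lambda>h. of_nat m * f x ^ (m - 1) * f' h) x"
proof -
  have "(\<Sum>i<m. f' h * (\<Prod>j\<in>{..<m} - {i}. f x)) = (\<Sum>i<m. f x ^ (m - 1) * f' h)" for h
    by (intro sum.cong) auto
  then show ?thesis
    using fps_has_derivative_prod[where S = "{..<m}", OF finite_lessThan assms] by (simp add: mult_ac)
qed

lemma fps_has_derivative_compose_linear:
  assumes "bounded_linear L" "fps_has_derivative f f' (L x)"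
  shows "fps_has_derivative (\<lambda>x. f (L x)) (\<lambda>h. f' (L h)) x"
  using assms has_derivative_compose[OF bounded_linear_imp_has_derivative[OF assms(1)]]
  unfolding fps_has_derivative_def by blast

lemma fps_powr_nth_eq_sum:
  assumes "f $ 0 = 1" "n \<le> N"
  shows "fps_powr f c $ n = (\<Sum>i\<le>N. fps_const (c gchoose i) * (f - 1) ^ i) $ n"
proof -
  have "((f - 1) ^ i) $ n = 0" if "n < i" for i
    using startsby_zero_power_prefix[of "f - 1"] assms(1) that by auto
  then show ?thesis
    unfolding fps_powr_def fps_compose_nth fps_sum_nth
    using assms(2) by (intro sum.mono_neutral_cong_left) auto
qed

lemma fps_has_derivative_fps_powr:
  assumes "fps_has_derivative f f' x" and f0: "\<And>y. f y $ 0 = 1"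
  shows "fps_has_derivative (\<lambda>x. fps_powr (f x) c) (\<lambda>h. fps_const c * fps_powr (f x) (c - 1) * f' h) x"
  unfolding fps_has_derivative_def
proof
  fix n
  define T where "T = (\<lambda>N c y. \<Sum>i\<le>N. fps_const (c gchoose i) * (f y - 1) ^ i)"
  have "fps_has_derivative (T (Suc n) c)
      (\<lambda>h. \<Sum>i\<le>Suc n. fps_const (c gchoose i) * (of_nat i * (f x - 1) ^ (i - 1) * (f' h - 0))) x"
    unfolding T_def
    by (intro fps_has_derivative_sum fps_has_derivative_mult_left fps_has_derivative_power
        fps_has_derivative_diff fps_has_derivative_const assms(1))
  also have "(\<lambda>h. \<Sum>i\<le>Suc n. fps_const (c gchoose i) * (of_nat i * (f x - 1) ^ (i - 1) * (f' h - 0)))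
      = (\<lambda>h. fps_const c * T n (c - 1) x * f' h)"
  proof
    fix h
    have absorb: "fps_const (c gchoose Suc i) * of_nat (Suc i) = fps_const c * fps_const (c - 1 gchoose i)" for i
      using gbinomial_absorption[of i c]
      by (simp add: mult.commute flip: fps_of_nat del: of_nat_Suc)
    have "(\<Sum>i\<le>Suc n. fps_const (c gchoose i) * (of_nat i * (f x - 1) ^ (i - 1) * (f' h - 0)))
        = (\<Sum>i\<le>n. (fps_const (c gchoose Suc i) * of_nat (Suc i)) * (f x - 1) ^ i * f' h)"
      unfolding sum.atMost_Suc_shift by (simp add: mult.assoc)
    then show "(\<Sum>i\<le>Suc n. fps_const (c gchoose i) * (of_nat i * (f x - 1) ^ (i - 1) * (f' h - 0)))
        = fps_const c * T n (c - 1) x * f' h"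
      unfolding absorb T_def sum_distrib_left sum_distrib_right by (simp only: mult.assoc)
  qed
  finally have "((\<lambda>x. T (Suc n) c x $ n) has_derivative (\<lambda>h. (fps_const c * T n (c - 1) x * f' h) $ n)) (at x)"
    by (rule fps_has_derivative_nth)
  moreover have "T (Suc n) c y $ n = fps_powr (f y) c $ n" for y
    unfolding T_def by (simp only: fps_powr_nth_eq_sum[OF f0, of n "Suc n"] le_SucI[OF order.refl])
  moreover have "(fps_const c * T n (c - 1) x * f' h) $ n = (fps_const c * fps_powr (f x) (c - 1) * f' h) $ n" for h
    unfolding mult.assoc fps_mult_left_const_nth fps_mult_nth T_def
    by (intro arg_cong[where f = "(*) c"] sum.cong refl) (simp add: fps_powr_nth_eq_sum[OF f0, of _ n])
  ultimately show "((\<lambda>x. fps_powr (f x) c $ n) has_derivative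
      (\<lambda>h. (fps_const c * fps_powr (f x) (c - 1) * f' h) $ n)) (at x)"
    by simp
qed

section \<open>Products over equally spaced angles\<close>

lemma prod_diff_roots_unity:
  fixes x :: complex
  assumes "k \<ge> 1"
  shows "(\<Prod>j<k. x - cis (2 * pi * real j / real k)) = x ^ k - 1"
proof -
  define p :: "complex poly" where "p = monom 1 k + [:- 1:]"
  have degree: "degree p = k"
    unfolding p_def using assms by (subst degree_add_eq_left) (auto simp: degree_monom_eq)
  have monic: "lead_coeff p = 1"
    unfolding degree unfolding p_def using assms by (cases k) auto
  have "rsquarefree p"
    unfolding rsquarefree_roots
  proof (intro allI notI)
    fix a assume "poly p a = 0 \<and> poly (pderiv p) a = 0"
    then have "a ^ k = 1" "of_nat k * a ^ (k - 1) = 0"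
      by (auto simp: p_def poly_monom pderiv_add pderiv_monom pderiv_pCons)
    then show False
      using assms by (auto simp: power_0_left split: if_splits)
  qed
  from complex_poly_decompose_rsquarefree[OF this]
  have "p = (\<Prod>z | poly p z = 0. [:- z, 1:])"
    unfolding monic by simp
  also have "{z. poly p z = 0} = {z. z ^ k = 1}"
    by (auto simp: p_def poly_monom)
  also have "(\<Prod>z\<in>\<dots>. [:- z, 1:]) = (\<Prod>j<k. [:- cis (2 * pi * real j / real k), 1:])"
    using assms by (intro prod.reindex_bij_betw[symmetric] Complex.bij_betw_roots_unity) auto
  finally have "poly p x = (\<Prod>j<k. x - cis (2 * pi * real j / real k))"
    by (simp add: poly_prod)
  then show ?thesis
    by (simp add: p_def poly_monom)
qed

lemma prod_diff_roots_unity_mult: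
  fixes x y :: complex
  assumes "k \<ge> 1"
  shows "(\<Prod>j<k. x - cis (2 * pi * real j / real k) * y) = x ^ k - y ^ k"
proof (cases "y = 0")
  case False
  have "(\<Prod>j<k. x - cis (2 * pi * real j / real k) * y)
      = (\<Prod>j<k. y * (x / y - cis (2 * pi * real j / real k)))"
    using False by (intro prod.cong) (auto simp: field_simps)
  also have "\<dots> = y ^ k * ((x / y) ^ k - 1)"
    unfolding prod_diff_roots_unity[OF assms, symmetric] by (simp add: prod.distrib)
  also have "\<dots> = x ^ k - y ^ k"
    using False by (simp add: power_divide right_diff_distrib)
  finally show ?thesis .
qed (use assms in simp)

lemma prod_diff_cis:
  fixes x y :: complex
  assumes "k \<ge> 1"
  shows "(\<Prod>j<k. x - y * cis ((t + 2 * pi * real j) / real k)) = x ^ k - y ^ k * cis t"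
proof -
  have "y * cis ((t + 2 * pi * real j) / real k) = cis (2 * pi * real j / real k) * (y * cis (t / real k))" for j
    by (simp add: cis_mult add_divide_distrib add.commute)
  moreover have "cis (t / real k) ^ k = cis t"
    using assms by (simp add: Complex.DeMoivre)
  ultimately show ?thesis
    by (simp only: prod_diff_roots_unity_mult[OF assms] power_mult_distrib)
qed

lemma sum_squares_one_product_exists:
  fixes s :: complex
  obtains a b where "a\<^sup>2 + b\<^sup>2 = 1" "a * b = s"
proof
  let ?p = "csqrt (1 + 2 * s)" and ?q = "csqrt (1 - 2 * s)"
  have squares: "?p * ?p = 1 + 2 * s" "?q * ?q = 1 - 2 * s"
    using power2_csqrt unfolding power2_eq_square by auto
  show "((?p + ?q) / 2)\<^sup>2 + ((?p - ?q) / 2)\<^sup>2 = 1"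
    using squares by (simp add: power2_eq_square field_simps)
  show "(?p + ?q) / 2 * ((?p - ?q) / 2) = s"
    using squares by (simp add: field_simps)
qed

lemma one_minus_cos_eq_mult_cis:
  fixes a b :: complex
  assumes "a\<^sup>2 + b\<^sup>2 = 1" "a * b = of_real s"
  shows "of_real (1 - 2 * s * cos \<theta>) = (a - b * cis \<theta>) * (a - b * cnj (cis \<theta>))"
proof -
  have "(a - b * cis \<theta>) * (a - b * cnj (cis \<theta>))
      = a\<^sup>2 + b\<^sup>2 * (cis \<theta> * cnj (cis \<theta>)) - (a * b) * (cis \<theta> + cnj (cis \<theta>))"
    by (simp add: power2_eq_square algebra_simps)
  also have "cis \<theta> * cnj (cis \<theta>) = 1"
    by (simp add: cis_cnj cis_mult)
  also have "cis \<theta> + cnj (cis \<theta>) = of_real (2 * cos \<theta>)"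
    by (simp add: complex_eq_iff)
  finally show ?thesis
    unfolding assms(2) using assms(1) by simp
qed

lemma prod_one_minus_cos:
  fixes s t :: real
  assumes "k \<ge> 1"
  shows "(\<Prod>j<k. 1 - 2 * s * cos ((t + 2 * pi * real j) / real k))
    = (\<Prod>j<k. 1 - 2 * s * cos (2 * pi * real j / real k)) - 2 * s ^ k * (cos t - 1)"
proof -
  obtain a b :: complex where ab: "a\<^sup>2 + b\<^sup>2 = 1" "a * b = of_real s"
    by (rule sum_squares_one_product_exists)
  have "complex_of_real (\<Prod>j<k. 1 - 2 * s * cos ((t + 2 * pi * real j) / real k))
      = (\<Prod>j<k. a - b * cis ((t + 2 * pi * real j) / real k))
        * cnj (\<Prod>j<k. cnj a - cnj b * cis ((t + 2 * pi * real j) / real k))" for t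
    unfolding of_real_prod one_minus_cos_eq_mult_cis[OF ab] prod.distrib by simp
  then have split: "complex_of_real (\<Prod>j<k. 1 - 2 * s * cos ((t + 2 * pi * real j) / real k))
      = (a ^ k - b ^ k * cis t) * (a ^ k - b ^ k * cnj (cis t))" for t
    unfolding prod_diff_cis[OF assms] by simp
  have expand: "complex_of_real (\<Prod>j<k. 1 - 2 * s * cos ((t + 2 * pi * real j) / real k))
      = a ^ (2 * k) + b ^ (2 * k) - of_real (2 * s ^ k * cos t)" for t
  proof -
    have "(a ^ k - b ^ k * cis t) * (a ^ k - b ^ k * cnj (cis t))
        = a ^ (2 * k) + b ^ (2 * k) * (cis t * cnj (cis t)) - (a * b) ^ k * (cis t + cnj (cis t))"
      by (simp add: power_mult_distrib mult.commute[of 2 k] power_mult power2_eq_square algebra_simps)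
    also have "cis t * cnj (cis t) = 1"
      by (simp add: cis_cnj cis_mult)
    also have "cis t + cnj (cis t) = of_real (2 * cos t)"
      by (simp add: complex_eq_iff)
    finally show ?thesis
      unfolding split ab(2) by simp
  qed
  have "complex_of_real (\<Prod>j<k. 1 - 2 * s * cos ((t + 2 * pi * real j) / real k))
      = of_real ((\<Prod>j<k. 1 - 2 * s * cos (2 * pi * real j / real k)) - 2 * s ^ k * (cos t - 1))"
    using expand[of t] expand[of 0] by (simp add: algebra_simps)
  then show ?thesis
    using of_real_eq_iff by blast
qed

text \<open>This is \<open>2\<^sup>1\<^sup>-\<^sup>k (r X)\<^sup>k T\<^sub>k(1 / (r X))\<close> for the Chebyshev polynomial \<open>T\<^sub>k\<close>.\<close>
definition chebyshev_fps :: "nat \<Rightarrow> real \<Rightarrow> real fps" where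
  "chebyshev_fps k r =
    (\<Prod>j<k. linear_factor (r * cos (2 * pi * real j / real k))) + fps_const (2 / 2 ^ k * r ^ k) * fps_X ^ k"

lemma prod_linear_factor_cos:
  assumes "k \<ge> 1"
  shows "(\<Prod>j<k. linear_factor (r * cos ((t + 2 * pi * real j) / real k)))
    = chebyshev_fps k r - fps_const (2 / 2 ^ k * r ^ k * cos t) * fps_X ^ k"
proof -
  define p where "p = (\<lambda>t. \<Prod>j<k. [:1, - (r * cos ((t + 2 * pi * real j) / real k)):])"
  have "poly (p t) x = poly (p 0 - monom (2 / 2 ^ k * r ^ k * (cos t - 1)) k) x" for x
    using prod_one_minus_cos[OF assms, of "r * x / 2" t]
    by (simp add: p_def poly_prod poly_monom power_divide power_mult_distrib mult_ac)
  then have "p t = p 0 - monom (2 / 2 ^ k * r ^ k * (cos t - 1)) k"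
    by (intro poly_eq_poly_eq_iff[THEN iffD1] ext)
  then have "fps_of_poly (p t) = fps_of_poly (p 0) - fps_const (2 / 2 ^ k * r ^ k * (cos t - 1)) * fps_X ^ k"
    by (simp add: fps_of_poly_diff fps_of_poly_monom)
  moreover have factors: "fps_of_poly (p t) = (\<Prod>j<k. linear_factor (r * cos ((t + 2 * pi * real j) / real k)))" for t
    unfolding p_def fps_of_poly_prod
    by (intro prod.cong) (simp_all add: fps_of_poly_pCons mult.commute flip: fps_const_neg)
  moreover have "fps_const (2 / 2 ^ k * r ^ k * (cos t - 1))
      = fps_const (2 / 2 ^ k * r ^ k * cos t) - fps_const (2 / 2 ^ k * r ^ k)"
    unfolding fps_const_sub right_diff_distrib by simp
  moreover from factors[of 0] have "fps_of_poly (p 0) = (\<Prod>j<k. linear_factor (r * cos (2 * pi * real j / real k)))"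
    by simp
  ultimately show ?thesis
    unfolding chebyshev_fps_def by (simp only: left_diff_distrib) simp
qed

section \<open>Geometrically bounded coefficients\<close>

definition geometrically_bounded_on :: "'a set \<Rightarrow> ('a \<Rightarrow> 'b::real_normed_field fps) \<Rightarrow> bool" where
  "geometrically_bounded_on S f \<longleftrightarrow>
     (\<exists>C R. C \<ge> 0 \<and> R \<ge> 0 \<and> (\<forall>x\<in>S. \<forall>n. norm (f x $ n) \<le> C * R ^ n))"

lemma geometrically_bounded_onI:
  "C \<ge> 0 \<Longrightarrow> R \<ge> 0 \<Longrightarrow> (\<And>x n. x \<in> S \<Longrightarrow> norm (f x $ n) \<le> C * R ^ n) \<Longrightarrow> geometrically_bounded_on S f"
  unfolding geometrically_bounded_on_def by blast

lemma geometrically_bounded_onE: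
  assumes "geometrically_bounded_on S f"
  obtains C R where "C \<ge> 0" "R \<ge> 0" "\<And>x n. x \<in> S \<Longrightarrow> norm (f x $ n) \<le> C * R ^ n"
  using assms unfolding geometrically_bounded_on_def by blast

lemma geometrically_bounded_on_common_ratioE:
  assumes "geometrically_bounded_on S f" "geometrically_bounded_on S g"
  obtains C C' R where "C \<ge> 0" "C' \<ge> 0" "R \<ge> 0"
    "\<And>x n. x \<in> S \<Longrightarrow> norm (f x $ n) \<le> C * R ^ n" "\<And>x n. x \<in> S \<Longrightarrow> norm (g x $ n) \<le> C' * R ^ n"
proof -
  obtain C R where f: "C \<ge> 0" "R \<ge> 0" "\<And>x n. x \<in> S \<Longrightarrow> norm (f x $ n) \<le> C * R ^ n"
    using assms(1) by (rule geometrically_bounded_onE) blast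
  obtain C' R' where g: "C' \<ge> 0" "R' \<ge> 0" "\<And>x n. x \<in> S \<Longrightarrow> norm (g x $ n) \<le> C' * R' ^ n"
    using assms(2) by (rule geometrically_bounded_onE) blast
  show thesis
  proof
    show "norm (f x $ n) \<le> C * max R R' ^ n" if "x \<in> S" for x n
      using f that by (intro order.trans[OF f(3)] mult_left_mono power_mono) auto
    show "norm (g x $ n) \<le> C' * max R R' ^ n" if "x \<in> S" for x n
      using g that by (intro order.trans[OF g(3)] mult_left_mono power_mono) auto
  qed (use f g in auto)
qed

lemma geometrically_bounded_on_cong:
  "(\<And>x. x \<in> S \<Longrightarrow> f x = g x) \<Longrightarrow> geometrically_bounded_on S f \<longleftrightarrow> geometrically_bounded_on S g"
  unfolding geometrically_bounded_on_def by simp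

lemma geometrically_bounded_on_compose:
  "geometrically_bounded_on T f \<Longrightarrow> g ` S \<subseteq> T \<Longrightarrow> geometrically_bounded_on S (\<lambda>x. f (g x))"
  unfolding geometrically_bounded_on_def by (meson image_subset_iff)

lemma geometrically_bounded_on_subset:
  "geometrically_bounded_on T f \<Longrightarrow> S \<subseteq> T \<Longrightarrow> geometrically_bounded_on S f"
  unfolding geometrically_bounded_on_def by (meson subsetD)

named_theorems geometrically_bounded_intros

lemma geometrically_bounded_on_fps_const:
  assumes "\<And>x. x \<in> S \<Longrightarrow> norm (f x) \<le> B"
  shows "geometrically_bounded_on S (\<lambda>x. fps_const (f x))"
  by (rule geometrically_bounded_onI[of "\<bar>B\<bar>" 1]) (use assms in \<open>force+\<close>)

lemma geometrically_bounded_on_fps_const_continuous [geometrically_bounded_intros]: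
  assumes "compact S" "continuous_on S f"
  shows "geometrically_bounded_on S (\<lambda>x. fps_const (f x))"
proof -
  have "bounded (f ` S)"
    by (intro compact_imp_bounded compact_continuous_image assms)
  then obtain B where "\<And>x. x \<in> S \<Longrightarrow> norm (f x) \<le> B"
    by (auto simp: bounded_iff)
  then show ?thesis
    by (rule geometrically_bounded_on_fps_const)
qed

lemma geometrically_bounded_on_1 [geometrically_bounded_intros]: "geometrically_bounded_on S (\<lambda>x. 1)"
  using geometrically_bounded_on_fps_const[of S "\<lambda>_. 1"] by fastforce

lemma geometrically_bounded_on_0 [geometrically_bounded_intros]: "geometrically_bounded_on S (\<lambda>x. 0)"
  using geometrically_bounded_on_fps_const[of S "\<lambda>_. 0"] by fastforce

lemma geometrically_bounded_on_X [geometrically_bounded_intros]: "geometrically_bounded_on S (\<lambda>x. fps_X)"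
  by (rule geometrically_bounded_onI[of 1 1]) (auto simp: fps_X_def)

lemma geometrically_bounded_on_minus [geometrically_bounded_intros]:
  "geometrically_bounded_on S f \<Longrightarrow> geometrically_bounded_on S (\<lambda>x. - f x)"
  unfolding geometrically_bounded_on_def by simp

lemma geometrically_bounded_on_add [geometrically_bounded_intros]:
  assumes "geometrically_bounded_on S f" "geometrically_bounded_on S g"
  shows "geometrically_bounded_on S (\<lambda>x. f x + g x)"
proof -
  obtain C C' R where "C \<ge> 0" "C' \<ge> 0" "R \<ge> 0"
    and f: "\<And>x n. x \<in> S \<Longrightarrow> norm (f x $ n) \<le> C * R ^ n"
    and g: "\<And>x n. x \<in> S \<Longrightarrow> norm (g x $ n) \<le> C' * R ^ n"
    using assms by (rule geometrically_bounded_on_common_ratioE) blast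
  moreover have "norm ((f x + g x) $ n) \<le> (C + C') * R ^ n" if "x \<in> S" for x n
    using norm_triangle_mono[OF f[OF that] g[OF that]] by (simp add: distrib_right)
  ultimately show ?thesis
    by (intro geometrically_bounded_onI[of "C + C'" R]) auto
qed

lemma geometrically_bounded_on_diff [geometrically_bounded_intros]:
  assumes "geometrically_bounded_on S f" "geometrically_bounded_on S g"
  shows "geometrically_bounded_on S (\<lambda>x. f x - g x)"
  using geometrically_bounded_on_add[OF assms(1) geometrically_bounded_on_minus[OF assms(2)]] by simp

lemma geometrically_bounded_on_mult [geometrically_bounded_intros]:
  assumes "geometrically_bounded_on S f" "geometrically_bounded_on S g"
  shows "geometrically_bounded_on S (\<lambda>x. f x * g x)"
proof -
  obtain C C' R where nonneg: "C \<ge> 0" "C' \<ge> 0" "R \<ge> 0"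
    and f: "\<And>x n. x \<in> S \<Longrightarrow> norm (f x $ n) \<le> C * R ^ n"
    and g: "\<And>x n. x \<in> S \<Longrightarrow> norm (g x $ n) \<le> C' * R ^ n"
    using assms by (rule geometrically_bounded_on_common_ratioE) blast
  show ?thesis
  proof (rule geometrically_bounded_onI[of "C * C'" "2 * R"])
    fix x n assume x: "x \<in> S"
    have "norm ((f x * g x) $ n) \<le> (\<Sum>i=0..n. C * C' * R ^ n)"
      unfolding fps_mult_nth
    proof (rule sum_norm_le)
      fix i assume i: "i \<in> {0..n}"
      have "norm (f x $ i * g x $ (n - i)) \<le> (C * R ^ i) * (C' * R ^ (n - i))"
        unfolding norm_mult using nonneg by (intro mult_mono f g x) auto
      also have "\<dots> = C * C' * R ^ n"
        using i by (simp flip: power_add)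
      finally show "norm (f x $ i * g x $ (n - i)) \<le> C * C' * R ^ n" .
    qed
    also have "\<dots> = real (Suc n) * (C * C' * R ^ n)"
      by simp
    also have "\<dots> \<le> 2 ^ n * (C * C' * R ^ n)"
    proof (rule mult_right_mono)
      have "Suc n \<le> 2 ^ n"
        by (simp add: Suc_le_eq)
      then show "real (Suc n) \<le> 2 ^ n"
        by (metis of_nat_le_iff of_nat_numeral of_nat_power)
    qed (use nonneg in auto)
    finally show "norm ((f x * g x) $ n) \<le> C * C' * (2 * R) ^ n"
      by (simp add: power_mult_distrib mult_ac)
  qed (use nonneg in auto)
qed

lemma geometrically_bounded_on_prod [geometrically_bounded_intros]:
  "(\<And>i. i \<in> A \<Longrightarrow> geometrically_bounded_on S (f i)) \<Longrightarrow> geometrically_bounded_on S (\<lambda>x. \<Prod>i\<in>A. f i x)"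
  by (induction A rule: infinite_finite_induct) (auto intro: geometrically_bounded_intros)

lemma geometrically_bounded_on_sum [geometrically_bounded_intros]:
  "(\<And>i. i \<in> A \<Longrightarrow> geometrically_bounded_on S (f i)) \<Longrightarrow> geometrically_bounded_on S (\<lambda>x. \<Sum>i\<in>A. f i x)"
  by (induction A rule: infinite_finite_induct) (auto intro: geometrically_bounded_intros)

lemma geometrically_bounded_on_power [geometrically_bounded_intros]:
  "geometrically_bounded_on S f \<Longrightarrow> geometrically_bounded_on S (\<lambda>x. f x ^ m)"
  by (induction m) (auto intro: geometrically_bounded_intros)

lemma pochhammer_le_power_mult_fact:
  assumes "(b::real) > 0"
  shows "pochhammer b n \<le> max 1 b ^ n * fact n"
proof (induction n)
  case (Suc n)
  have "1 * real n \<le> max 1 b * real n"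
    by (intro mult_right_mono) auto
  then have "b + real n \<le> max 1 b * (1 + real n)"
    by (simp add: distrib_left add_mono)
  then have "pochhammer b n * (b + real n) \<le> (max 1 b ^ n * fact n) * (max 1 b * (1 + real n))"
    using Suc assms by (intro mult_mono) (auto simp: pochhammer_nonneg)
  then show ?case
    by (simp add: pochhammer_Suc algebra_simps)
qed auto

lemma geometrically_bounded_on_fps_powr_linear_factor:
  fixes a :: "'a \<Rightarrow> real"
  assumes "b > 0" "\<And>x. x \<in> S \<Longrightarrow> \<bar>a x\<bar> \<le> B"
  shows "geometrically_bounded_on S (\<lambda>x. fps_powr (linear_factor (a x)) (- b))"
proof (rule geometrically_bounded_onI[of 1 "max 1 b * \<bar>B\<bar>"])
  fix x n assume x: "x \<in> S"
  have "norm (fps_powr (linear_factor (a x)) (- b) $ n) = pochhammer b n / fact n * \<bar>a x\<bar> ^ n"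
    using assms(1) by (simp add: fps_powr_linear_factor_nth abs_mult power_abs pochhammer_nonneg)
  also have "\<dots> \<le> max 1 b ^ n * \<bar>B\<bar> ^ n"
    using assms(2)[OF x] pochhammer_le_power_mult_fact[OF assms(1), of n]
    by (intro mult_mono power_mono) (auto simp: divide_le_eq)
  finally show "norm (fps_powr (linear_factor (a x)) (- b) $ n) \<le> 1 * (max 1 b * \<bar>B\<bar>) ^ n"
    by (simp add: power_mult_distrib)
qed auto

section \<open>Dividing the coefficients by Pochhammer symbols\<close>

lemma fact_le_pochhammer:
  assumes "(c::real) \<ge> 1"
  shows "fact n \<le> pochhammer c n"
proof (induction n)
  case (Suc n)
  have "fact n * (1 + real n) \<le> pochhammer c n * (c + real n)"
    using Suc assms by (intro mult_mono) (auto simp: pochhammer_nonneg)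
  then show ?case
    by (simp add: pochhammer_Suc algebra_simps)
qed auto

lemma summable_geometric_div_pochhammer:
  fixes c :: real
  assumes "c \<ge> 1"
  shows "summable (\<lambda>n. C * R ^ n / pochhammer c n)"
proof (rule summable_comparison_test')
  show "summable (\<lambda>n. \<bar>C\<bar> * (inverse (fact n) * \<bar>R\<bar> ^ n))"
    by (intro summable_mult summable_exp)
  fix n
  have "norm (C * R ^ n / pochhammer c n) = \<bar>C\<bar> * \<bar>R\<bar> ^ n / pochhammer c n"
    using assms by (simp add: abs_mult power_abs pochhammer_nonneg)
  also have "\<dots> \<le> \<bar>C\<bar> * \<bar>R\<bar> ^ n / fact n"
    using fact_le_pochhammer[OF assms, of n] pochhammer_pos[of c n] assms
    by (intro divide_left_mono mult_nonneg_nonneg mult_pos_pos) auto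
  finally show "norm (C * R ^ n / pochhammer c n) \<le> \<bar>C\<bar> * (inverse (fact n) * \<bar>R\<bar> ^ n)"
    by (simp add: field_simps)
qed

definition pochhammer_sum :: "real \<Rightarrow> real fps \<Rightarrow> real" where
  "pochhammer_sum c f = (\<Sum>n. f $ n / pochhammer c n)"

definition pochhammer_summable :: "real \<Rightarrow> real fps \<Rightarrow> bool" where
  "pochhammer_summable c f \<longleftrightarrow> summable (\<lambda>n. f $ n / pochhammer c n)"

lemma pochhammer_sums:
  "pochhammer_summable c f \<Longrightarrow> (\<lambda>n. f $ n / pochhammer c n) sums pochhammer_sum c f"
  unfolding pochhammer_summable_def pochhammer_sum_def by (rule summable_sums)

lemma geometrically_bounded_imp_norm_summable:
  fixes f :: "'a \<Rightarrow> real fps"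
  assumes "geometrically_bounded_on S f" "x \<in> S" "c \<ge> 1"
  shows "summable (\<lambda>n. norm (f x $ n / pochhammer c n))"
proof -
  obtain C R where f: "\<And>x n. x \<in> S \<Longrightarrow> norm (f x $ n) \<le> C * R ^ n"
    using assms(1) by (rule geometrically_bounded_onE) blast
  show ?thesis
  proof (rule summable_comparison_test'[OF summable_geometric_div_pochhammer[OF assms(3), of C R]])
    show "norm (norm (f x $ n / pochhammer c n)) \<le> C * R ^ n / pochhammer c n" for n
      using f[OF assms(2)] assms(3) by (auto simp: pochhammer_nonneg intro!: divide_right_mono)
  qed
qed

lemma geometrically_bounded_imp_pochhammer_summable:
  fixes f :: "'a \<Rightarrow> real fps"
  assumes "geometrically_bounded_on S f" "x \<in> S" "c \<ge> 1"
  shows "pochhammer_summable c (f x)"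
  unfolding pochhammer_summable_def
  by (rule summable_norm_cancel[OF geometrically_bounded_imp_norm_summable[OF assms]])

lemma pochhammer_sum_1: "pochhammer_sum c 1 = 1"
proof -
  have "(\<lambda>n. 1 $ n / pochhammer c n) sums (1 $ 0 / pochhammer c 0)"
    by (rule sums_single[of 0 "\<lambda>n. 1 $ n / pochhammer c n", THEN sums_cong[THEN iffD1, rotated]]) auto
  then show ?thesis
    by (simp add: pochhammer_sum_def sums_iff)
qed

lemma pochhammer_sum_X_mult_XDp:
  assumes "c > 0" "pochhammer_summable c f"
  shows "(\<lambda>n. (fps_X * fps_XDp c f) $ n / pochhammer c n) sums pochhammer_sum c f"
proof -
  have "(fps_X * fps_XDp c f) $ Suc n / pochhammer c (Suc n) = f $ n / pochhammer c n" for n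
    using assms(1) by (simp add: pochhammer_Suc add_pos_nonneg)
  then have "(\<lambda>n. (fps_X * fps_XDp c f) $ Suc n / pochhammer c (Suc n)) sums pochhammer_sum c f"
    using pochhammer_sums[OF assms(2)] by simp
  then show ?thesis
    by (subst (asm) sums_Suc_iff) simp
qed

lemma pochhammer_sum_X_power_mult:
  assumes "pochhammer_summable (c + real k) f"
  shows "pochhammer_sum c (fps_X ^ k * f) = pochhammer_sum (c + real k) f / pochhammer c k"
proof -
  have "f $ n / pochhammer (c + real k) n / pochhammer c k
      = (fps_X ^ k * f) $ (n + k) / pochhammer c (n + k)" for n
    using pochhammer_product'[of c k n] by (simp add: fps_X_power_mult_nth add.commute[of n k] mult.commute[of "pochhammer c k"])
  then have "(\<lambda>n. (fps_X ^ k * f) $ (n + k) / pochhammer c (n + k))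
      sums (pochhammer_sum (c + real k) f / pochhammer c k)"
    using sums_divide[OF pochhammer_sums[OF assms], of "pochhammer c k"] by simp
  moreover have "(\<Sum>i<k. (fps_X ^ k * f) $ i / pochhammer c i) = 0"
    by (simp add: fps_X_power_mult_nth)
  ultimately have "(\<lambda>n. (fps_X ^ k * f) $ n / pochhammer c n)
      sums (pochhammer_sum (c + real k) f / pochhammer c k)"
    by (simp add: sums_iff_shift[of "\<lambda>n. (fps_X ^ k * f) $ n / pochhammer c n" k])
  then show ?thesis
    by (simp add: pochhammer_sum_def sums_iff)
qed

lemma pochhammer_sum_add:
  assumes "pochhammer_summable c f" "pochhammer_summable c g"
  shows "pochhammer_sum c (f + g) = pochhammer_sum c f + pochhammer_sum c g"
  using sums_add[OF assms[THEN pochhammer_sums]] by (simp add: pochhammer_sum_def sums_iff add_divide_distrib)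

lemma pochhammer_sum_const_mult:
  assumes "pochhammer_summable c f"
  shows "pochhammer_sum c (fps_const a * f) = a * pochhammer_sum c f"
  using sums_mult[OF pochhammer_sums[OF assms], of a] by (simp add: pochhammer_sum_def sums_iff)

lemma pochhammer_sum_uniform_limit:
  fixes f :: "'a \<Rightarrow> real fps"
  assumes "c \<ge> 1" "geometrically_bounded_on S f"
  shows "uniform_limit S (\<lambda>n x. \<Sum>i<n. f x $ i / pochhammer c i) (\<lambda>x. pochhammer_sum c (f x)) sequentially"
proof -
  obtain C R where f: "\<And>x n. x \<in> S \<Longrightarrow> norm (f x $ n) \<le> C * R ^ n"
    using assms(2) by (rule geometrically_bounded_onE) blast
  show ?thesis
    unfolding pochhammer_sum_def
  proof (rule Weierstrass_m_test)
    show "summable (\<lambda>n. C * R ^ n / pochhammer c n)"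
      by (rule summable_geometric_div_pochhammer[OF assms(1)])
    show "norm (f x $ n / pochhammer c n) \<le> C * R ^ n / pochhammer c n" if "x \<in> S" for n x
      using f[OF that] assms(1) by (auto simp: pochhammer_nonneg intro!: divide_right_mono)
  qed
qed

lemma continuous_on_pochhammer_sum:
  fixes f :: "'a::topological_space \<Rightarrow> real fps"
  assumes "c \<ge> 1" "geometrically_bounded_on S f" "fps_continuous_on S f"
  shows "continuous_on S (\<lambda>x. pochhammer_sum c (f x))"
proof (rule uniform_limit_theorem[OF _ pochhammer_sum_uniform_limit[OF assms(1,2)]])
  show "\<forall>\<^sub>F n in sequentially. continuous_on S (\<lambda>x. \<Sum>i<n. f x $ i / pochhammer c i)"
    unfolding divide_inverse
    by (intro always_eventually allI continuous_intros fps_continuous_on_nth assms(3))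
qed simp

lemma linear_eq_sum_Basis:
  fixes f :: "'a::euclidean_space \<Rightarrow> 'b::real_vector"
  assumes "linear f"
  shows "f h = (\<Sum>b\<in>Basis. (h \<bullet> b) *\<^sub>R f b)"
  using assms by (metis (no_types, lifting) euclidean_representation linear_scale linear_sum sum.cong)

lemma norm_sum_Basis_le:
  fixes d :: "'a::euclidean_space \<Rightarrow> 'b::real_normed_vector"
  assumes "\<And>b. b \<in> Basis \<Longrightarrow> norm (d b) \<le> e"
  shows "norm (\<Sum>b\<in>Basis. (h \<bullet> b) *\<^sub>R d b) \<le> real DIM('a) * e * norm h"
proof -
  have "norm ((h \<bullet> b) *\<^sub>R d b) \<le> norm h * e" if "b \<in> Basis" for b
    using that assms by (auto intro!: mult_mono Basis_le_norm)
  from sum_norm_le[of Basis "\<lambda>b. (h \<bullet> b) *\<^sub>R d b", OF this] show ?thesis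
    by (simp add: mult_ac)
qed

lemma pochhammer_sum_eq_sum_Basis:
  fixes f :: "'a::euclidean_space \<Rightarrow> real fps"
  assumes linear: "\<And>n. linear (\<lambda>h. f h $ n)" and "\<And>b. b \<in> Basis \<Longrightarrow> pochhammer_summable c (f b)"
  shows "pochhammer_sum c (f h) = (\<Sum>b\<in>Basis. (h \<bullet> b) *\<^sub>R pochhammer_sum c (f b))"
proof -
  have "(\<lambda>n. \<Sum>b\<in>Basis. (h \<bullet> b) *\<^sub>R (f b $ n / pochhammer c n))
      sums (\<Sum>b\<in>Basis. (h \<bullet> b) *\<^sub>R pochhammer_sum c (f b))"
    by (intro sums_sum sums_scaleR_right pochhammer_sums assms(2))
  moreover have "f h $ n / pochhammer c n = (\<Sum>b\<in>Basis. (h \<bullet> b) *\<^sub>R (f b $ n / pochhammer c n))" for n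
    by (subst linear_eq_sum_Basis[OF linear]) (simp add: sum_divide_distrib)
  ultimately show ?thesis
    by (simp add: pochhammer_sum_def sums_iff)
qed

lemma pochhammer_sum_remainder_le:
  fixes f :: "'a::euclidean_space \<Rightarrow> real fps"
  assumes linear: "\<And>n. linear (\<lambda>h. f h $ n)" and "\<And>b. b \<in> Basis \<Longrightarrow> pochhammer_summable c (f b)"
    and "\<And>b. b \<in> Basis \<Longrightarrow> \<bar>(\<Sum>i<n. f b $ i / pochhammer c i) - pochhammer_sum c (f b)\<bar> \<le> e"
  shows "\<bar>(\<Sum>i<n. f h $ i / pochhammer c i) - pochhammer_sum c (f h)\<bar> \<le> real DIM('a) * e * norm h"
proof -
  let ?s = "\<lambda>h. \<Sum>i<n. f h $ i / pochhammer c i"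
  have "linear ?s"
    by (intro linearI)
      (simp_all add: linear_add[OF linear] linear_scale[OF linear] add_divide_distrib sum.distrib sum_distrib_left)
  then have "?s h = (\<Sum>b\<in>Basis. (h \<bullet> b) *\<^sub>R ?s b)"
    by (rule linear_eq_sum_Basis)
  moreover have "pochhammer_sum c (f h) = (\<Sum>b\<in>Basis. (h \<bullet> b) *\<^sub>R pochhammer_sum c (f b))"
    by (rule pochhammer_sum_eq_sum_Basis[OF assms(1,2)])
  ultimately have "?s h - pochhammer_sum c (f h) = (\<Sum>b\<in>Basis. (h \<bullet> b) *\<^sub>R (?s b - pochhammer_sum c (f b)))"
    by (simp only: sum_subtractf scaleR_diff_right)
  then show ?thesis
    using norm_sum_Basis_le[of "\<lambda>b. ?s b - pochhammer_sum c (f b)" e h] assms(3) by simp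
qed

lemma pochhammer_sum_has_derivative:
  fixes f :: "'a::euclidean_space \<Rightarrow> real fps"
  assumes c_ge_1: "c \<ge> 1" and S: "open S" "convex S" and x: "x \<in> S"
    and der: "\<And>x. x \<in> S \<Longrightarrow> fps_has_derivative f (f' x) x"
    and bounded: "geometrically_bounded_on S f"
    and bounded': "\<And>h. geometrically_bounded_on S (\<lambda>x. f' x h)"
  shows "((\<lambda>x. pochhammer_sum c (f x)) has_derivative (\<lambda>h. pochhammer_sum c (f' x h))) (at x)"
proof -
  let ?g' = "\<lambda>x h. pochhammer_sum c (f' x h)" and ?s = "\<lambda>n x h. \<Sum>i<n. f' x h $ i / pochhammer c i"
  have linear: "linear (\<lambda>h. f' y h $ n)" if "y \<in> S" for y n
    using fps_has_derivative_nth[OF der[OF that]] by (rule has_derivative_linear)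
  have "\<exists>g. \<forall>y\<in>S. (\<lambda>n. f y $ n / pochhammer c n) sums g y \<and> (g has_derivative ?g' y) (at y within S)"
  proof (rule has_derivative_series[OF S(2) _ _ x])
    show "((\<lambda>y. f y $ n / pochhammer c n) has_derivative (\<lambda>h. f' y h $ n / pochhammer c n)) (at y within S)"
      if "y \<in> S" for n y
      using has_derivative_mult_left[OF has_derivative_at_withinI[OF fps_has_derivative_nth[OF der[OF that]]]]
      unfolding divide_inverse .
    show "(\<lambda>n. f x $ n / pochhammer c n) sums pochhammer_sum c (f x)"
      by (rule pochhammer_sums[OF geometrically_bounded_imp_pochhammer_summable[OF bounded x c_ge_1]])
    fix e :: real assume "e > 0"
    then have "\<forall>\<^sub>F n in sequentially. \<forall>b\<in>Basis. \<forall>y\<in>S. dist (?s n y b) (?g' y b) < e / real DIM('a)"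
      using pochhammer_sum_uniform_limit[OF c_ge_1 bounded']
      by (auto simp: uniform_limit_iff eventually_ball_finite_distrib)
    then show "\<forall>\<^sub>F n in sequentially. \<forall>y\<in>S. \<forall>h. norm (?s n y h - ?g' y h) \<le> e * norm h"
    proof eventually_elim
      case (elim n)
      have "norm (?s n y h - ?g' y h) \<le> real DIM('a) * (e / real DIM('a)) * norm h" if "y \<in> S" for y h
        unfolding real_norm_def
        using elim that
        by (intro pochhammer_sum_remainder_le linear geometrically_bounded_imp_pochhammer_summable[OF bounded' _ c_ge_1])
          (auto simp: dist_real_def less_imp_le)
      then show ?case
        by simp
    qed
  qed
  then obtain g where g: "\<And>y. y \<in> S \<Longrightarrow> (\<lambda>n. f y $ n / pochhammer c n) sums g y"
    "\<And>y. y \<in> S \<Longrightarrow> (g has_derivative ?g' y) (at y within S)"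
    by blast
  have "(g has_derivative ?g' x) (at x)"
    using g(2)[OF x] at_within_open[OF x S(1)] by simp
  then show ?thesis
    by (rule has_derivative_transform_within_open[OF _ S(1) x])
      (use g(1) in \<open>simp add: pochhammer_sum_def sums_iff\<close>)
qed

section \<open>Humbert series\<close>

definition humbert_term :: "nat \<Rightarrow> (nat \<Rightarrow> real) \<Rightarrow> real \<Rightarrow> (nat \<Rightarrow> real) \<Rightarrow> (nat \<Rightarrow> nat) \<Rightarrow> real" where
  "humbert_term m b c x js =
    (\<Prod>i<m. pochhammer (b i) (js i) * x i ^ js i / fact (js i)) / pochhammer c (\<Sum>i<m. js i)"

lemma humbert2_eq_infsum: "humbert2 m b c x = (\<Sum>\<^sub>\<infinity>js\<in>{js. \<forall>i\<ge>m. js i = 0}. humbert_term m b c x js)"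
  by (simp add: humbert2_def humbert_term_def)

lemma abs_humbert_term:
  assumes "c \<ge> 1" "\<And>i. i < m \<Longrightarrow> b i > 0"
  shows "\<bar>humbert_term m b c x js\<bar> = humbert_term m b c (\<lambda>i. \<bar>x i\<bar>) js"
proof -
  have "\<bar>\<Prod>i<m. pochhammer (b i) (js i) * x i ^ js i / fact (js i)\<bar>
      = (\<Prod>i<m. pochhammer (b i) (js i) * \<bar>x i\<bar> ^ js i / fact (js i))"
    unfolding abs_prod using assms(2)
    by (intro prod.cong) (auto simp: abs_mult power_abs pochhammer_nonneg)
  then show ?thesis
    using assms(1) by (simp add: humbert_term_def pochhammer_nonneg)
qed

lemma sum_count_multisets_of_size:
  assumes "finite A" "X \<in> multisets_of_size A n"
  shows "(\<Sum>x\<in>A. count X x) = n"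
proof -
  have "(\<Sum>x\<in>A. count X x) = (\<Sum>x\<in>set_mset X. count X x)"
    using assms by (intro sum.mono_neutral_right) (auto simp: multisets_of_size_def not_in_iff)
  then show ?thesis
    using assms(2) by (simp add: multisets_of_size_def size_multiset_overloaded_eq)
qed

lemma sum_humbert_term:
  "(\<Sum>X\<in>multisets_of_size {..<m} n. humbert_term m b c x (count X))
    = (\<Prod>i<m. fps_powr (linear_factor (x i)) (- b i)) $ n / pochhammer c n"
  unfolding fps_prod_nth'[OF finite_lessThan] fps_powr_linear_factor_nth sum_divide_distrib humbert_term_def
  by (intro sum.cong refl) (simp add: sum_count_multisets_of_size)

lemma count_Abs_multiset_bounded_support:
  fixes m :: nat
  assumes "\<forall>i\<ge>m. js i = 0"
  shows "count (Abs_multiset js) = js" and "set_mset (Abs_multiset js) \<subseteq> {..<m}"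
proof -
  have support: "{i. 0 < js i} \<subseteq> {..<m}"
    using assms by (force simp: not_less intro: ccontr)
  then show count: "count (Abs_multiset js) = js"
    by (simp add: finite_subset)
  show "set_mset (Abs_multiset js) \<subseteq> {..<m}"
    unfolding set_mset_def count by (rule support)
qed

lemma bij_betw_count_multisets_of_size:
  fixes m :: nat
  shows "bij_betw (\<lambda>(n, X). count X) (SIGMA n:UNIV. multisets_of_size {..<m} n) {js. \<forall>i\<ge>m. js i = 0}"
proof (rule bij_betwI[where g = "\<lambda>js. (size (Abs_multiset js), Abs_multiset js)"])
  show "(\<lambda>(n, X). count X) \<in> (SIGMA n:UNIV. multisets_of_size {..<m} n) \<rightarrow> {js. \<forall>i\<ge>m. js i = 0}"
    by (force simp: multisets_of_size_def count_eq_zero_iff)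
  show "(\<lambda>js. (size (Abs_multiset js), Abs_multiset js))
      \<in> {js. \<forall>i\<ge>m. js i = 0} \<rightarrow> (SIGMA n:UNIV. multisets_of_size {..<m} n)"
    using count_Abs_multiset_bounded_support(2) by (auto simp: multisets_of_size_def)
qed (auto simp: multisets_of_size_def count_Abs_multiset_bounded_support)

lemma humbert_term_summable:
  assumes "c \<ge> 1" "\<And>i. i < m \<Longrightarrow> b i > 0"
  shows "(\<lambda>(n, X). humbert_term m b c x (count X)) summable_on (SIGMA n:UNIV. multisets_of_size {..<m} n)"
proof (rule Infinite_Sum.abs_summable_summable, unfold Infinite_Sum.abs_summable_on_Sigma_iff, intro conjI ballI)
  let ?F = "\<lambda>x. \<Prod>i<m. fps_powr (linear_factor (x i)) (- b i)" and ?abs = "\<lambda>i. \<bar>x i\<bar>"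
  have "geometrically_bounded_on UNIV (\<lambda>_::unit. ?F ?abs)"
    using assms(2)
    by (intro geometrically_bounded_intros geometrically_bounded_on_fps_powr_linear_factor) auto
  from geometrically_bounded_imp_norm_summable[OF this UNIV_I assms(1)]
  have "(\<lambda>n. ?F ?abs $ n / pochhammer c n) summable_on UNIV"
    by (rule norm_summable_imp_summable_on)
  moreover have "(\<Sum>\<^sub>\<infinity>X\<in>multisets_of_size {..<m} n. \<bar>humbert_term m b c x (count X)\<bar>)
      = ?F ?abs $ n / pochhammer c n" for n
    by (simp add: abs_humbert_term[OF assms] sum_humbert_term finite_multisets_of_size)
  moreover have "?F ?abs $ n / pochhammer c n \<ge> 0" for n
    unfolding sum_humbert_term[symmetric] by (simp add: sum_nonneg flip: abs_humbert_term[OF assms])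
  ultimately show "(\<lambda>n. norm (\<Sum>\<^sub>\<infinity>X\<in>multisets_of_size {..<m} n.
      norm (case (n, X) of (n, X) \<Rightarrow> humbert_term m b c x (count X)))) summable_on UNIV"
    by (simp only: case_prod_conv real_norm_def abs_of_nonneg)
qed (simp add: finite_multisets_of_size)

lemma humbert2_eq_pochhammer_sum:
  assumes "c \<ge> 1" "\<And>i. i < m \<Longrightarrow> b i > 0"
  shows "humbert2 m b c x = pochhammer_sum c (\<Prod>i<m. fps_powr (linear_factor (x i)) (- b i))"
proof -
  let ?S = "SIGMA n:UNIV. multisets_of_size {..<m} n"
  note summable = humbert_term_summable[where b = b, OF assms]
  have "humbert2 m b c x = (\<Sum>\<^sub>\<infinity>(n, X)\<in>?S. humbert_term m b c x (count X))"
    unfolding humbert2_eq_infsum infsum_reindex_bij_betw[OF bij_betw_count_multisets_of_size, symmetric]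
    by (simp add: case_prod_unfold)
  also have "\<dots> = (\<Sum>\<^sub>\<infinity>n. \<Sum>\<^sub>\<infinity>X\<in>multisets_of_size {..<m} n. humbert_term m b c x (count X))"
    by (rule infsum_Sigma'_banach[OF summable, symmetric])
  also have "\<dots> = pochhammer_sum c (\<Prod>i<m. fps_powr (linear_factor (x i)) (- b i))"
    using has_sum_imp_sums[OF has_sum_infsum[OF summable_on_Sigma_banach[OF summable]]]
    by (simp add: sum_humbert_term pochhammer_sum_def sums_iff finite_multisets_of_size)
  finally show ?thesis .
qed

section \<open>Uniqueness of the Dunkl kernel\<close>

lemma cinner_eq_inner: "cinner z w = z \<bullet> w"
  by (simp add: cinner_def inner_complex_def)

lemma norm_dih_refl [simp]: "cmod (dih_refl k j z) = cmod z"
  by (simp add: dih_refl_def norm_mult)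

lemma closure_dih_regular: "closure {x. dih_regular k x} = UNIV"
proof -
  let ?mirrors = "\<Union>j\<in>{..<2*k}. {x. dih_root k j \<bullet> x = 0}"
  have "negligible ?mirrors"
    by (rule negligible_Union) (auto simp: dih_root_def intro!: negligible_hyperplane)
  then have "interior ?mirrors = {}"
    using negligible_subset open_interior interior_subset open_not_negligible by metis
  moreover have "{x. dih_regular k x} = - ?mirrors"
    by (auto simp: dih_regular_def cinner_eq_inner)
  ultimately show ?thesis
    by (metis closure_complement Compl_empty_eq)
qed

lemma linear_complex_eq:
  fixes f :: "complex \<Rightarrow> 'a::real_vector"
  assumes "linear f"
  shows "f h = Re h *\<^sub>R f 1 + Im h *\<^sub>R f \<i>"
  by (subst linear_eq_sum_Basis[OF assms]) (simp add: Basis_complex_def inner_complex_def)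

lemma linear_dunkl_op:
  assumes "f differentiable (at x)"
  shows "linear (\<lambda>\<xi>. dunkl_op k \<alpha> \<beta> \<xi> f x)"
proof -
  have "linear (frechet_derivative f (at x))"
    by (rule linear_frechet_derivative[OF assms])
  then show ?thesis
    unfolding dunkl_op_def cinner_eq_inner
    by (intro linearI)
      (simp_all add: linear_add linear_scale inner_add_right algebra_simps add_divide_distrib
        sum.distrib sum_distrib_left sum_subtractf diff_divide_distrib)
qed

lemma dunkl_op_radial:
  assumes "dih_regular k x"
  shows "dunkl_op k \<alpha> \<beta> x f x
    = frechet_derivative f (at x) x + (\<Sum>j<2*k. dih_mult \<alpha> \<beta> j * (f x - f (dih_refl k j x)))"
  using assms unfolding dunkl_op_def dih_regular_def
  by (intro arg_cong2[where f = "(+)"] sum.cong refl) (simp add: field_simps)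

lemma dunkl_op_kernel:
  assumes "is_dunkl_kernel k \<alpha> \<beta> w f" "dih_regular k x"
  shows "dunkl_op k \<alpha> \<beta> \<xi> f x = cinner \<xi> w * f x"
proof -
  let ?T = "\<lambda>\<xi>. dunkl_op k \<alpha> \<beta> \<xi> f x"
  have "linear ?T"
    using assms(1) by (intro linear_dunkl_op) (simp add: is_dunkl_kernel_def)
  then have "?T \<xi> = Re \<xi> *\<^sub>R ?T 1 + Im \<xi> *\<^sub>R ?T \<i>"
    by (rule linear_complex_eq)
  also have "?T 1 = cinner 1 w * f x"
    using assms by (simp add: is_dunkl_kernel_def)
  also have "?T \<i> = cinner \<i> w * f x"
    using assms by (simp add: is_dunkl_kernel_def)
  finally show ?thesis
    by (simp add: cinner_def algebra_simps)
qed

lemma dunkl_kernel_radial: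
  assumes "is_dunkl_kernel k \<alpha> \<beta> w f"
  shows "frechet_derivative f (at x) x + (\<Sum>j<2*k. dih_mult \<alpha> \<beta> j * (f x - f (dih_refl k j x)))
    = cinner x w * f x" (is "?radial x")
proof -
  have diff: "f differentiable (at x)" for x
    using assms by (simp add: is_dunkl_kernel_def)
  have f: "continuous_on UNIV f"
    using diff by (intro continuous_at_imp_continuous_on ballI differentiable_imp_continuous_within)
  have "continuous_on UNIV (\<lambda>x. frechet_derivative f (at x) x)"
    using assms
    by (subst linear_complex_eq[OF linear_frechet_derivative[OF diff]])
      (auto simp: is_dunkl_kernel_def intro!: continuous_intros)
  moreover have "continuous_on UNIV (\<lambda>x. f (dih_refl k j x))" for j
    unfolding dih_refl_def by (intro continuous_on_compose2[OF f] continuous_intros) auto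
  ultimately have "closed {x. ?radial x}"
    unfolding cinner_eq_inner by (intro closed_Collect_eq continuous_intros f)
  moreover have "{x. dih_regular k x} \<subseteq> {x. ?radial x}"
    using dunkl_op_kernel[OF assms] by (auto simp flip: dunkl_op_radial)
  ultimately have "closure {x. dih_regular k x} \<subseteq> {x. ?radial x}"
    by (intro closure_minimal)
  then show ?thesis
    unfolding closure_dih_regular by auto
qed

lemma radial_derivative_ge_at_max:
  fixes d :: "'a::real_normed_vector \<Rightarrow> real"
  assumes der: "(d has_derivative d') (at z)"
    and max: "\<And>t. 0 < t \<Longrightarrow> t < 1 \<Longrightarrow> d (t *\<^sub>R z) * exp (- (C * (t * norm z))) \<le> d z * exp (- (C * norm z))"
  shows "C * norm z * d z \<le> d' z"
proof (rule ccontr)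
  assume "\<not> C * norm z * d z \<le> d' z"
  then have neg: "(d' z - C * norm z * d z) * exp (- (C * norm z)) < 0"
    by (simp add: mult_less_0_iff)
  define \<psi> where "\<psi> = (\<lambda>t. d (t *\<^sub>R z) * exp (- (C * (t * norm z))))"
  have "(d has_derivative d') (at (1 *\<^sub>R z))"
    using der by simp
  moreover have "((\<lambda>t. t *\<^sub>R z) has_derivative (\<lambda>t. t *\<^sub>R z)) (at (1::real))"
    by (auto intro!: derivative_eq_intros)
  ultimately have "((\<lambda>t. d (t *\<^sub>R z)) has_derivative (\<lambda>t. d' (t *\<^sub>R z))) (at 1)"
    by (rule has_derivative_compose[rotated])
  then have "((\<lambda>t. d (t *\<^sub>R z)) has_real_derivative d' z) (at 1)"
    using has_derivative_linear[OF der]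
    by (simp add: has_field_derivative_def linear_scale mult_commute_abs)
  then have "(\<psi> has_real_derivative (d' z - C * norm z * d z) * exp (- (C * norm z))) (at 1)"
    unfolding \<psi>_def by (auto intro!: derivative_eq_intros simp: algebra_simps)
  from DERIV_neg_dec_left[OF this neg]
  obtain \<delta> where \<delta>: "\<delta> > 0" "\<And>h. h > 0 \<Longrightarrow> h < \<delta> \<Longrightarrow> \<psi> 1 < \<psi> (1 - h)"
    by blast
  define h where "h = min (\<delta> / 2) (1 / 2)"
  have h: "h > 0" "h < \<delta>" "h < 1"
    using \<delta>(1) by (auto simp: h_def min_def)
  then have "\<psi> (1 - h) \<le> \<psi> 1"
    using max[of "1 - h"] by (simp add: \<psi>_def)
  then show False
    using \<delta>(2)[of h] h by simp
qed

lemma radial_reflection_equation_nonpos: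
  fixes d :: "'a::euclidean_space \<Rightarrow> real"
  assumes der: "\<And>x. (d has_derivative d' x) (at x)"
    and radial: "\<And>x. d' x x + (\<Sum>j\<in>A. \<kappa> j * (d x - d (s j x))) = (x \<bullet> w) * d x"
    and \<kappa>: "\<And>j. j \<in> A \<Longrightarrow> \<kappa> j \<ge> 0" and isometry: "\<And>j x. norm (s j x) = norm x" and "d 0 = 0"
  shows "d x \<le> 0"
proof (rule ccontr)
  assume "\<not> d x \<le> 0"
  define C where "C = norm w + 1"
  define \<phi> where "\<phi> = (\<lambda>y. d y * exp (- (C * norm y)))"
  have "continuous_on UNIV d"
    using der by (intro continuous_at_imp_continuous_on ballI) (metis has_derivative_continuous)
  then have "continuous_on (cball 0 (norm x)) \<phi>"
    unfolding \<phi>_def by (intro continuous_intros) (auto intro: continuous_on_subset)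
  then obtain z where z: "z \<in> cball 0 (norm x)" and max: "\<And>y. y \<in> cball 0 (norm x) \<Longrightarrow> \<phi> y \<le> \<phi> z"
    using continuous_attains_sup[of "cball 0 (norm x)" \<phi>]
    by (metis compact_cball norm_ge_zero cball_eq_empty not_less)
  have "0 < \<phi> x"
    using \<open>\<not> d x \<le> 0\<close> by (simp add: \<phi>_def)
  also have "\<phi> x \<le> \<phi> z"
    by (intro max) simp
  finally have pos: "d z > 0"
    by (simp add: \<phi>_def zero_less_mult_iff)
  have "\<phi> (t *\<^sub>R z) \<le> \<phi> z" if "0 < t" "t < 1" for t
    using z that by (intro max) (simp add: mult_le_one mult_left_le_one_le[THEN order.trans])
  then have "C * norm z * d z \<le> d' z z"
    by (intro radial_derivative_ge_at_max[OF der]) (simp add: \<phi>_def)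
  moreover have "d (s j z) \<le> d z" for j
    using max[of "s j z"] z isometry by (simp add: \<phi>_def)
  then have "(\<Sum>j\<in>A. \<kappa> j * (d z - d (s j z))) \<ge> 0"
    using \<kappa> by (intro sum_nonneg) auto
  moreover have "(z \<bullet> w) * d z \<le> norm z * norm w * d z"
    using pos norm_cauchy_schwarz[of z w] by (intro mult_right_mono) auto
  ultimately have "norm z * d z \<le> 0"
    using radial[of z] by (simp add: C_def algebra_simps)
  then show False
    using pos \<open>d 0 = 0\<close> by (auto simp: mult_le_0_iff)
qed

lemma is_dunkl_kernel_unique:
  assumes "\<alpha> \<ge> 0" "\<beta> \<ge> 0" "is_dunkl_kernel k \<alpha> \<beta> w f" "is_dunkl_kernel k \<alpha> \<beta> w g"
  shows "f = g"
proof -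
  have "f x - g x \<le> 0" if f: "is_dunkl_kernel k \<alpha> \<beta> w f" and g: "is_dunkl_kernel k \<alpha> \<beta> w g" for f g x
  proof (rule radial_reflection_equation_nonpos[where s = "dih_refl k" and A = "{..<2*k}"
        and \<kappa> = "dih_mult \<alpha> \<beta>" and w = w
        and d' = "\<lambda>x h. frechet_derivative f (at x) h - frechet_derivative g (at x) h"])
    show "((\<lambda>x. f x - g x) has_derivative
        (\<lambda>h. frechet_derivative f (at x) h - frechet_derivative g (at x) h)) (at x)" for x
      using f g unfolding is_dunkl_kernel_def
      by (intro has_derivative_diff) (auto simp: frechet_derivative_works)
    show "(frechet_derivative f (at x) x - frechet_derivative g (at x) x) +
      (\<Sum>j<2*k. dih_mult \<alpha> \<beta> j * (f x - g x - (f (dih_refl k j x) - g (dih_refl k j x))))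
        = (x \<bullet> w) * (f x - g x)" for x
      using dunkl_kernel_radial[OF f, of x] dunkl_kernel_radial[OF g, of x]
      by (simp add: cinner_eq_inner algebra_simps sum.distrib sum_subtractf)
    show "f 0 - g 0 = 0"
      using f g by (simp add: is_dunkl_kernel_def)
  qed (use assms(1,2) in \<open>auto simp: dih_mult_def\<close>)
  from this[OF assms(3,4)] this[OF assms(4,3)] show ?thesis
    by (intro ext antisym) auto
qed

lemma dunkl_kernel_eqI:
  assumes "\<alpha> \<ge> 0" "\<beta> \<ge> 0" "is_dunkl_kernel k \<alpha> \<beta> w f"
  shows "dunkl_kernel k \<alpha> \<beta> z w = f z"
  unfolding dunkl_kernel_def using is_dunkl_kernel_unique[OF assms(1,2) _ assms(3)] assms(3)
  by (metis the_equality)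

section \<open>Dirichlet integrals over the simplex\<close>

lemma simplexT_measurable [measurable]: "simplexT k \<in> sets (PiM {..<k} (\<lambda>_. lborel))"
proof -
  have "simplexT k =
      {t \<in> space (PiM {..<k} (\<lambda>_. lborel :: real measure)). (\<forall>j\<in>{..<k}. t j > 0) \<and> (\<Sum>j<k. t j) < 1}"
    by (auto simp: simplexT_def space_PiM)
  also have "\<dots> \<in> sets (PiM {..<k} (\<lambda>_. lborel))"
    by measurable
  finally show ?thesis .
qed

lemma nn_integral_Beta:
  assumes "a > 0" "c > (0::real)"
  shows "(\<integral>\<^sup>+y. ennreal (indicator {0<..<1} y * (y powr (a - 1) * (1 - y) powr (c - 1))) \<partial>lborel) = ennreal (Beta a c)"
proof -
  let ?f = "\<lambda>t. t powr (a - 1) * (1 - t) powr (c - 1)"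
  have "(\<integral>\<^sup>+y. ennreal (indicator {0<..<1} y * ?f y) \<partial>lborel) = (\<integral>\<^sup>+y. ennreal (indicator {0..1} y *\<^sub>R ?f y) \<partial>lborel)"
    by (intro nn_integral_cong) (auto simp: indicator_def)
  also have "\<dots> = ennreal (\<integral>y. indicator {0..1} y *\<^sub>R ?f y \<partial>lborel)"
    using integrable_Beta[OF assms] unfolding set_integrable_def
    by (intro nn_integral_eq_integral) auto
  also have "(\<integral>y. indicator {0..1} y *\<^sub>R ?f y \<partial>lborel) = Beta a c"
    using set_borel_integral_eq_integral(2)[OF integrable_Beta[OF assms]]
      integral_unique[OF has_integral_Beta_real[OF assms]]
    unfolding set_lebesgue_integral_def by simp
  finally show ?thesis .
qed

lemma powr_Beta_integrand_scale:
  fixes r :: real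
  assumes "r > 0"
  shows "indicator {0<..<r} (r * y) * ((r * y) powr (a - 1) * (r - r * y) powr (c - 1))
    = r powr (a + c - 2) * (indicator {0<..<1} y * (y powr (a - 1) * (1 - y) powr (c - 1)))"
proof (cases "0 < y \<and> y < 1")
  case True
  have "(r - r * y) powr (c - 1) = r powr (c - 1) * (1 - y) powr (c - 1)"
    using True assms powr_mult[of r "1 - y" "c - 1"] by (simp add: algebra_simps)
  moreover have "(r * y) powr (a - 1) = r powr (a - 1) * y powr (a - 1)"
    using True assms by (simp add: powr_mult)
  moreover have "r powr (a + c - 2) = r powr (a - 1) * r powr (c - 1)"
    unfolding powr_add[symmetric] by (simp add: algebra_simps)
  ultimately show ?thesis
    using True assms by simp
qed (use assms in \<open>auto simp: indicator_def zero_less_mult_iff\<close>)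

lemma nn_integral_Beta_scaled:
  assumes "a > 0" "c > (0::real)" "r > 0"
  shows "(\<integral>\<^sup>+y. ennreal (indicator {0<..<r} y * (y powr (a - 1) * (r - y) powr (c - 1))) \<partial>lborel)
     = ennreal (r powr (a + c - 1) * Beta a c)"
proof -
  let ?f = "\<lambda>r y. indicator {0<..<r} y * (y powr (a - 1) * (r - y) powr (c - 1))"
  have "(\<integral>\<^sup>+y. ennreal (?f r y) \<partial>lborel) = ennreal \<bar>r\<bar> * (\<integral>\<^sup>+y. ennreal (?f r (0 + r * y)) \<partial>lborel)"
    using assms by (intro nn_integral_real_affine) auto
  also have "\<dots> = ennreal r * (\<integral>\<^sup>+y. ennreal (r powr (a + c - 2)) * ennreal (?f 1 y) \<partial>lborel)"
    using assms(3) by (simp only: add_0 powr_Beta_integrand_scale ennreal_mult' powr_ge_zero abs_of_pos)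
  also have "\<dots> = ennreal r * (ennreal (r powr (a + c - 2)) * ennreal (Beta a c))"
    by (subst nn_integral_cmult) (auto simp: nn_integral_Beta[OF assms(1,2)])
  also have "\<dots> = ennreal ((r * r powr (a + c - 2)) * Beta a c)"
    using assms(3) by (simp add: ennreal_mult'[symmetric] mult.assoc)
  also have "r * r powr (a + c - 2) = r powr (a + c - 1)"
    using assms(3) powr_add[of r 1 "a + c - 2"] by simp
  finally show ?thesis .
qed

lemma Gamma_real_nonzero: "x > (0::real) \<Longrightarrow> Gamma x \<noteq> 0"
  using Gamma_real_pos by fastforce

lemma Beta_real_pos: "a > 0 \<Longrightarrow> b > (0::real) \<Longrightarrow> Beta a b > 0"
  by (simp add: Beta_def)

definition dirichlet_density :: "nat \<Rightarrow> (nat \<Rightarrow> real) \<Rightarrow> real \<Rightarrow> (nat \<Rightarrow> real) \<Rightarrow> real" where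
  "dirichlet_density k b c t =
     indicator (simplexT k) t * ((\<Prod>j<k. t j powr (b j - 1)) * (1 - (\<Sum>j<k. t j)) powr (c - 1))"

lemma dirichlet_density_measurable [measurable]:
  "dirichlet_density k b c \<in> borel_measurable (PiM {..<k} (\<lambda>_. lborel))"
  unfolding dirichlet_density_def by measurable

lemma dirichlet_density_nonneg: "dirichlet_density k b c t \<ge> 0"
  unfolding dirichlet_density_def by (intro mult_nonneg_nonneg prod_nonneg) auto

lemma dirichlet_density_Suc:
  assumes "x \<in> extensional {..<k}"
  shows "dirichlet_density (Suc k) b c (x(k := y))
    = indicator (simplexT k) x * (\<Prod>j<k. x j powr (b j - 1))
      * (indicator {0<..<1 - (\<Sum>j<k. x j)} y * (y powr (b k - 1) * (1 - (\<Sum>j<k. x j) - y) powr (c - 1)))"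
proof -
  have "x(k := y) \<in> simplexT (Suc k) \<longleftrightarrow> x \<in> simplexT k \<and> y \<in> {0<..<1 - (\<Sum>j<k. x j)}"
    using assms by (auto simp: simplexT_def PiE_def extensional_def less_Suc_eq)
  then show ?thesis
    unfolding dirichlet_density_def indicator_def by (auto simp: algebra_simps)
qed

lemma nn_integral_dirichlet_density_last:
  assumes "x \<in> extensional {..<k}" "b k > 0" "c > 0"
  shows "(\<integral>\<^sup>+y. ennreal (dirichlet_density (Suc k) b c (x(k := y))) \<partial>lborel)
    = ennreal (Beta (b k) c) * ennreal (dirichlet_density k b (b k + c) x)"
proof -
  let ?s = "\<Sum>j<k. x j" and ?p = "indicator (simplexT k) x * (\<Prod>j<k. x j powr (b j - 1))"
  have product_nonneg: "?p \<ge> 0"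
    by (intro mult_nonneg_nonneg prod_nonneg) auto
  have "(\<integral>\<^sup>+y. ennreal (dirichlet_density (Suc k) b c (x(k := y))) \<partial>lborel)
    = ennreal ?p * (\<integral>\<^sup>+y. ennreal (indicator {0<..<1 - ?s} y * (y powr (b k - 1) * (1 - ?s - y) powr (c - 1))) \<partial>lborel)"
    unfolding dirichlet_density_Suc[OF assms(1)]
    by (subst nn_integral_cmult[symmetric]) (auto simp: ennreal_mult'[OF product_nonneg])
  also have "\<dots> = ennreal (Beta (b k) c) * ennreal (dirichlet_density k b (b k + c) x)"
  proof (cases "x \<in> simplexT k")
    case True
    then have "1 - ?s > 0"
      by (simp add: simplexT_def)
    moreover have "ennreal ?p * ennreal ((1 - ?s) powr (b k + c - 1) * Beta (b k) c)
      = ennreal (Beta (b k) c) * ennreal (dirichlet_density k b (b k + c) x)"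
      using Beta_real_pos[OF assms(2,3)]
      by (simp add: ennreal_mult'[OF product_nonneg, symmetric] ennreal_mult'[symmetric] dirichlet_density_def mult_ac)
    ultimately show ?thesis
      using assms(2,3) by (subst nn_integral_Beta_scaled) auto
  qed (simp add: dirichlet_density_def)
  finally show ?thesis .
qed

lemma nn_integral_dirichlet_density:
  assumes "\<And>j. j < k \<Longrightarrow> b j > 0" "c > 0"
  shows "(\<integral>\<^sup>+t. ennreal (dirichlet_density k b c t) \<partial>PiM {..<k} (\<lambda>_. lborel))
    = ennreal ((\<Prod>j<k. Gamma (b j)) * Gamma c / Gamma ((\<Sum>j<k. b j) + c))"
  using assms
proof (induction k arbitrary: c)
  case 0
  have "(\<lambda>_. undefined) \<in> simplexT 0"
    by (simp add: simplexT_def)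
  then show ?case
    using 0 by (simp add: PiM_empty nn_integral_count_space_finite dirichlet_density_def Gamma_real_nonzero)
next
  case (Suc k)
  interpret product_sigma_finite "\<lambda>_::nat. lborel :: real measure" by standard
  let ?M = "PiM {..<k} (\<lambda>_. lborel :: real measure)"
  have pos: "b k > 0" "c > 0"
    using Suc.prems by auto
  have "(\<integral>\<^sup>+t. ennreal (dirichlet_density (Suc k) b c t) \<partial>PiM {..<Suc k} (\<lambda>_. lborel))
    = (\<integral>\<^sup>+x. (\<integral>\<^sup>+y. ennreal (dirichlet_density (Suc k) b c (x(k := y))) \<partial>lborel) \<partial>?M)"
    unfolding lessThan_Suc
    by (rule product_nn_integral_insert) (auto simp flip: lessThan_Suc)
  also have "\<dots> = (\<integral>\<^sup>+x. ennreal (Beta (b k) c) * ennreal (dirichlet_density k b (b k + c) x) \<partial>?M)"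
    using pos by (intro nn_integral_cong nn_integral_dirichlet_density_last) (auto simp: space_PiM PiE_def)
  also have "\<dots> = ennreal (Beta (b k) c) *
      ennreal ((\<Prod>j<k. Gamma (b j)) * Gamma (b k + c) / Gamma ((\<Sum>j<k. b j) + (b k + c)))"
    using Suc.prems pos by (subst nn_integral_cmult) (auto simp: Suc.IH add_pos_pos)
  also have "\<dots> = ennreal ((Beta (b k) c * Gamma (b k + c)) * (\<Prod>j<k. Gamma (b j)) / Gamma ((\<Sum>j<Suc k. b j) + c))"
    using Beta_real_pos[OF pos] by (simp add: ennreal_mult'[symmetric] add.assoc mult_ac)
  also have "Beta (b k) c * Gamma (b k + c) = Gamma (b k) * Gamma c"
    using pos by (simp add: Beta_def Gamma_real_nonzero)
  finally show ?case
    by (simp add: mult_ac)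
qed

lemma
  assumes "\<And>j. j < k \<Longrightarrow> b j > 0" "c > 0"
  shows integrable_dirichlet_density: "integrable (PiM {..<k} (\<lambda>_. lborel)) (dirichlet_density k b c)"
    and integral_dirichlet_density: "(\<integral>t. dirichlet_density k b c t \<partial>PiM {..<k} (\<lambda>_. lborel))
      = (\<Prod>j<k. Gamma (b j)) * Gamma c / Gamma ((\<Sum>j<k. b j) + c)"
proof -
  let ?v = "(\<Prod>j<k. Gamma (b j)) * Gamma c / Gamma ((\<Sum>j<k. b j) + c)"
  have "(\<Sum>j<k. b j) + c > 0"
    using assms by (intro add_nonneg_pos sum_nonneg) (auto intro: less_imp_le)
  then have "?v \<ge> 0"
    using assms
    by (intro divide_nonneg_nonneg mult_nonneg_nonneg prod_nonneg) (auto intro!: less_imp_le Gamma_real_pos)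
  then have "has_bochner_integral (PiM {..<k} (\<lambda>_. lborel)) (dirichlet_density k b c) ?v"
    using nn_integral_dirichlet_density[OF assms]
    by (intro has_bochner_integral_nn_integral) (auto simp: dirichlet_density_nonneg)
  then show "integrable (PiM {..<k} (\<lambda>_. lborel)) (dirichlet_density k b c)"
     "(\<integral>t. dirichlet_density k b c t \<partial>PiM {..<k} (\<lambda>_. lborel)) = ?v"
    by (auto simp: has_bochner_integral_iff)
qed

definition barycentric :: "nat \<Rightarrow> (nat \<Rightarrow> real) \<Rightarrow> nat \<Rightarrow> real" where
  "barycentric m t i = (if i < m then t i else 1 - (\<Sum>j<m. t j))"

lemma barycentric_measurable [measurable]:
  "(\<lambda>t. barycentric m t i) \<in> borel_measurable (PiM {..<m} (\<lambda>_. lborel))"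
  unfolding barycentric_def by (cases "i < m") (auto, measurable)

lemma abs_barycentric_le_1:
  assumes "t \<in> simplexT m"
  shows "\<bar>barycentric m t i\<bar> \<le> 1"
proof -
  have nonneg: "t j \<ge> 0" if "j < m" for j
    using assms that by (auto simp: simplexT_def intro: less_imp_le)
  then have "t j \<le> (\<Sum>j<m. t j)" if "j < m" for j
    using that by (intro member_le_sum) auto
  moreover have "0 \<le> (\<Sum>j<m. t j)" "(\<Sum>j<m. t j) < 1"
    using assms nonneg by (auto simp: simplexT_def intro: sum_nonneg)
  ultimately show ?thesis
    using nonneg by (fastforce simp: barycentric_def)
qed

lemma dirichlet_density_mult_barycentric_powers:
  "dirichlet_density m b (b m) t * (\<Prod>i<Suc m. barycentric m t i ^ js i)
    = dirichlet_density m (\<lambda>i. b i + real (js i)) (b m + real (js m)) t"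
proof (cases "t \<in> simplexT m")
  case True
  then have pos: "t j > 0" if "j < m" for j
    using that by (auto simp: simplexT_def)
  have pos': "1 - (\<Sum>j<m. t j) > 0"
    using True by (auto simp: simplexT_def)
  have powr: "x powr (a - 1) * x ^ n = x powr (a + real n - 1)" if "x > 0" for x a n
    using that powr_add[of x "a - 1" "real n"] by (simp add: powr_realpow algebra_simps)
  have "(\<Prod>j<m. t j powr (b j - 1)) * (\<Prod>j<m. t j ^ js j) = (\<Prod>j<m. t j powr (b j + real (js j) - 1))"
    unfolding prod.distrib[symmetric] using powr pos by (intro prod.cong) auto
  moreover have "(\<Prod>i<m. barycentric m t i ^ js i) = (\<Prod>j<m. t j ^ js j)"
    by (intro prod.cong) (auto simp: barycentric_def)
  ultimately show ?thesis
    using powr[OF pos', of "b m" "js m"] True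
    by (simp add: dirichlet_density_def barycentric_def algebra_simps)
qed (simp add: dirichlet_density_def)

lemma Gamma_add_nat_eq_pochhammer:
  assumes "x > (0::real)"
  shows "Gamma (x + real n) = Gamma x * pochhammer x n"
  using assms Gamma_real_nonzero[OF assms] by (subst pochhammer_Gamma) (auto simp: nonpos_Ints_def)

lemma dirichlet_moment:
  assumes "\<And>i. i < Suc m \<Longrightarrow> b i > 0"
  defines "B \<equiv> \<Sum>i<Suc m. b i"
  shows integrable_dirichlet_moment: "integrable (PiM {..<m} (\<lambda>_. lborel))
      (\<lambda>t. dirichlet_density m b (b m) t * (\<Prod>i<Suc m. barycentric m t i ^ js i))"
    and integral_dirichlet_moment:
      "(\<integral>t. dirichlet_density m b (b m) t * (\<Prod>i<Suc m. barycentric m t i ^ js i) \<partial>PiM {..<m} (\<lambda>_. lborel))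
      = (\<Prod>i<Suc m. Gamma (b i)) / Gamma B
        * ((\<Prod>i<Suc m. pochhammer (b i) (js i)) / pochhammer B (\<Sum>i<Suc m. js i))"
proof -
  show "integrable (PiM {..<m} (\<lambda>_. lborel))
      (\<lambda>t. dirichlet_density m b (b m) t * (\<Prod>i<Suc m. barycentric m t i ^ js i))"
    unfolding dirichlet_density_mult_barycentric_powers using assms(1)
    by (intro integrable_dirichlet_density add_pos_nonneg) auto
  have "B > 0"
    unfolding B_def using assms(1) by (intro sum_pos) auto
  have "(\<integral>t. dirichlet_density m b (b m) t * (\<Prod>i<Suc m. barycentric m t i ^ js i) \<partial>PiM {..<m} (\<lambda>_. lborel))
    = (\<Prod>i<m. Gamma (b i + real (js i))) * Gamma (b m + real (js m))
      / Gamma ((\<Sum>i<m. b i + real (js i)) + (b m + real (js m)))"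
    unfolding dirichlet_density_mult_barycentric_powers using assms(1)
    by (intro integral_dirichlet_density add_pos_nonneg) auto
  also have "(\<Sum>i<m. b i + real (js i)) + (b m + real (js m)) = B + real (\<Sum>i<Suc m. js i)"
    by (simp add: B_def sum.distrib)
  also have "(\<Prod>i<m. Gamma (b i + real (js i))) * Gamma (b m + real (js m))
      = (\<Prod>i<Suc m. Gamma (b i) * pochhammer (b i) (js i))"
    using assms(1) by (simp add: Gamma_add_nat_eq_pochhammer)
  finally show "(\<integral>t. dirichlet_density m b (b m) t * (\<Prod>i<Suc m. barycentric m t i ^ js i) \<partial>PiM {..<m} (\<lambda>_. lborel))
      = (\<Prod>i<Suc m. Gamma (b i)) / Gamma B
        * ((\<Prod>i<Suc m. pochhammer (b i) (js i)) / pochhammer B (\<Sum>i<Suc m. js i))"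
    unfolding Gamma_add_nat_eq_pochhammer[OF \<open>B > 0\<close>] prod.distrib by simp
qed

lemma sum_power_div_fact:
  fixes y :: "'i \<Rightarrow> real"
  assumes "finite A"
  shows "(\<Sum>i\<in>A. y i) ^ n / fact n = (\<Sum>X\<in>multisets_of_size A n. \<Prod>i\<in>A. y i ^ count X i / fact (count X i))"
proof -
  have "fps_exp (\<Sum>i\<in>A. y i) = (\<Prod>i\<in>A. fps_exp (y i))"
    using assms by (induction A rule: finite_induct) (auto simp: fps_exp_add_mult)
  then have "fps_exp (\<Sum>i\<in>A. y i) $ n = (\<Prod>i\<in>A. fps_exp (y i)) $ n"
    by simp
  then show ?thesis
    unfolding fps_prod_nth'[OF assms] by simp
qed

lemma integral_dirichlet_linear_form_power:
  assumes "\<And>i. i < Suc m \<Longrightarrow> b i > 0"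
  defines "B \<equiv> \<Sum>i<Suc m. b i"
  shows "(\<integral>t. dirichlet_density m b (b m) t * ((\<Sum>i<Suc m. x i * barycentric m t i) ^ n / fact n) \<partial>PiM {..<m} (\<lambda>_. lborel))
    = (\<Prod>i<Suc m. Gamma (b i)) / Gamma B
      * ((\<Prod>i<Suc m. fps_powr (linear_factor (x i)) (- b i)) $ n / pochhammer B n)"
proof -
  let ?A = "{..<Suc m}" and ?M = "PiM {..<m} (\<lambda>_. lborel :: real measure)"
  let ?moment = "\<lambda>X t. dirichlet_density m b (b m) t * (\<Prod>i<Suc m. barycentric m t i ^ count X i)"
  let ?c = "\<lambda>X. \<Prod>i<Suc m. x i ^ count X i / fact (count X i)"
  have expand: "dirichlet_density m b (b m) t * ((\<Sum>i<Suc m. x i * barycentric m t i) ^ n / fact n)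
      = (\<Sum>X\<in>multisets_of_size ?A n. ?c X * ?moment X t)" for t
    unfolding sum_power_div_fact[OF finite_lessThan] sum_distrib_left
    by (intro sum.cong refl) (simp only: power_mult_distrib prod_dividef prod.distrib times_divide_eq_left
        times_divide_eq_right mult_ac)
  have "(\<integral>t. dirichlet_density m b (b m) t * ((\<Sum>i<Suc m. x i * barycentric m t i) ^ n / fact n) \<partial>?M)
      = (\<Sum>X\<in>multisets_of_size ?A n. ?c X * (\<integral>t. ?moment X t \<partial>?M))"
    unfolding expand
    by (subst Bochner_Integration.integral_sum)
      (intro integrable_mult_right integrable_dirichlet_moment assms(1), assumption, simp)
  also have "\<dots> = (\<Sum>X\<in>multisets_of_size ?A n. (\<Prod>i<Suc m. Gamma (b i)) / Gamma B
      * ((\<Prod>i<Suc m. fps_powr (linear_factor (x i)) (- b i) $ count X i) / pochhammer B n))"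
  proof (intro sum.cong refl)
    fix X assume "X \<in> multisets_of_size ?A n"
    then have "(\<integral>t. ?moment X t \<partial>?M) = (\<Prod>i<Suc m. Gamma (b i)) / Gamma B
        * ((\<Prod>i<Suc m. pochhammer (b i) (count X i)) / pochhammer B n)"
      unfolding B_def
      by (subst integral_dirichlet_moment[OF assms(1)]) (simp_all only: sum_count_multisets_of_size finite_lessThan)
    then show "?c X * (\<integral>t. ?moment X t \<partial>?M) = (\<Prod>i<Suc m. Gamma (b i)) / Gamma B
        * ((\<Prod>i<Suc m. fps_powr (linear_factor (x i)) (- b i) $ count X i) / pochhammer B n)"
      unfolding fps_powr_linear_factor_nth prod_dividef prod.distrib by (simp add: mult_ac del: prod.lessThan_Suc sum.lessThan_Suc)
  qed
  finally show ?thesis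
    unfolding fps_prod_nth'[OF finite_lessThan] by (simp only: sum_distrib_left sum_divide_distrib)
qed

lemma integral_mult_exp_sums:
  fixes f S :: "'a \<Rightarrow> real"
  assumes f: "integrable M f" and [measurable]: "S \<in> borel_measurable M"
    and bound: "\<And>t. f t \<noteq> 0 \<Longrightarrow> \<bar>S t\<bar> \<le> K"
  shows "(\<lambda>n. \<integral>t. f t * (S t ^ n / fact n) \<partial>M) sums (\<integral>t. f t * exp (S t) \<partial>M)"
proof -
  have [measurable]: "f \<in> borel_measurable M"
    using f by measurable
  have norm_term_le: "norm (f t * (S t ^ n / fact n)) \<le> \<bar>K\<bar> ^ n / fact n * \<bar>f t\<bar>" for n t
  proof (cases "f t = 0")
    case False
    then have "\<bar>S t\<bar> ^ n \<le> \<bar>K\<bar> ^ n"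
      using bound[of t] by (intro power_mono) auto
    then have "\<bar>f t\<bar> * (\<bar>S t\<bar> ^ n / fact n) \<le> \<bar>f t\<bar> * (\<bar>K\<bar> ^ n / fact n)"
      by (intro mult_left_mono divide_right_mono) auto
    then show ?thesis
      by (simp add: abs_mult power_abs mult.commute)
  qed simp
  have integrable_term: "integrable M (\<lambda>t. f t * (S t ^ n / fact n))" for n
    by (rule Bochner_Integration.integrable_bound[of _ "\<lambda>t. \<bar>K\<bar> ^ n / fact n * \<bar>f t\<bar>"])
      (use f norm_term_le in \<open>auto intro!: AE_I2\<close>)
  have exp_sums: "(\<lambda>n. f t * (S t ^ n / fact n)) sums (f t * exp (S t))" for t
    using sums_mult[OF exp_converges[of "S t"], of "f t"] by (simp add: divide_inverse mult_ac)
  have "(\<lambda>n. \<integral>t. f t * (S t ^ n / fact n) \<partial>M) sums (\<integral>t. (\<Sum>n. f t * (S t ^ n / fact n)) \<partial>M)"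
  proof (rule sums_integral[OF integrable_term])
    have "summable (\<lambda>n. norm (S t ^ n / fact n))" for t
      using summable_exp[of "\<bar>S t\<bar>"] by (simp add: power_abs field_simps)
    then show "AE t in M. summable (\<lambda>n. norm (f t * (S t ^ n / fact n)))"
      unfolding norm_mult by (intro AE_I2 summable_mult)
    show "summable (\<lambda>n. \<integral>t. norm (f t * (S t ^ n / fact n)) \<partial>M)"
    proof (rule summable_comparison_test')
      show "summable (\<lambda>n. inverse (fact n) * \<bar>K\<bar> ^ n * (\<integral>t. \<bar>f t\<bar> \<partial>M))"
        by (intro summable_mult2 summable_exp)
      have "(\<integral>t. norm (f t * (S t ^ n / fact n)) \<partial>M) \<le> (\<integral>t. \<bar>K\<bar> ^ n / fact n * \<bar>f t\<bar> \<partial>M)" for n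
        using f integrable_term norm_term_le by (intro integral_mono integrable_norm) auto
      then show "norm (\<integral>t. norm (f t * (S t ^ n / fact n)) \<partial>M) \<le> inverse (fact n) * \<bar>K\<bar> ^ n * (\<integral>t. \<bar>f t\<bar> \<partial>M)" for n
        by (simp add: field_simps)
    qed
  qed
  then show ?thesis
    by (simp only: sums_unique[OF exp_sums, symmetric])
qed

lemma integral_dirichlet_exp:
  assumes b: "\<And>i. i < Suc m \<Longrightarrow> b i > 0" and "(\<Sum>i<Suc m. b i) \<ge> 1"
  shows "(\<integral>t. dirichlet_density m b (b m) t * exp (\<Sum>i<Suc m. x i * barycentric m t i) \<partial>PiM {..<m} (\<lambda>_. lborel))
    = (\<Prod>i<Suc m. Gamma (b i)) / Gamma (\<Sum>i<Suc m. b i) * humbert2 (Suc m) b (\<Sum>i<Suc m. b i) x"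
proof -
  let ?M = "PiM {..<m} (\<lambda>_. lborel :: real measure)" and ?B = "\<Sum>i<Suc m. b i"
  let ?F = "\<Prod>i<Suc m. fps_powr (linear_factor (x i)) (- b i)" and ?G = "(\<Prod>i<Suc m. Gamma (b i)) / Gamma (\<Sum>i<Suc m. b i)"
  have "geometrically_bounded_on UNIV (\<lambda>_::unit. ?F)"
    using b by (intro geometrically_bounded_intros geometrically_bounded_on_fps_powr_linear_factor) auto
  from geometrically_bounded_imp_pochhammer_summable[OF this UNIV_I assms(2)]
  have "(\<lambda>n. ?G * (?F $ n / pochhammer ?B n)) sums (?G * pochhammer_sum ?B ?F)"
    by (intro sums_mult pochhammer_sums)
  moreover have "(\<lambda>n. \<integral>t. dirichlet_density m b (b m) t * ((\<Sum>i<Suc m. x i * barycentric m t i) ^ n / fact n) \<partial>?M)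
      sums (\<integral>t. dirichlet_density m b (b m) t * exp (\<Sum>i<Suc m. x i * barycentric m t i) \<partial>?M)"
  proof (rule integral_mult_exp_sums)
    show "integrable ?M (dirichlet_density m b (b m))"
      using b by (intro integrable_dirichlet_density) auto
    show "(\<lambda>t. \<Sum>i<Suc m. x i * barycentric m t i) \<in> borel_measurable ?M"
      by measurable
    fix t assume "dirichlet_density m b (b m) t \<noteq> 0"
    then have "t \<in> simplexT m"
      by (cases "t \<in> simplexT m") (auto simp: dirichlet_density_def)
    then have "\<bar>x i * barycentric m t i\<bar> \<le> \<bar>x i\<bar>" for i
      using abs_barycentric_le_1[of t m i] by (simp add: abs_mult mult_left_le)
    then show "\<bar>\<Sum>i<Suc m. x i * barycentric m t i\<bar> \<le> (\<Sum>i<Suc m. \<bar>x i\<bar>)"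
      by (intro order.trans[OF sum_abs] sum_mono)
  qed
  then have "(\<lambda>n. ?G * (?F $ n / pochhammer ?B n))
      sums (\<integral>t. dirichlet_density m b (b m) t * exp (\<Sum>i<Suc m. x i * barycentric m t i) \<partial>?M)"
    by (simp only: integral_dirichlet_linear_form_power[where b = b, OF b])
  ultimately have "(\<integral>t. dirichlet_density m b (b m) t * exp (\<Sum>i<Suc m. x i * barycentric m t i) \<partial>?M)
      = ?G * pochhammer_sum ?B ?F"
    by (rule sums_unique2[rotated])
  also have "pochhammer_sum ?B ?F = humbert2 (Suc m) b ?B x"
    by (rule humbert2_eq_pochhammer_sum[OF assms(2) b, symmetric])
  finally show ?thesis .
qed

lemma simplex_integral_eq_humbert2:
  assumes "\<gamma> > 0"
  shows "(LINT t:simplexT k|PiM {..<k} (\<lambda>_. lborel).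
      exp ((\<Sum>j<k. x j * t j) + x k * (1 - (\<Sum>j<k. t j))) * (\<Prod>j<k. t j powr (\<gamma> - 1)))
    = Gamma \<gamma> ^ k / Gamma (real k * \<gamma> + 1)
      * humbert2 (k + 1) (\<lambda>i. if i < k then \<gamma> else 1) (real k * \<gamma> + 1) x"
proof -
  let ?b = "\<lambda>i. if i < k then \<gamma> else 1"
  have "indicator (simplexT k) t *\<^sub>R
      (exp ((\<Sum>j<k. x j * t j) + x k * (1 - (\<Sum>j<k. t j))) * (\<Prod>j<k. t j powr (\<gamma> - 1)))
    = dirichlet_density k ?b (?b k) t * exp (\<Sum>i<Suc k. x i * barycentric k t i)" for t
  proof (cases "t \<in> simplexT k")
    case True
    then have "1 - (\<Sum>j<k. t j) > 0"
      by (simp add: simplexT_def)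
    then show ?thesis
      using True by (simp add: dirichlet_density_def barycentric_def)
  qed (simp add: dirichlet_density_def)
  moreover have "(\<Sum>i<Suc k. ?b i) = real k * \<gamma> + 1" "(\<Prod>i<Suc k. Gamma (?b i)) = Gamma \<gamma> ^ k"
    by simp_all
  ultimately show ?thesis
    unfolding set_lebesgue_integral_def using integral_dirichlet_exp[of k ?b x] assms by simp
qed

lemma humbert2_eq_exp_mult_humbert2:
  assumes "\<gamma> > 0"
  shows "humbert2 (k + 1) (\<lambda>i. if i < k then \<gamma> else 1) (real k * \<gamma> + 1) x
    = exp (x k) * humbert2 k (\<lambda>_. \<gamma>) (real k * \<gamma> + 1) (\<lambda>j. x j - x k)"
proof -
  let ?b = "\<lambda>i. if i < k then \<gamma> else 1" and ?c = "real k * \<gamma> + 1"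
  define y where "y = (\<lambda>j. if j < k then x j - x k else 0)"
  have nonzero: "Gamma \<gamma> ^ k / Gamma ?c \<noteq> 0"
    using assms by (simp add: Gamma_real_nonzero add_nonneg_pos)
  have "humbert2 (k + 1) ?b ?c y = pochhammer_sum ?c (\<Prod>i<k + 1. fps_powr (linear_factor (y i)) (- ?b i))"
    using assms by (intro humbert2_eq_pochhammer_sum) auto
  also have "\<dots> = pochhammer_sum ?c (\<Prod>i<k. fps_powr (linear_factor (x i - x k)) (- \<gamma>))"
    by (simp add: y_def)
  also have "\<dots> = humbert2 k (\<lambda>_. \<gamma>) ?c (\<lambda>j. x j - x k)"
    using assms by (intro humbert2_eq_pochhammer_sum[symmetric]) auto
  finally have "humbert2 (k + 1) ?b ?c y = humbert2 k (\<lambda>_. \<gamma>) ?c (\<lambda>j. x j - x k)" .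
  moreover have "exp ((\<Sum>j<k. x j * t j) + x k * (1 - (\<Sum>j<k. t j)))
      = exp (x k) * exp ((\<Sum>j<k. y j * t j) + y k * (1 - (\<Sum>j<k. t j)))" for t
    by (simp add: y_def algebra_simps sum_subtractf sum_distrib_left flip: exp_add)
  then have "Gamma \<gamma> ^ k / Gamma ?c * humbert2 (k + 1) ?b ?c x
      = exp (x k) * (Gamma \<gamma> ^ k / Gamma ?c * humbert2 (k + 1) ?b ?c y)"
    unfolding simplex_integral_eq_humbert2[OF assms, symmetric]
    by (simp only: mult.assoc set_integral_mult_right)
  ultimately have "Gamma \<gamma> ^ k / Gamma ?c * humbert2 (k + 1) ?b ?c x
      = Gamma \<gamma> ^ k / Gamma ?c * (exp (x k) * humbert2 k (\<lambda>_. \<gamma>) ?c (\<lambda>j. x j - x k))"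
    by (simp only: mult.left_commute)
  then show ?thesis
    by (rule mult_left_cancel[OF nonzero, THEN iffD1])
qed

section \<open>Integration of series against compactly supported measures\<close>

definition fps_lebesgue_integral :: "'a measure \<Rightarrow> ('a \<Rightarrow> real fps) \<Rightarrow> real fps" where
  "fps_lebesgue_integral M f = Abs_fps (\<lambda>n. \<integral>t. f t $ n \<partial>M)"

lemma fps_lebesgue_integral_nth [simp]: "fps_lebesgue_integral M f $ n = (\<integral>t. f t $ n \<partial>M)"
  by (simp add: fps_lebesgue_integral_def)

lemma fps_XD_fps_lebesgue_integral: "fps_XD (fps_lebesgue_integral M f) = fps_lebesgue_integral M (\<lambda>t. fps_XD (f t))"
  by (rule fps_ext) simp

lemma continuous_on_slice:
  fixes g :: "'a::topological_space \<times> 'b::topological_space \<Rightarrow> 'c::topological_space"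
  assumes "continuous_on UNIV g"
  shows "continuous_on UNIV (\<lambda>y. g (x, y))"
  by (rule continuous_on_compose2[OF assms]) (auto intro!: continuous_on_Pair continuous_on_const continuous_on_id)

locale compactly_supported_measure = finite_measure M
  for M :: "'b::{metric_space, second_countable_topology} measure" +
  fixes K :: "'b set"
  assumes sets_eq_borel: "sets M = sets borel" and AE_in_support: "AE t in M. t \<in> K"
    and compact_support: "compact K"
begin

lemma integrable_continuous:
  fixes g :: "'b \<Rightarrow> real"
  assumes "continuous_on UNIV g"
  shows "integrable M g"
proof -
  have "bounded (g ` K)"
    by (intro compact_imp_bounded compact_continuous_image compact_support continuous_on_subset[OF assms]) auto
  then obtain B where "\<And>t. t \<in> K \<Longrightarrow> norm (g t) \<le> B"
    by (auto simp: bounded_iff)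
  then have "AE t in M. norm (g t) \<le> B"
    using AE_in_support by (auto elim: eventually_mono)
  moreover have "g \<in> borel_measurable M"
    using borel_measurable_continuous_onI[OF assms] sets_eq_borel measurable_cong_sets by blast
  ultimately show ?thesis
    by (intro integrable_const_bound)
qed

lemma derivative_uniformly_close:
  fixes f' :: "'a::euclidean_space \<Rightarrow> 'a \<Rightarrow> 'b \<Rightarrow> real"
  assumes linear: "\<And>z t. linear (\<lambda>h. f' z h t)"
    and continuous: "\<And>h. continuous_on UNIV (\<lambda>(z, t). f' z h t)" and "e > 0"
  obtains d where "d > 0" "\<And>y h t. y \<in> ball z d \<Longrightarrow> t \<in> K \<Longrightarrow> \<bar>f' y h t - f' z h t\<bar> \<le> e * norm h"
proof -
  have "\<exists>X. z \<in> X \<and> open X \<and> (\<forall>y\<in>X. \<forall>t\<in>K. \<bar>f' y b t - f' z b t\<bar> \<le> e / DIM('a))" for b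
  proof -
    have "continuous_on (UNIV \<times> K) (\<lambda>(z, t). f' z b t)" "e / DIM('a) > 0"
      using \<open>e > 0\<close> by (auto intro: continuous_on_subset[OF continuous])
    then obtain X where "z \<in> X" "open X"
      "\<forall>y\<in>X \<inter> UNIV. \<forall>t\<in>K. dist ((\<lambda>(z, t). f' z b t) (y, t)) ((\<lambda>(z, t). f' z b t) (z, t)) \<le> e / DIM('a)"
      by (rule continuous_on_prod_compactE[OF _ compact_support UNIV_I])
    then show ?thesis
      by (intro exI[of _ X]) (simp add: dist_real_def)
  qed
  then obtain X where X: "\<And>b. z \<in> X b" "\<And>b. open (X b)"
    and close: "\<And>b y t. y \<in> X b \<Longrightarrow> t \<in> K \<Longrightarrow> \<bar>f' y b t - f' z b t\<bar> \<le> e / DIM('a)"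
    by metis
  have "open (\<Inter>b\<in>Basis. X b)" "z \<in> (\<Inter>b\<in>Basis. X b)"
    using X by auto
  then obtain d where "d > 0" and ball: "ball z d \<subseteq> (\<Inter>b\<in>Basis. X b)"
    by (meson open_contains_ball)
  have "\<bar>f' y h t - f' z h t\<bar> \<le> e * norm h" if "y \<in> ball z d" "t \<in> K" for y h t
  proof -
    have "linear (\<lambda>h. f' y h t - f' z h t)"
      by (intro linear_compose_sub linear)
    then have "f' y h t - f' z h t = (\<Sum>b\<in>Basis. (h \<bullet> b) *\<^sub>R (f' y b t - f' z b t))"
      by (rule linear_eq_sum_Basis)
    then show ?thesis
      using norm_sum_Basis_le[of "\<lambda>b. f' y b t - f' z b t" "e / DIM('a)" h] close ball that by auto
  qed
  with \<open>d > 0\<close> show thesis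
    by (rule that)
qed

lemma linearization_uniformly_close:
  fixes f :: "'a::euclidean_space \<Rightarrow> 'b \<Rightarrow> real"
  assumes der: "\<And>z t. ((\<lambda>z. f z t) has_derivative (\<lambda>h. f' z h t)) (at z)"
    and continuous: "\<And>h. continuous_on UNIV (\<lambda>(z, t). f' z h t)" and "e > 0"
  obtains d where "d > 0"
    "\<And>y t. y \<in> ball z d \<Longrightarrow> t \<in> K \<Longrightarrow> \<bar>f y t - f z t - f' z (y - z) t\<bar> \<le> e * norm (y - z)"
proof -
  have "linear (\<lambda>h. f' z h t)" for z t
    using der by (rule has_derivative_linear)
  from derivative_uniformly_close[OF this continuous \<open>e > 0\<close>]
  obtain d where "d > 0"
    and close: "\<And>y h t. y \<in> ball z d \<Longrightarrow> t \<in> K \<Longrightarrow> \<bar>f' y h t - f' z h t\<bar> \<le> e * norm h"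
    by blast
  show thesis
  proof (rule that[OF \<open>d > 0\<close>])
    fix y t assume y: "y \<in> ball z d" and t: "t \<in> K"
    have "norm (f y t - f z t - f' z (y - z) t) \<le> norm (y - z) * e"
    proof (rule differentiable_bound_linearization[where S = "ball z d" and f' = "\<lambda>x h. f' x h t"])
      show "z + s *\<^sub>R (y - z) \<in> ball z d" if "s \<in> {0..1}" for s
        using that y by (auto simp: dist_norm norm_minus_commute intro: mult_left_le_one_le[THEN le_less_trans])
      show "onorm ((\<lambda>h. f' x h t) - (\<lambda>h. f' z h t)) \<le> e" if "x \<in> ball z d" for x
        using close[OF that t] \<open>e > 0\<close> by (intro onorm_bound) auto
    qed (use \<open>d > 0\<close> in \<open>auto intro: has_derivative_at_withinI[OF der]\<close>)
    then show "\<bar>f y t - f z t - f' z (y - z) t\<bar> \<le> e * norm (y - z)"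
      by (simp add: mult.commute)
  qed
qed

lemma integral_linearization_close:
  fixes f :: "'a::euclidean_space \<Rightarrow> 'b \<Rightarrow> real"
  assumes der: "\<And>z t. ((\<lambda>z. f z t) has_derivative (\<lambda>h. f' z h t)) (at z)"
    and f: "\<And>z. continuous_on UNIV (f z)" and f': "\<And>h. continuous_on UNIV (\<lambda>(z, t). f' z h t)" and "e > 0"
  obtains d where "d > 0"
    "\<And>y. y \<in> ball z d \<Longrightarrow> \<bar>(\<integral>t. f y t \<partial>M) - (\<integral>t. f z t \<partial>M) - (\<integral>t. f' z (y - z) t \<partial>M)\<bar> \<le> e * norm (y - z)"
proof -
  define m where "m = measure M (space M) + 1"
  have m: "m > 0" "measure M (space M) \<le> m"
    by (auto simp: m_def add_nonneg_pos)
  then obtain d where "d > 0"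
    and close: "\<And>y t. y \<in> ball z d \<Longrightarrow> t \<in> K \<Longrightarrow> \<bar>f y t - f z t - f' z (y - z) t\<bar> \<le> e / m * norm (y - z)"
    using linearization_uniformly_close[OF der f', of "e / m" z] \<open>e > 0\<close> by (metis divide_pos_pos)
  have integrable: "integrable M (f z)" and integrable': "integrable M (f' z h)" for z h
    using integrable_continuous[OF f] integrable_continuous[OF continuous_on_slice[OF f']] by simp_all
  show thesis
  proof (rule that[OF \<open>d > 0\<close>])
    fix y assume y: "y \<in> ball z d"
    have "\<bar>(\<integral>t. f y t \<partial>M) - (\<integral>t. f z t \<partial>M) - (\<integral>t. f' z (y - z) t \<partial>M)\<bar>
        = \<bar>\<integral>t. f y t - f z t - f' z (y - z) t \<partial>M\<bar>"
      using integrable integrable' by simp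
    also have "\<dots> \<le> (\<integral>t. \<bar>f y t - f z t - f' z (y - z) t\<bar> \<partial>M)"
      by (rule integral_abs_bound)
    also have "\<dots> \<le> (\<integral>t. e / m * norm (y - z) \<partial>M)"
      using integrable integrable' AE_in_support close[OF y] by (intro integral_mono_AE) (auto elim!: eventually_mono)
    also have "\<dots> = e / m * norm (y - z) * measure M (space M)"
      by simp
    also have "\<dots> \<le> e / m * norm (y - z) * m"
      using m \<open>e > 0\<close> by (intro mult_left_mono) auto
    also have "\<dots> = e * norm (y - z)"
      using m by simp
    finally show "\<bar>(\<integral>t. f y t \<partial>M) - (\<integral>t. f z t \<partial>M) - (\<integral>t. f' z (y - z) t \<partial>M)\<bar> \<le> e * norm (y - z)" .
  qed
qed

lemma has_derivative_integral:
  fixes f :: "'a::euclidean_space \<Rightarrow> 'b \<Rightarrow> real"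
  assumes der: "\<And>z t. ((\<lambda>z. f z t) has_derivative (\<lambda>h. f' z h t)) (at z)"
    and f: "\<And>z. continuous_on UNIV (f z)" and f': "\<And>h. continuous_on UNIV (\<lambda>(z, t). f' z h t)"
  shows "((\<lambda>z. \<integral>t. f z t \<partial>M) has_derivative (\<lambda>h. \<integral>t. f' z h t \<partial>M)) (at z)"
  unfolding has_derivative_at_alt
proof (intro conjI allI impI)
  have linear: "linear (\<lambda>h. f' z h t)" for t
    using der by (rule has_derivative_linear)
  have "integrable M (f' z h)" for h
    using integrable_continuous[OF continuous_on_slice[OF f']] by simp
  then have "linear (\<lambda>h. \<integral>t. f' z h t \<partial>M)"
    by (intro linearI) (simp_all add: linear_add[OF linear] linear_scale[OF linear])
  then show "bounded_linear (\<lambda>h. \<integral>t. f' z h t \<partial>M)"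
    by (rule linear_conv_bounded_linear[THEN iffD1])
  show "\<exists>d>0. \<forall>y. norm (y - z) < d \<longrightarrow>
      norm ((\<integral>t. f y t \<partial>M) - (\<integral>t. f z t \<partial>M) - (\<integral>t. f' z (y - z) t \<partial>M)) \<le> e * norm (y - z)" if "e > 0" for e
    using integral_linearization_close[OF der f f' that, of z] by (auto simp: dist_norm norm_minus_commute)
qed

lemma integrable_fps_nth: "fps_continuous_on UNIV f \<Longrightarrow> integrable M (\<lambda>t. (f t :: real fps) $ n)"
  by (intro integrable_continuous fps_continuous_on_nth)

lemma fps_lebesgue_integral_add:
  assumes "fps_continuous_on UNIV f" "fps_continuous_on UNIV g"
  shows "fps_lebesgue_integral M (\<lambda>t. f t + g t) = fps_lebesgue_integral M f + fps_lebesgue_integral M g"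
  using assms by (intro fps_ext) (simp add: integrable_fps_nth)

lemma fps_lebesgue_integral_mult:
  assumes "fps_continuous_on UNIV f"
  shows "fps_lebesgue_integral M (\<lambda>t. A * f t) = A * fps_lebesgue_integral M f"
  using assms
  by (intro fps_ext) (simp add: fps_mult_nth Bochner_Integration.integral_sum integrable_fps_nth)

lemma fps_lebesgue_integral_sum:
  assumes "\<And>i. i \<in> I \<Longrightarrow> fps_continuous_on UNIV (f i)"
  shows "fps_lebesgue_integral M (\<lambda>t. \<Sum>i\<in>I. f i t) = (\<Sum>i\<in>I. fps_lebesgue_integral M (f i))"
  using assms
  by (intro fps_ext) (simp add: fps_sum_nth Bochner_Integration.integral_sum integrable_fps_nth)

lemma fps_has_derivative_fps_lebesgue_integral:
  fixes f :: "'a::euclidean_space \<Rightarrow> 'b \<Rightarrow> real fps"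
  assumes "\<And>z t. fps_has_derivative (\<lambda>z. f z t) (\<lambda>h. f' z h t) z"
    and "\<And>z. fps_continuous_on UNIV (f z)" and "\<And>h. fps_continuous_on UNIV (\<lambda>(z, t). f' z h t)"
  shows "fps_has_derivative (\<lambda>z. fps_lebesgue_integral M (f z)) (\<lambda>h. fps_lebesgue_integral M (f' z h)) z"
  unfolding fps_has_derivative_def fps_lebesgue_integral_nth
  using assms
  by (intro allI has_derivative_integral)
    (auto simp: fps_has_derivative_def fps_continuous_on_def case_prod_unfold)

lemma geometrically_bounded_on_fps_lebesgue_integral:
  assumes "geometrically_bounded_on (S \<times> K) (\<lambda>(z, t). f z t)" and f: "\<And>z. fps_continuous_on UNIV (f z)"
  shows "geometrically_bounded_on S (\<lambda>z. fps_lebesgue_integral M (f z))"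
proof -
  obtain C R where "C \<ge> 0" "R \<ge> 0"
    and bound: "\<And>p n. p \<in> S \<times> K \<Longrightarrow> norm ((case p of (z, t) \<Rightarrow> f z t) $ n) \<le> C * R ^ n"
    using assms(1) by (rule geometrically_bounded_onE) blast
  show ?thesis
  proof (rule geometrically_bounded_onI[of "measure M (space M) * C" R])
    fix z n assume z: "z \<in> S"
    have "norm (fps_lebesgue_integral M (f z) $ n) \<le> (\<integral>t. norm (f z t $ n) \<partial>M)"
      unfolding fps_lebesgue_integral_nth by (rule integral_norm_bound)
    also have "\<dots> \<le> (\<integral>t. C * R ^ n \<partial>M)"
      using AE_in_support bound[of "(z, _)"] z integrable_fps_nth[OF f]
      by (intro integral_mono_AE integrable_norm) (auto elim!: eventually_mono)
    finally show "norm (fps_lebesgue_integral M (f z) $ n) \<le> measure M (space M) * C * R ^ n"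
      by (simp add: mult_ac)
  qed (use \<open>C \<ge> 0\<close> \<open>R \<ge> 0\<close> in auto)
qed

lemma
  assumes c_ge_1: "c \<ge> 1" and f: "fps_continuous_on UNIV f" and bounded: "geometrically_bounded_on K f"
  shows integrable_pochhammer_sum: "integrable M (\<lambda>t. pochhammer_sum c (f t))"
    and integral_pochhammer_sum: "(\<integral>t. pochhammer_sum c (f t) \<partial>M) = pochhammer_sum c (fps_lebesgue_integral M f)"
proof -
  obtain C R where bound: "\<And>t n. t \<in> K \<Longrightarrow> norm (f t $ n) \<le> C * R ^ n"
    using bounded by (rule geometrically_bounded_onE) blast
  let ?m = "measure M (space M)"
  have integrable: "integrable M (\<lambda>t. f t $ n / pochhammer c n)" for n
    using integrable_fps_nth[OF f] by simp
  have AE_summable: "AE t in M. summable (\<lambda>n. norm (f t $ n / pochhammer c n))"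
    using AE_in_support geometrically_bounded_imp_norm_summable[OF bounded _ c_ge_1] by (auto elim!: eventually_mono)
  have summable: "summable (\<lambda>n. \<integral>t. norm (f t $ n / pochhammer c n) \<partial>M)"
  proof (rule summable_comparison_test')
    show "summable (\<lambda>n. (?m * C) * R ^ n / pochhammer c n)"
      by (rule summable_geometric_div_pochhammer[OF c_ge_1])
    fix n
    have "(\<integral>t. norm (f t $ n / pochhammer c n) \<partial>M) \<le> (\<integral>t. C * R ^ n / pochhammer c n \<partial>M)"
      using integrable AE_in_support bound c_ge_1
      by (intro integral_mono_AE integrable_norm)
        (auto elim!: eventually_mono simp: pochhammer_nonneg intro!: divide_right_mono)
    then show "norm (\<integral>t. norm (f t $ n / pochhammer c n) \<partial>M) \<le> (?m * C) * R ^ n / pochhammer c n"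
      by (simp add: mult_ac)
  qed
  show "integrable M (\<lambda>t. pochhammer_sum c (f t))"
    unfolding pochhammer_sum_def by (rule integrable_suminf[OF integrable AE_summable summable])
  show "(\<integral>t. pochhammer_sum c (f t) \<partial>M) = pochhammer_sum c (fps_lebesgue_integral M f)"
    unfolding pochhammer_sum_def using integral_suminf[OF integrable AE_summable summable] by simp
qed

end

section \<open>The measures on the interval and the square\<close>

lemma Gamma_legendre_duplication_real:
  fixes x :: real
  assumes "x > 0"
  shows "Gamma x * Gamma (x + 1/2) = 2 powr (1 - 2 * x) * sqrt pi * Gamma (2 * x)"
proof -
  have "complex_of_real x \<notin> \<int>\<^sub>\<le>\<^sub>0" "complex_of_real x + 1/2 \<notin> \<int>\<^sub>\<le>\<^sub>0"
    using assms by (auto simp: nonpos_Ints_def complex_eq_iff)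
  from Gamma_legendre_duplication[OF this]
  have "complex_of_real (Gamma x * Gamma (x + 1/2)) = complex_of_real (exp ((1 - 2 * x) * ln 2) * sqrt pi * Gamma (2 * x))"
    by (simp add: exp_of_real[symmetric] flip: Gamma_complex_of_real)
  then show ?thesis
    unfolding powr_def using of_real_eq_iff by fastforce
qed

abbreviation "mu_normalizer \<alpha> \<equiv> Gamma (\<alpha> + 1/2) / (sqrt pi * Gamma (\<alpha> :: real))"

lemma mu_dens_normalization:
  assumes "\<alpha> > 0"
  shows "mu_normalizer \<alpha> * (2 powr (2 * \<alpha>) * Beta (\<alpha> + 1) \<alpha>) = 1"
proof -
  have "\<alpha> + 1 + \<alpha> = 2 * \<alpha> + 1"
    by simp
  then have shift: "Gamma (\<alpha> + 1) = \<alpha> * Gamma \<alpha>" "Gamma (\<alpha> + 1 + \<alpha>) = 2 * \<alpha> * Gamma (2 * \<alpha>)"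
    using Gamma_add_nat_eq_pochhammer[of \<alpha> 1] Gamma_add_nat_eq_pochhammer[of "2 * \<alpha>" 1] assms by simp_all
  have "mu_normalizer \<alpha> * (2 powr (2 * \<alpha>) * Beta (\<alpha> + 1) \<alpha>)
      = (Gamma \<alpha> * Gamma (\<alpha> + 1/2)) * 2 powr (2 * \<alpha>) / (2 * sqrt pi * Gamma (2 * \<alpha>))"
    unfolding Beta_def shift using assms by (simp add: Gamma_real_nonzero field_simps)
  also have "\<dots> = 2 powr (1 - 2 * \<alpha>) * 2 powr (2 * \<alpha>) / 2"
    unfolding Gamma_legendre_duplication_real[OF assms] using assms by (simp add: Gamma_real_nonzero)
  also have "\<dots> = 1"
    by (simp flip: powr_add)
  finally show ?thesis .
qed

definition mu_measure :: "real \<Rightarrow> real measure" where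
  "mu_measure \<alpha> = density lborel (\<lambda>u. ennreal (indicator {-1..1} u * mu_dens \<alpha> u))"

lemma sets_mu_measure [simp, measurable_cong]: "sets (mu_measure \<alpha>) = sets borel"
  by (simp add: mu_measure_def)

lemma space_mu_measure [simp]: "space (mu_measure \<alpha>) = UNIV"
  by (simp add: mu_measure_def)

lemma mu_dens_measurable [measurable]: "mu_dens \<alpha> \<in> borel_measurable borel"
  unfolding mu_dens_def by measurable

lemma indicator_mult_mu_dens_nonneg:
  assumes "\<alpha> > 0"
  shows "indicator {-1..1} u * mu_dens \<alpha> u \<ge> 0"
proof (cases "u \<in> {-1..1}")
  case True
  then show ?thesis
    using assms Gamma_real_pos[of \<alpha>] Gamma_real_pos[of "\<alpha> + 1/2"] by (simp add: mu_dens_def)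
qed simp

lemma indicator_mult_mu_dens_shift:
  "indicator {-1..1} (y - 1) * mu_dens \<alpha> (y - 1) = mu_normalizer \<alpha>
    * (indicator {0<..<2} y * (y powr ((\<alpha> + 1) - 1) * (2 - y) powr (\<alpha> - 1)))"
proof (cases "0 < y \<and> y < 2")
  case True
  have "1 - (y - 1)\<^sup>2 = y * (2 - y)"
    by (simp add: power2_eq_square algebra_simps)
  then have "(1 - (y - 1)\<^sup>2) powr (\<alpha> - 1) = y powr (\<alpha> - 1) * (2 - y) powr (\<alpha> - 1)"
    using True by (simp add: powr_mult)
  moreover have "y powr \<alpha> = y * y powr (\<alpha> - 1)"
    using True powr_add[of y 1 "\<alpha> - 1"] by simp
  ultimately show ?thesis
    using True by (simp add: mu_dens_def)
next
  case False
  then have "y = 0 \<or> y = 2 \<or> y < 0 \<or> y > 2"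
    by linarith
  then show ?thesis
    by (auto simp: mu_dens_def)
qed

lemma prob_space_mu_measure:
  assumes "\<alpha> > 0"
  shows "prob_space (mu_measure \<alpha>)"
proof
  let ?C = "mu_normalizer \<alpha>"
  have C_nonneg: "?C \<ge> 0"
    using assms Gamma_real_pos[of \<alpha>] Gamma_real_pos[of "\<alpha> + 1/2"] by simp
  have "emeasure (mu_measure \<alpha>) (space (mu_measure \<alpha>))
      = (\<integral>\<^sup>+u. ennreal (indicator {-1..1} u * mu_dens \<alpha> u) \<partial>lborel)"
    unfolding mu_measure_def by (simp add: emeasure_density)
  also have "\<dots> = (\<integral>\<^sup>+y. ennreal (indicator {-1..1} (y - 1) * mu_dens \<alpha> (y - 1)) \<partial>lborel)"
    using nn_integral_real_affine[of "\<lambda>u. ennreal (indicator {-1..1} u * mu_dens \<alpha> u)" 1 "-1"] by simp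
  also have "\<dots> = ennreal (?C * (2 powr ((\<alpha> + 1) + \<alpha> - 1) * Beta (\<alpha> + 1) \<alpha>))"
    unfolding indicator_mult_mu_dens_shift ennreal_mult'[OF C_nonneg]
    using assms by (subst nn_integral_cmult) (simp_all only: nn_integral_Beta_scaled add_pos_pos zero_less_one, auto)
  also have "(\<alpha> + 1) + \<alpha> - 1 = 2 * \<alpha>"
    by simp
  also have "?C * (2 powr (2 * \<alpha>) * Beta (\<alpha> + 1) \<alpha>) = 1"
    by (rule mu_dens_normalization[OF assms])
  finally show "emeasure (mu_measure \<alpha>) (space (mu_measure \<alpha>)) = 1"
    by simp
qed

lemma compactly_supported_mu_measure:
  assumes "\<alpha> > 0"
  shows "compactly_supported_measure (mu_measure \<alpha>) {-1..1}"
proof -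
  interpret prob_space "mu_measure \<alpha>"
    by (rule prob_space_mu_measure[OF assms])
  show ?thesis
  proof
    show "AE u in mu_measure \<alpha>. u \<in> {-1..1}"
      unfolding mu_measure_def by (subst AE_density) (auto simp: indicator_def intro!: AE_I2)
  qed auto
qed

lemma integral_mu_measure:
  assumes "\<alpha> > 0" "g \<in> borel_measurable borel"
  shows "(\<integral>u. g u \<partial>mu_measure \<alpha>) = (LINT u:{-1..1}|lborel. (g u :: real) * mu_dens \<alpha> u)"
  unfolding mu_measure_def set_lebesgue_integral_def
  using assms indicator_mult_mu_dens_nonneg[OF assms(1)] by (subst integral_density) (auto simp: mult_ac)

lemma set_integrable_mult_mu_dens:
  fixes g :: "real \<Rightarrow> real"
  assumes "\<alpha> > 0" "continuous_on UNIV g"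
  shows "set_integrable lborel {-1..1} (\<lambda>u. g u * mu_dens \<alpha> u)"
proof -
  have [measurable]: "g \<in> borel_measurable borel"
    by (rule borel_measurable_continuous_onI[OF assms(2)])
  have "integrable (mu_measure \<alpha>) g"
    by (rule compactly_supported_measure.integrable_continuous[OF compactly_supported_mu_measure[OF assms(1)] assms(2)])
  then show ?thesis
    unfolding mu_measure_def set_integrable_def
    using indicator_mult_mu_dens_nonneg[OF assms(1)] by (subst (asm) integrable_density) (auto simp: mult_ac)
qed

lemma one_minus_mult_mu_dens:
  assumes "u \<in> {-1..1}"
  shows "(1 - u) * mu_dens \<alpha> u = mu_normalizer \<alpha> * (1 - u\<^sup>2) powr \<alpha>"
proof -
  have "1 - u\<^sup>2 \<ge> 0"
    using assms by (auto simp: abs_square_le_1 abs_le_iff)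
  then have "(1 - u\<^sup>2) powr \<alpha> = (1 - u\<^sup>2) * (1 - u\<^sup>2) powr (\<alpha> - 1)"
    using powr_mult_base[of "1 - u\<^sup>2" "\<alpha> - 1"] by simp
  also have "\<dots> = (1 - u) * ((1 + u) * (1 - u\<^sup>2) powr (\<alpha> - 1))"
    by (simp add: power2_eq_square algebra_simps)
  finally show ?thesis
    by (simp add: mu_dens_def mult_ac)
qed

lemma power_weight_has_derivative:
  fixes \<alpha> u :: real
  assumes "u \<in> {-1<..<1}"
  defines "C \<equiv> mu_normalizer \<alpha>"
  shows "((\<lambda>u. C * (1 - u\<^sup>2) powr \<alpha>) has_real_derivative - \<alpha> * (mu_dens \<alpha> u - mu_dens \<alpha> (- u))) (at u)"
proof -
  have "1 - u\<^sup>2 > 0"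
    using assms(1) by (auto simp: abs_square_less_1 abs_less_iff)
  then have "((\<lambda>u. C * (1 - u\<^sup>2) powr \<alpha>) has_real_derivative C * (\<alpha> * (1 - u\<^sup>2) powr (\<alpha> - 1) * (- 2 * u))) (at u)"
    by (auto intro!: derivative_eq_intros)
  also have "C * (\<alpha> * (1 - u\<^sup>2) powr (\<alpha> - 1) * (- 2 * u)) = - \<alpha> * (mu_dens \<alpha> u - mu_dens \<alpha> (- u))"
    unfolding mu_dens_def C_def[symmetric] by (simp add: algebra_simps)
  finally show ?thesis .
qed

lemma has_integral_mu_dens_by_parts:
  fixes g :: "real \<Rightarrow> real"
  assumes "\<alpha> > 0" and der: "\<And>u. (g has_real_derivative g' u) (at u)"
  shows "((\<lambda>u. (1 - u) * g' u * mu_dens \<alpha> u - \<alpha> * (g u * mu_dens \<alpha> u - g u * mu_dens \<alpha> (- u)))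
    has_integral 0) {-1..1}"
proof -
  define F where "F = (\<lambda>u. mu_normalizer \<alpha> * (1 - u\<^sup>2) powr \<alpha> * g u)"
  have "continuous_on {-1..1} g"
    using der by (intro continuous_at_imp_continuous_on ballI) (metis DERIV_isCont)
  moreover have "1 - u\<^sup>2 \<ge> 0" if "u \<in> {-1..1}" for u :: real
    using that by (auto simp: abs_square_le_1 abs_le_iff)
  ultimately have "continuous_on {-1..1} F"
    unfolding F_def using assms(1) by (intro continuous_intros continuous_on_powr') auto
  moreover have "(F has_vector_derivative
      (1 - u) * g' u * mu_dens \<alpha> u - \<alpha> * (g u * mu_dens \<alpha> u - g u * mu_dens \<alpha> (- u))) (at u)"
    if u: "u \<in> {-1<..<1}" for u
  proof -
    have "(F has_real_derivative (- \<alpha> * (mu_dens \<alpha> u - mu_dens \<alpha> (- u))) * g u + g' u * ((1 - u) * mu_dens \<alpha> u)) (at u)"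
      unfolding F_def using u
      by (subst one_minus_mult_mu_dens, simp, intro DERIV_mult power_weight_has_derivative der)
    then show ?thesis
      by (simp add: has_real_derivative_iff_has_vector_derivative algebra_simps)
  qed
  ultimately have "((\<lambda>u. (1 - u) * g' u * mu_dens \<alpha> u - \<alpha> * (g u * mu_dens \<alpha> u - g u * mu_dens \<alpha> (- u)))
      has_integral (F 1 - F (-1))) {-1..1}"
    by (intro fundamental_theorem_of_calculus_interior) auto
  then show ?thesis
    by (simp add: F_def)
qed

lemma set_integral_reflect:
  fixes f :: "real \<Rightarrow> real"
  shows "(LINT u:{-a..a}|lborel. f (- u)) = (LINT u:{-a..a}|lborel. f u)"
    and "set_integrable lborel {-a..a} f \<Longrightarrow> set_integrable lborel {-a..a} (\<lambda>u. f (- u))"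
proof -
  have indicator_even: "indicator {-a..a} (- u) = (indicator {-a..a} u :: real)" for u
    by (auto simp: indicator_def)
  show "(LINT u:{-a..a}|lborel. f (- u)) = (LINT u:{-a..a}|lborel. f u)"
    using lborel_integral_real_affine[of "-1" "\<lambda>u. indicator {-a..a} u *\<^sub>R f u" 0]
    unfolding set_lebesgue_integral_def by (simp add: indicator_even)
  show "set_integrable lborel {-a..a} (\<lambda>u. f (- u))" if "set_integrable lborel {-a..a} f"
    using lborel_integrable_real_affine[OF that[unfolded set_integrable_def], of "-1" 0]
    unfolding set_integrable_def by (simp add: indicator_even)
qed

lemma integral_by_parts_mu_measure:
  fixes g :: "real \<Rightarrow> real"
  assumes \<alpha>_pos: "\<alpha> > 0" and der: "\<And>u. (g has_real_derivative g' u) (at u)" and g': "continuous_on UNIV g'"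
  shows "(\<integral>u. (1 - u) * g' u \<partial>mu_measure \<alpha>)
    = \<alpha> * ((\<integral>u. g u \<partial>mu_measure \<alpha>) - (\<integral>u. g (- u) \<partial>mu_measure \<alpha>))"
proof -
  have g: "continuous_on UNIV g"
    using der by (intro continuous_at_imp_continuous_on ballI) (metis DERIV_isCont)
  have g_reflect: "continuous_on UNIV (\<lambda>u. g (- u))"
    by (intro continuous_on_compose2[OF g] continuous_intros) auto
  have [measurable]: "g \<in> borel_measurable borel" "g' \<in> borel_measurable borel"
    using g g' by (auto intro: borel_measurable_continuous_onI)
  let ?G1 = "\<lambda>u. (1 - u) * g' u * mu_dens \<alpha> u" and ?G2 = "\<lambda>u. g u * mu_dens \<alpha> u"
    and ?G3 = "\<lambda>u. g u * mu_dens \<alpha> (- u)"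
  have integrable: "set_integrable lborel {-1..1} ?G1" "set_integrable lborel {-1..1} ?G2"
    "set_integrable lborel {-1..1} ?G3"
    using set_integral_reflect(2)[OF set_integrable_mult_mu_dens[OF \<alpha>_pos g_reflect]]
    by (auto intro!: set_integrable_mult_mu_dens \<alpha>_pos g continuous_intros g')
  have "(LINT u:{-1..1}|lborel. ?G1 u - \<alpha> * (?G2 u - ?G3 u)) = 0"
    using integrable has_integral_mu_dens_by_parts[OF \<alpha>_pos der]
    by (subst set_borel_integral_eq_integral(2)) (auto simp: integral_unique intro!: set_integral_diff set_integrable_mult_right)
  moreover have "(LINT u:{-1..1}|lborel. ?G1 u - \<alpha> * (?G2 u - ?G3 u))
      = (LINT u:{-1..1}|lborel. ?G1 u) - \<alpha> * ((LINT u:{-1..1}|lborel. ?G2 u) - (LINT u:{-1..1}|lborel. ?G3 u))"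
    using integrable by (simp add: set_integral_diff)
  moreover have "(LINT u:{-1..1}|lborel. ?G3 u) = (\<integral>u. g (- u) \<partial>mu_measure \<alpha>)"
    using set_integral_reflect(1)[of 1 "\<lambda>u. g (- u) * mu_dens \<alpha> u"] \<alpha>_pos by (simp add: integral_mu_measure)
  ultimately show ?thesis
    using \<alpha>_pos by (simp add: integral_mu_measure)
qed

text \<open>Points of the square are pairs \<open>(v, u)\<close>: the variable of the outer integral comes first.\<close>
definition mu_square :: "real \<Rightarrow> real \<Rightarrow> (real \<times> real) measure" where
  "mu_square \<alpha> \<beta> = mu_measure \<beta> \<Otimes>\<^sub>M mu_measure \<alpha>"

definition centered_square :: "(real \<times> real) set" where
  "centered_square = {-1..1} \<times> {-1..1}"

lemma mem_centered_square [simp]: "(v, u) \<in> centered_square \<longleftrightarrow> v \<in> {-1..1} \<and> u \<in> {-1..1}"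
  by (simp add: centered_square_def)

lemma compact_centered_square: "compact centered_square"
  unfolding centered_square_def by (intro compact_Times compact_Icc)

text \<open>The coordinate of the square whose sign is changed by a reflection \<open>dih_refl k j\<close> of \<open>z\<close>.\<close>
definition class_coord :: "nat \<Rightarrow> real \<times> real \<Rightarrow> real" where
  "class_coord j x = (if even j then snd x else fst x)"

definition class_axis :: "nat \<Rightarrow> real \<times> real" where
  "class_axis j = (if even j then (0, 1) else (1, 0))"

definition class_flip :: "nat \<Rightarrow> real \<times> real \<Rightarrow> real \<times> real" where
  "class_flip j x = (if even j then (fst x, - snd x) else (- fst x, snd x))"

lemma continuous_on_class_coord [continuous_intros]:
  "continuous_on S f \<Longrightarrow> continuous_on S (\<lambda>x. class_coord j (f x))"
  unfolding class_coord_def by (cases "even j") (auto intro!: continuous_intros)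

context
  fixes \<alpha> \<beta> :: real
  assumes \<alpha>_pos: "\<alpha> > 0" and \<beta>_pos: "\<beta> > 0"
begin

interpretation A: prob_space "mu_measure \<alpha>" by (rule prob_space_mu_measure[OF \<alpha>_pos])
interpretation B: prob_space "mu_measure \<beta>" by (rule prob_space_mu_measure[OF \<beta>_pos])
interpretation P: pair_prob_space "mu_measure \<beta>" "mu_measure \<alpha>" by unfold_locales

lemma prob_space_mu_square: "prob_space (mu_square \<alpha> \<beta>)"
  unfolding mu_square_def by (rule P.prob_space_axioms)

lemma compactly_supported_mu_square: "compactly_supported_measure (mu_square \<alpha> \<beta>) centered_square"
proof -
  interpret prob_space "mu_square \<alpha> \<beta>" by (rule prob_space_mu_square)
  show ?thesis
  proof
    have "sets (mu_measure \<beta> \<Otimes>\<^sub>M mu_measure \<alpha>) = sets (borel \<Otimes>\<^sub>M borel)"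
      by (intro sets_pair_measure_cong) auto
    then show "sets (mu_square \<alpha> \<beta>) = sets borel"
      unfolding mu_square_def borel_prod .
    have AE: "AE u in mu_measure \<gamma>. u \<in> {-1..1}" if "\<gamma> > 0" for \<gamma>
      using compactly_supported_mu_measure[OF that] by (rule compactly_supported_measure.AE_in_support)
    show "AE x in mu_square \<alpha> \<beta>. x \<in> centered_square"
      unfolding mu_square_def
    proof (rule P.AE_pair_measure)
      have "centered_square \<in> sets (mu_measure \<beta> \<Otimes>\<^sub>M mu_measure \<alpha>)"
        unfolding centered_square_def by (intro pair_measureI) auto
      then show "{x \<in> space (mu_measure \<beta> \<Otimes>\<^sub>M mu_measure \<alpha>). x \<in> centered_square} \<in> sets (mu_measure \<beta> \<Otimes>\<^sub>M mu_measure \<alpha>)"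
        by (simp add: space_pair_measure)
      show "AE v in mu_measure \<beta>. AE u in mu_measure \<alpha>. (v, u) \<in> centered_square"
        using AE[OF \<beta>_pos] AE[OF \<alpha>_pos] by (auto elim!: eventually_mono)
    qed
  qed (rule compact_centered_square)
qed

lemma integral_mu_square_swap:
  fixes f :: "real \<times> real \<Rightarrow> real"
  assumes "continuous_on UNIV f"
  shows "(\<integral>x. f x \<partial>mu_square \<alpha> \<beta>) = (\<integral>x. f (prod.swap x) \<partial>mu_square \<beta> \<alpha>)"
proof -
  have "f \<in> borel_measurable (mu_measure \<beta> \<Otimes>\<^sub>M mu_measure \<alpha>)"
    using compactly_supported_measure.integrable_continuous[OF compactly_supported_mu_square assms]
    unfolding mu_square_def by (rule borel_measurable_integrable)
  from P.integral_product_swap[OF this] show ?thesis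
    by (simp add: mu_square_def case_prod_unfold prod.swap_def)
qed

lemma integral_by_parts_snd:
  fixes g g' :: "real \<times> real \<Rightarrow> real"
  assumes g: "continuous_on UNIV g" and g': "continuous_on UNIV g'"
    and der: "\<And>v u. ((\<lambda>u. g (v, u)) has_real_derivative g' (v, u)) (at u)"
  shows "(\<integral>x. (1 - snd x) * g' x \<partial>mu_square \<alpha> \<beta>)
    = \<alpha> * ((\<integral>x. g x \<partial>mu_square \<alpha> \<beta>) - (\<integral>x. g (fst x, - snd x) \<partial>mu_square \<alpha> \<beta>))"
proof -
  note integrable = compactly_supported_measure.integrable_continuous[OF compactly_supported_mu_square]
  have iterated: "(\<integral>x. f x \<partial>mu_square \<alpha> \<beta>) = (\<integral>v. (\<integral>u. f (v, u) \<partial>mu_measure \<alpha>) \<partial>mu_measure \<beta>)"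
    and slice: "integrable (mu_measure \<beta>) (\<lambda>v. \<integral>u. f (v, u) \<partial>mu_measure \<alpha>)"
    if "continuous_on UNIV f" for f :: "real \<times> real \<Rightarrow> real"
    using P.integral_fst'[of f] P.integrable_fst'[of f] integrable[OF that] unfolding mu_square_def by simp_all
  have flip: "continuous_on UNIV (\<lambda>x. g (fst x, - snd x))"
    by (rule continuous_on_compose2[OF g]) (auto intro!: continuous_intros)
  have "(\<integral>x. (1 - snd x) * g' x \<partial>mu_square \<alpha> \<beta>)
      = (\<integral>v. (\<integral>u. (1 - u) * g' (v, u) \<partial>mu_measure \<alpha>) \<partial>mu_measure \<beta>)"
    using g' by (subst iterated) (auto intro!: continuous_intros)
  also have "\<dots> = (\<integral>v. \<alpha> * ((\<integral>u. g (v, u) \<partial>mu_measure \<alpha>) - (\<integral>u. g (v, - u) \<partial>mu_measure \<alpha>)) \<partial>mu_measure \<beta>)"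
    by (subst integral_by_parts_mu_measure[OF \<alpha>_pos der continuous_on_slice[OF g']]) (rule refl)
  also have "\<dots> = \<alpha> * ((\<integral>x. g x \<partial>mu_square \<alpha> \<beta>) - (\<integral>x. g (fst x, - snd x) \<partial>mu_square \<alpha> \<beta>))"
    unfolding iterated[OF g] iterated[OF flip] using slice[OF g] slice[OF flip] by simp
  finally show ?thesis .
qed

end

lemma integral_by_parts_class_coord:
  fixes g g' :: "real \<times> real \<Rightarrow> real"
  assumes \<alpha>_pos: "\<alpha> > 0" and \<beta>_pos: "\<beta> > 0" and g: "continuous_on UNIV g" and g': "continuous_on UNIV g'"
    and der: "\<And>x. ((\<lambda>t. g (x + t *\<^sub>R class_axis j)) has_real_derivative g' x) (at 0)"
  shows "(\<integral>x. (1 - class_coord j x) * g' x \<partial>mu_square \<alpha> \<beta>)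
    = dih_mult \<alpha> \<beta> j * ((\<integral>x. g x \<partial>mu_square \<alpha> \<beta>) - (\<integral>x. g (class_flip j x) \<partial>mu_square \<alpha> \<beta>))"
proof (cases "even j")
  case True
  have "((\<lambda>u. g (v, u)) has_real_derivative g' (v, u)) (at u)" for v u
    using der[of "(v, u)"] True DERIV_shift[of "\<lambda>u. g (v, u)" "g' (v, u)" 0 u]
    by (simp add: class_axis_def add.commute)
  then show ?thesis
    using True integral_by_parts_snd[OF \<alpha>_pos \<beta>_pos g g'] by (simp add: class_coord_def class_flip_def dih_mult_def)
next
  case False
  let ?swap = "\<lambda>f x. f (prod.swap x) :: real"
  have swap: "continuous_on UNIV (?swap f)" if "continuous_on UNIV f" for f
    by (rule continuous_on_compose2[OF that]) (auto intro!: continuous_intros)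
  have "((\<lambda>v. ?swap g (u, v)) has_real_derivative ?swap g' (u, v)) (at v)" for u v
    using der[of "(v, u)"] False DERIV_shift[of "\<lambda>v. g (v, u)" "g' (v, u)" 0 v]
    by (simp add: class_axis_def add.commute)
  moreover have "continuous_on UNIV (\<lambda>x. g (- fst x, snd x))"
    by (rule continuous_on_compose2[OF g]) (auto intro!: continuous_intros)
  ultimately show ?thesis
    using False g g' integral_by_parts_snd[OF \<beta>_pos \<alpha>_pos swap[OF g] swap[OF g']]
    by (subst (1 2 3) integral_mu_square_swap[OF \<alpha>_pos \<beta>_pos])
      (auto simp: class_coord_def class_flip_def dih_mult_def intro!: continuous_intros swap)
qed

definition iterated_mu_integral :: "real \<Rightarrow> real \<Rightarrow> (real \<Rightarrow> real \<Rightarrow> real) \<Rightarrow> real" where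
  "iterated_mu_integral \<alpha> \<beta> F =
    (LINT v:{-1..1}|lborel. (LINT u:{-1..1}|lborel. F u v * mu_dens \<alpha> u) * mu_dens \<beta> v)"

lemma iterated_mu_integral_mult_left:
  "iterated_mu_integral \<alpha> \<beta> (\<lambda>u v. c * F u v) = c * iterated_mu_integral \<alpha> \<beta> F"
  by (simp only: iterated_mu_integral_def mult.assoc set_integral_mult_right)

lemma iterated_mu_integral_eq:
  fixes f :: "real \<times> real \<Rightarrow> real"
  assumes \<alpha>_pos: "\<alpha> > 0" and \<beta>_pos: "\<beta> > 0" and f: "integrable (mu_square \<alpha> \<beta>) f"
    and eq: "\<And>u v. u \<in> {-1..1} \<Longrightarrow> v \<in> {-1..1} \<Longrightarrow> F u v = f (v, u)"
  shows "iterated_mu_integral \<alpha> \<beta> F = (\<integral>x. f x \<partial>mu_square \<alpha> \<beta>)"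
proof -
  interpret A: prob_space "mu_measure \<alpha>" by (rule prob_space_mu_measure[OF \<alpha>_pos])
  interpret B: prob_space "mu_measure \<beta>" by (rule prob_space_mu_measure[OF \<beta>_pos])
  interpret P: pair_prob_space "mu_measure \<beta>" "mu_measure \<alpha>" by unfold_locales
  have f': "integrable (mu_measure \<beta> \<Otimes>\<^sub>M mu_measure \<alpha>) f"
    using f unfolding mu_square_def .
  have inner: "(\<lambda>u. f (v, u)) \<in> borel_measurable borel" for v
    using measurable_Pair2[OF borel_measurable_integrable[OF f']]
    by (simp add: measurable_cong_sets[OF sets_mu_measure refl])
  have outer: "(\<lambda>v. \<integral>u. f (v, u) \<partial>mu_measure \<alpha>) \<in> borel_measurable borel"
    using borel_measurable_integrable[OF P.integrable_fst'[OF f']]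
    by (simp add: measurable_cong_sets[OF sets_mu_measure refl])
  have "(\<integral>x. f x \<partial>mu_square \<alpha> \<beta>) = (\<integral>v. (\<integral>u. f (v, u) \<partial>mu_measure \<alpha>) \<partial>mu_measure \<beta>)"
    unfolding mu_square_def by (rule P.integral_fst'[OF f', symmetric])
  also have "\<dots> = (LINT v:{-1..1}|lborel. (LINT u:{-1..1}|lborel. f (v, u) * mu_dens \<alpha> u) * mu_dens \<beta> v)"
    by (subst integral_mu_measure[OF \<beta>_pos outer]) (simp only: integral_mu_measure[OF \<alpha>_pos inner])
  also have "\<dots> = iterated_mu_integral \<alpha> \<beta> F"
    unfolding iterated_mu_integral_def using eq by (intro set_lebesgue_integral_cong allI impI arg_cong2[where f = "(*)"]) auto
  finally show ?thesis ..
qed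

section \<open>The dihedral reflections\<close>

lemma dih_refl_eq: "dih_refl k j z = z - 2 * of_real (cinner (dih_root k j) z) * dih_root k j"
proof -
  let ?r = "dih_root k j"
  have "?r * ?r = - cis (real j * pi / real k)"
    by (simp add: dih_root_def cis_mult algebra_simps)
  moreover have "cmod ?r = 1"
    by (simp add: dih_root_def norm_mult)
  then have "?r * cnj ?r = 1"
    using complex_norm_square[of ?r] by simp
  moreover have "2 * of_real (cinner ?r z) = ?r * cnj z + cnj ?r * z"
    by (simp add: cinner_def complex_eq_iff)
  moreover have "(?r * cnj z + cnj ?r * z) * ?r = (?r * ?r) * cnj z + (?r * cnj ?r) * z"
    by (simp add: algebra_simps)
  ultimately have "2 * of_real (cinner ?r z) * ?r = - cis (real j * pi / real k) * cnj z + z"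
    by simp
  then show ?thesis
    by (simp add: dih_refl_def algebra_simps)
qed

lemma cinner_dih_refl:
  "cinner (dih_refl k j z) w = cinner z w - 2 * cinner (dih_root k j) z * cinner (dih_root k j) w"
proof -
  have "cinner (z - 2 * of_real a * r) w = cinner z w - 2 * a * cinner r w" for a r
    by (simp add: cinner_def algebra_simps)
  then show ?thesis
    unfolding dih_refl_eq by simp
qed

lemma dih_regular_cinner_nonzero:
  assumes "dih_regular k z" "i < k" "e < 2"
  shows "cinner (dih_root k (2 * i + e)) z \<noteq> 0"
proof -
  have "2 * i + e < 2 * k"
    using assms(2,3) by simp
  then show ?thesis
    using assms(1) unfolding dih_regular_def by blast
qed

lemma bounded_linear_dih_refl: "bounded_linear (dih_refl k j)"
  unfolding dih_refl_def by (intro bounded_linear_mult_const bounded_linear_cnj)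

lemma power_dih_refl:
  assumes "k \<ge> 1"
  shows "dih_refl k j z ^ k = (- 1) ^ j * cnj (z ^ k)"
proof -
  have "cis (real j * pi / real k) ^ k = cis (real j * pi)"
    using assms by (simp add: Complex.DeMoivre)
  also have "\<dots> = (- 1) ^ j"
    using Complex.DeMoivre[of pi j] by simp
  finally show ?thesis
    by (simp add: dih_refl_def power_mult_distrib mult.commute)
qed

definition dih_rot :: "nat \<Rightarrow> nat \<Rightarrow> complex \<Rightarrow> complex" where
  "dih_rot k i z = cis (2 * pi * real i / real k) * z"

lemma norm_dih_rot [simp]: "cmod (dih_rot k i z) = cmod z"
  by (simp add: dih_rot_def norm_mult)

lemma dih_rot_0 [simp]: "dih_rot k 0 z = z"
  by (simp add: dih_rot_def)

lemma power_dih_rot: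
  assumes "k \<ge> 1"
  shows "dih_rot k i z ^ k = z ^ k"
proof -
  have "cis (2 * pi * real i / real k) ^ k = cis (2 * pi * real i)"
    using assms by (simp add: Complex.DeMoivre)
  then show ?thesis
    by (simp add: dih_rot_def power_mult_distrib)
qed

lemma dih_refl_eq_dih_rot: "k \<ge> 1 \<Longrightarrow> dih_refl k (2 * i + e) z = dih_rot k i (dih_refl k e z)"
  by (simp add: dih_refl_def dih_rot_def cis_mult add_divide_distrib algebra_simps)

lemma cinner_dih_rot:
  assumes "k \<ge> 1"
  shows "cinner (dih_rot k i z) w
    = cmod z * cmod w * cos ((real k * (Arg z - Arg w) + 2 * pi * real i) / real k)"
proof -
  have "dih_rot k i z * cnj w
      = rcis 1 (2 * pi * real i / real k) * rcis (cmod z) (Arg z) * cnj (rcis (cmod w) (Arg w))"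
    unfolding dih_rot_def rcis_cmod_Arg by (simp add: rcis_def)
  also have "\<dots> = rcis (cmod z * cmod w) (2 * pi * real i / real k + Arg z - Arg w)"
    by (simp add: rcis_def cis_cnj cis_mult algebra_simps)
  also have "2 * pi * real i / real k + Arg z - Arg w = (real k * (Arg z - Arg w) + 2 * pi * real i) / real k"
    using assms by (simp add: field_simps)
  finally show ?thesis
    by (simp add: cinner_def)
qed

lemma Re_Im_power_polar:
  "Re (z ^ k) = cmod z ^ k * cos (real k * Arg z)" "Im (z ^ k) = cmod z ^ k * sin (real k * Arg z)"
proof -
  have "z ^ k = rcis (cmod z ^ k) (real k * Arg z)"
    by (subst rcis_cmod_Arg[of z, symmetric]) (rule DeMoivre2)
  then show "Re (z ^ k) = cmod z ^ k * cos (real k * Arg z)" "Im (z ^ k) = cmod z ^ k * sin (real k * Arg z)"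
    by auto
qed

definition class_part :: "nat \<Rightarrow> complex \<Rightarrow> real" where
  "class_part j x = (if even j then Im x else Re x)"

lemma bounded_linear_class_part: "bounded_linear (class_part j)"
  unfolding class_part_def by (cases "even j") (simp_all add: bounded_linear_Im bounded_linear_Re)

lemma class_part_power_dih_refl:
  "k \<ge> 1 \<Longrightarrow> class_part i (dih_refl k j z ^ k) = (if even i = even j then -1 else 1) * class_part i (z ^ k)"
  unfolding power_dih_refl class_part_def by (cases "even j") (auto simp del: complex_cnj_power)

lemma diff_cnj_eq_class_part:
  "x - (- 1) ^ j * cnj x = (if even j then 2 * \<i> else 2) * of_real (class_part j x)"
  by (simp add: class_part_def complex_eq_iff)

lemma prod_diff_dih_refl:
  assumes "k \<ge> 1"
  shows "(\<Prod>i<k. z - dih_refl k (2 * i + e) z) = (if even e then 2 * \<i> else 2) * of_real (class_part e (z ^ k))"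
proof -
  have "(\<Prod>i<k. z - dih_refl k (2 * i + e) z) = z ^ k - dih_refl k e z ^ k"
    unfolding dih_refl_eq_dih_rot[OF assms] dih_rot_def by (rule prod_diff_roots_unity_mult[OF assms])
  then show ?thesis
    unfolding power_dih_refl[OF assms] diff_cnj_eq_class_part .
qed

lemma has_derivative_prod_logarithmic:
  fixes f :: "'i \<Rightarrow> 'a::real_normed_vector \<Rightarrow> 'b::real_normed_field"
  assumes "finite S" "\<And>i. i \<in> S \<Longrightarrow> (f i has_derivative f' i) (at x)" "\<And>i. i \<in> S \<Longrightarrow> f i x \<noteq> 0"
  shows "((\<lambda>x. \<Prod>i\<in>S. f i x) has_derivative (\<lambda>h. (\<Sum>i\<in>S. f' i h / f i x) * (\<Prod>i\<in>S. f i x))) (at x)"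
proof -
  have "f' i h * (\<Prod>j\<in>S - {i}. f j x) = f' i h / f i x * (\<Prod>j\<in>S. f j x)" if "i \<in> S" for i h
    using assms(1,3) that by (simp add: prod.remove)
  then have "(\<lambda>h. \<Sum>i\<in>S. f' i h * (\<Prod>j\<in>S - {i}. f j x)) = (\<lambda>h. (\<Sum>i\<in>S. f' i h / f i x) * (\<Prod>i\<in>S. f i x))"
    by (simp add: sum_distrib_right)
  then show ?thesis
    using has_derivative_prod[of S f f' x UNIV] assms(2) by simp
qed

lemma power_has_derivative: "((\<lambda>z. z ^ k) has_derivative (\<lambda>h. of_nat k * z ^ (k - 1) * h)) (at (z :: complex))"
  by (auto intro!: derivative_eq_intros)

text \<open>Up to a constant, \<open>class_part e (z ^ k)\<close> is the product of the linear forms vanishing on the mirrors of one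
  class; both sides are its derivative.\<close>
lemma sum_root_quotients_mult_class_part:
  assumes k_ge_1: "k \<ge> 1" and regular: "dih_regular k z" and "e < 2"
  shows "(\<Sum>i<k. cinner (dih_root k (2 * i + e)) h / cinner (dih_root k (2 * i + e)) z) * class_part e (z ^ k)
    = class_part e (of_nat k * z ^ (k - 1) * h)"
proof -
  let ?r = "\<lambda>i. dih_root k (2 * i + e)" and ?c = "if even e then 2 * \<i> else 2"
  have "dih_root k j \<noteq> 0" for j
    by (simp add: dih_root_def)
  then have nonzero: "z - dih_refl k (2 * i + e) z \<noteq> 0"
    and quotient: "(h - dih_refl k (2 * i + e) h) / (z - dih_refl k (2 * i + e) z)
      = of_real (cinner (?r i) h / cinner (?r i) z)" if "i < k" for i h
    using that dih_regular_cinner_nonzero[OF regular _ \<open>e < 2\<close>] by (auto simp: dih_refl_eq)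
  have "((\<lambda>z. \<Prod>i<k. z - dih_refl k (2 * i + e) z) has_derivative
      (\<lambda>h. (\<Sum>i<k. (h - dih_refl k (2 * i + e) h) / (z - dih_refl k (2 * i + e) z))
        * (\<Prod>i<k. z - dih_refl k (2 * i + e) z))) (at z)"
    using nonzero
    by (intro has_derivative_prod_logarithmic has_derivative_diff has_derivative_ident
        bounded_linear_imp_has_derivative bounded_linear_dih_refl) auto
  then have "((\<lambda>z. ?c * of_real (class_part e (z ^ k))) has_derivative
      (\<lambda>h. of_real (\<Sum>i<k. cinner (?r i) h / cinner (?r i) z) * (?c * of_real (class_part e (z ^ k))))) (at z)"
    unfolding prod_diff_dih_refl[OF k_ge_1] by (simp add: quotient)
  moreover have "((\<lambda>z. ?c * of_real (class_part e (z ^ k))) has_derivative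
      (\<lambda>h. ?c * of_real (class_part e (of_nat k * z ^ (k - 1) * h)))) (at z)"
    by (intro has_derivative_mult_right has_derivative_of_real
        bounded_linear.has_derivative[OF bounded_linear_class_part] power_has_derivative)
  ultimately have "(\<lambda>h. of_real (\<Sum>i<k. cinner (?r i) h / cinner (?r i) z) * (?c * of_real (class_part e (z ^ k))))
      = (\<lambda>h. ?c * of_real (class_part e (of_nat k * z ^ (k - 1) * h)))"
    by (rule has_derivative_unique)
  from fun_cong[OF this, of h]
  have "?c * complex_of_real ((\<Sum>i<k. cinner (?r i) h / cinner (?r i) z) * class_part e (z ^ k))
      = ?c * of_real (class_part e (of_nat k * z ^ (k - 1) * h))"
    by (simp only: of_real_mult mult_ac)
  then show ?thesis
    by (simp only: mult_cancel_left of_real_eq_iff) (simp split: if_splits)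
qed

section \<open>The generating series\<close>

locale dihedral_kernel =
  fixes k :: nat and \<alpha> \<beta> :: real and w :: complex
  assumes k_ge_1: "k \<ge> 1" and \<alpha>_pos: "\<alpha> > 0" and \<beta>_pos: "\<beta> > 0"
begin

abbreviation "\<nu> \<equiv> \<alpha> + \<beta>"

abbreviation "\<mu> \<equiv> mu_square \<alpha> \<beta>"

abbreviation "\<kappa> \<equiv> dih_mult \<alpha> \<beta>"

sublocale mu: compactly_supported_measure "\<mu>" centered_square
  by (rule compactly_supported_mu_square[OF \<alpha>_pos \<beta>_pos])

definition pairing_factor :: "complex \<Rightarrow> real fps" where
  "pairing_factor z = linear_factor (cinner z w)"

definition orbit_product :: "complex \<Rightarrow> real fps" where
  "orbit_product z = (\<Prod>i<k. pairing_factor (dih_rot k i z))"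

definition orbit_cofactor :: "complex \<Rightarrow> real fps" where
  "orbit_cofactor z = (\<Prod>i\<in>{1..<k}. pairing_factor (dih_rot k i z))"

definition class_term :: "nat \<Rightarrow> complex \<Rightarrow> real fps" where
  "class_term j z = fps_const (2 / 2 ^ k * class_part j (z ^ k) * class_part j (w ^ k)) * fps_X ^ k"

definition deformed_product :: "complex \<Rightarrow> real \<times> real \<Rightarrow> real fps" where
  "deformed_product z x = orbit_product z + (\<Sum>j<2. fps_const (1 - class_coord j x) * class_term j z)"

subsection \<open>Algebraic relations\<close>

lemma pairing_factor_nth_0 [simp]: "pairing_factor z $ 0 = 1"
  by (simp add: pairing_factor_def)

lemma pairing_factor_nonzero [simp]: "pairing_factor z \<noteq> 0"
  using pairing_factor_nth_0[of z] by (metis fps_zero_nth zero_neq_one)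

lemma orbit_product_nth_0 [simp]: "orbit_product z $ 0 = 1"
  by (simp add: orbit_product_def fps_prod_nth_0)

lemma class_term_nth_0 [simp]: "class_term j z $ 0 = 0"
  using k_ge_1 by (simp add: class_term_def)

lemma deformed_product_nth_0 [simp]: "deformed_product z x $ 0 = 1"
  by (simp add: deformed_product_def fps_sum_nth)

lemma pairing_factor_mult_orbit_cofactor: "pairing_factor z * orbit_cofactor z = orbit_product z"
proof -
  have "{..<k} = insert 0 {1..<k}"
    using k_ge_1 by auto
  then show ?thesis
    by (simp add: orbit_product_def orbit_cofactor_def)
qed

lemma sum_class_terms_eq_xi_uv:
  "(\<Sum>j<2. fps_const (c j) * class_term j z) = fps_const (2 / 2 ^ k * (cmod z * cmod w) ^ k
    * xi_uv (c 0) (c 1) (real k * Arg z) (real k * Arg w)) * fps_X ^ k"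
proof -
  have "(\<Sum>j<2. fps_const (c j) * class_term j z)
      = fps_const (\<Sum>j<2. c j * (2 / 2 ^ k * class_part j (z ^ k) * class_part j (w ^ k))) * fps_X ^ k"
    unfolding class_term_def mult.assoc[of "fps_const _", symmetric] fps_const_mult
    by (simp only: numeral_2_eq_2 sum.lessThan_Suc lessThan_0 sum.empty add_0 fps_const_add distrib_right[symmetric])
  also have "(\<Sum>j<2. c j * (2 / 2 ^ k * class_part j (z ^ k) * class_part j (w ^ k)))
      = 2 / 2 ^ k * (cmod z * cmod w) ^ k * xi_uv (c 0) (c 1) (real k * Arg z) (real k * Arg w)"
    by (simp add: numeral_2_eq_2 class_part_def Re_Im_power_polar xi_uv_def power_mult_distrib algebra_simps)
  finally show ?thesis .
qed

lemma orbit_product_eq_chebyshev: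
  "orbit_product z = chebyshev_fps k (cmod z * cmod w) - (\<Sum>j<2. class_term j z)"
proof -
  have "orbit_product z = chebyshev_fps k (cmod z * cmod w)
      - fps_const (2 / 2 ^ k * (cmod z * cmod w) ^ k * cos (real k * (Arg z - Arg w))) * fps_X ^ k"
    unfolding orbit_product_def pairing_factor_def cinner_dih_rot[OF k_ge_1] by (rule prod_linear_factor_cos[OF k_ge_1])
  also have "cos (real k * (Arg z - Arg w)) = xi_uv 1 1 (real k * Arg z) (real k * Arg w)"
    by (simp add: xi_uv_def right_diff_distrib cos_diff)
  finally show ?thesis
    using sum_class_terms_eq_xi_uv[of "\<lambda>_. 1" z] by simp
qed

lemma deformed_product_eq_chebyshev:
  "deformed_product z x
    = chebyshev_fps k (cmod z * cmod w) - (\<Sum>j<2. fps_const (class_coord j x) * class_term j z)"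
  by (simp add: deformed_product_def orbit_product_eq_chebyshev numeral_2_eq_2 algebra_simps flip: fps_const_sub)

lemma orbit_product_dih_rot: "orbit_product (dih_rot k i z) = orbit_product z"
  by (simp add: orbit_product_eq_chebyshev class_term_def power_dih_rot[OF k_ge_1])

lemma class_term_dih_refl:
  "class_term i (dih_refl k j z) = (if even i = even j then - class_term i z else class_term i z)"
  by (simp add: class_term_def class_part_power_dih_refl[OF k_ge_1] flip: fps_const_neg)

lemma orbit_product_dih_refl: "orbit_product (dih_refl k j z) = orbit_product z + 2 * class_term j z"
proof -
  have "class_term j z = class_term (if even j then 0 else 1) z"
    by (simp add: class_term_def class_part_def)
  then show ?thesis
    by (simp add: orbit_product_eq_chebyshev numeral_2_eq_2 class_term_dih_refl)
qed

lemma deformed_product_dih_refl: "deformed_product (dih_refl k j z) x = deformed_product z (class_flip j x)"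
  by (simp add: deformed_product_eq_chebyshev numeral_2_eq_2 class_term_dih_refl class_coord_def class_flip_def
      flip: fps_const_neg)

lemma deformed_product_add_class_axis:
  "deformed_product z (x + t *\<^sub>R class_axis j) = deformed_product z x - fps_const t * class_term j z"
proof -
  have "class_term j z = class_term (if even j then 0 else 1) z"
    by (simp add: class_term_def class_part_def)
  then show ?thesis
    by (simp add: deformed_product_eq_chebyshev numeral_2_eq_2 class_axis_def class_coord_def algebra_simps
        flip: fps_const_add)
qed

lemma prod_pairing_factors_remove:
  assumes "i < k"
  shows "(\<Prod>j\<in>{..<k} - {i}. pairing_factor (dih_rot k j z)) = orbit_cofactor (dih_rot k i z)"
proof -
  have "pairing_factor (dih_rot k i z) * (\<Prod>j\<in>{..<k} - {i}. pairing_factor (dih_rot k j z)) = orbit_product z"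
    unfolding orbit_product_def using assms by (simp add: prod.remove)
  also have "\<dots> = pairing_factor (dih_rot k i z) * orbit_cofactor (dih_rot k i z)"
    unfolding pairing_factor_mult_orbit_cofactor orbit_product_dih_rot ..
  finally show ?thesis
    by simp
qed

lemma fps_XD_pairing_factor: "fps_XD (pairing_factor z) = pairing_factor z - 1"
  by (simp add: pairing_factor_def fps_XD_def mult.commute)

lemma fps_XD_orbit_product:
  "fps_XD (orbit_product z) = of_nat k * orbit_product z - (\<Sum>i<k. orbit_cofactor (dih_rot k i z))"
proof -
  have "(pairing_factor (dih_rot k i z) - 1) * orbit_cofactor (dih_rot k i z)
      = orbit_product z - orbit_cofactor (dih_rot k i z)" for i
    by (simp add: left_diff_distrib pairing_factor_mult_orbit_cofactor orbit_product_dih_rot)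
  then show ?thesis
    unfolding orbit_product_def[of z] fps_XD_prod[OF finite_lessThan] fps_XD_pairing_factor
    by (simp add: prod_pairing_factors_remove sum_subtractf flip: orbit_product_def)
qed

lemma fps_XD_class_term: "fps_XD (class_term j z) = of_nat k * class_term j z"
  by (rule fps_ext) (simp add: class_term_def fps_X_power_nth flip: fps_of_nat)

lemma fps_XD_deformed_product:
  "fps_XD (deformed_product z x)
    = fps_XD (orbit_product z) + (\<Sum>j<2. fps_const (1 - class_coord j x) * fps_XD (class_term j z))"
  by (simp add: deformed_product_def numeral_2_eq_2)

subsection \<open>Derivatives\<close>

text \<open>Primed constants are derivatives in \<open>z\<close>; the argument \<open>h\<close> is the direction.\<close>
definition orbit_product' :: "complex \<Rightarrow> complex \<Rightarrow> real fps" where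
  "orbit_product' z h = - (\<Sum>i<k. fps_const (cinner (dih_rot k i h) w) * fps_X * orbit_cofactor (dih_rot k i z))"

definition orbit_cofactor' :: "complex \<Rightarrow> complex \<Rightarrow> real fps" where
  "orbit_cofactor' z h = (\<Sum>i\<in>{1..<k}. - (fps_const (cinner (dih_rot k i h) w) * fps_X)
    * (\<Prod>j\<in>{1..<k} - {i}. pairing_factor (dih_rot k j z)))"

definition class_term' :: "nat \<Rightarrow> complex \<Rightarrow> complex \<Rightarrow> real fps" where
  "class_term' j z h =
    fps_const (2 / 2 ^ k * class_part j (of_nat k * z ^ (k - 1) * h) * class_part j (w ^ k)) * fps_X ^ k"

definition deformed_product' :: "complex \<Rightarrow> complex \<Rightarrow> real \<times> real \<Rightarrow> real fps" where
  "deformed_product' z h x = orbit_product' z h + (\<Sum>j<2. fps_const (1 - class_coord j x) * class_term' j z h)"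

lemma pairing_factor_has_derivative:
  "fps_has_derivative (\<lambda>z. pairing_factor (dih_rot k i z)) (\<lambda>h. - (fps_const (cinner (dih_rot k i h) w) * fps_X)) z"
proof -
  have "((\<lambda>z. cinner (dih_rot k i z) w) has_derivative (\<lambda>h. cinner (dih_rot k i h) w)) (at z)"
    unfolding cinner_def dih_rot_def by (auto intro!: derivative_eq_intros)
  from fps_has_derivative_diff[OF fps_has_derivative_const
      fps_has_derivative_mult_right[OF fps_has_derivative_fps_const[OF this]]]
  show ?thesis
    unfolding pairing_factor_def by simp
qed

lemma orbit_product_has_derivative: "fps_has_derivative orbit_product (orbit_product' z) z"
proof -
  have "fps_has_derivative orbit_product (\<lambda>h. \<Sum>i<k. - (fps_const (cinner (dih_rot k i h) w) * fps_X) *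
      (\<Prod>j\<in>{..<k} - {i}. pairing_factor (dih_rot k j z))) z"
    unfolding orbit_product_def by (rule fps_has_derivative_prod) (auto intro: pairing_factor_has_derivative)
  then show ?thesis
    unfolding orbit_product'_def by (simp add: prod_pairing_factors_remove sum_negf)
qed

lemma orbit_cofactor_has_derivative: "fps_has_derivative orbit_cofactor (orbit_cofactor' z) z"
  unfolding orbit_cofactor_def orbit_cofactor'_def
  by (rule fps_has_derivative_prod) (auto intro: pairing_factor_has_derivative)

lemma class_term_has_derivative: "fps_has_derivative (class_term j) (class_term' j z) z"
  unfolding class_term_def class_term'_def
  by (intro fps_has_derivative_mult_right fps_has_derivative_fps_const has_derivative_mult_left
      has_derivative_mult_right bounded_linear.has_derivative[OF bounded_linear_class_part] power_has_derivative)

lemma deformed_product_has_derivative: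
  "fps_has_derivative (\<lambda>z. deformed_product z x) (\<lambda>h. deformed_product' z h x) z"
  unfolding deformed_product_def deformed_product'_def
  by (intro fps_has_derivative_add fps_has_derivative_sum fps_has_derivative_mult_left
      orbit_product_has_derivative class_term_has_derivative)

lemma orbit_product'_dih_refl:
  "orbit_product' (dih_refl k j z) (dih_refl k j h) = orbit_product' z h + 2 * class_term' j z h"
proof -
  have "fps_has_derivative (\<lambda>z. orbit_product (dih_refl k j z))
      (\<lambda>h. orbit_product' (dih_refl k j z) (dih_refl k j h)) z"
    by (rule fps_has_derivative_compose_linear[OF bounded_linear_dih_refl orbit_product_has_derivative])
  moreover have "fps_has_derivative (\<lambda>z. orbit_product (dih_refl k j z))
      (\<lambda>h. orbit_product' z h + 2 * class_term' j z h) z"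
    unfolding orbit_product_dih_refl
    by (intro fps_has_derivative_add fps_has_derivative_mult_left orbit_product_has_derivative class_term_has_derivative)
  ultimately show ?thesis
    by (rule fps_has_derivative_unique)
qed

lemma continuous_on_dih_rot [continuous_intros]: "continuous_on S f \<Longrightarrow> continuous_on S (\<lambda>x. dih_rot k i (f x))"
  unfolding dih_rot_def by (intro continuous_intros)

lemma fps_continuous_on_pairing_factor [fps_continuous_intros]:
  "continuous_on S f \<Longrightarrow> fps_continuous_on S (\<lambda>x. pairing_factor (f x))"
  unfolding pairing_factor_def cinner_def by (intro fps_continuous_intros continuous_intros)

lemma fps_continuous_on_orbit_cofactor [fps_continuous_intros]:
  "continuous_on S f \<Longrightarrow> fps_continuous_on S (\<lambda>x. orbit_cofactor (f x))"
  unfolding orbit_cofactor_def by (intro fps_continuous_intros continuous_intros)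

lemma continuous_on_class_part [continuous_intros]: "continuous_on S f \<Longrightarrow> continuous_on S (\<lambda>x. class_part j (f x))"
  by (rule bounded_linear.continuous_on[OF bounded_linear_class_part])

lemma fps_continuous_on_deformed_product [fps_continuous_intros]:
  "continuous_on S f \<Longrightarrow> continuous_on S g \<Longrightarrow> fps_continuous_on S (\<lambda>x. deformed_product (f x) (g x))"
  unfolding deformed_product_def orbit_product_def class_term_def
  by (intro fps_continuous_intros continuous_intros)

lemma fps_continuous_on_orbit_product' [fps_continuous_intros]:
  "continuous_on S f \<Longrightarrow> fps_continuous_on S (\<lambda>x. orbit_product' (f x) h)"
  unfolding orbit_product'_def by (intro fps_continuous_intros continuous_intros)

lemma fps_continuous_on_class_term' [fps_continuous_intros]:
  "continuous_on S f \<Longrightarrow> fps_continuous_on S (\<lambda>x. class_term' j (f x) h)"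
  unfolding class_term'_def by (intro fps_continuous_intros continuous_intros)

lemma fps_continuous_on_deformed_product' [fps_continuous_intros]:
  "continuous_on S f \<Longrightarrow> continuous_on S g \<Longrightarrow> fps_continuous_on S (\<lambda>x. deformed_product' (f x) h (g x))"
  unfolding deformed_product'_def by (intro fps_continuous_intros continuous_intros)

subsection \<open>Averages over the square\<close>

definition power_average :: "complex \<Rightarrow> real fps" where
  "power_average z = fps_lebesgue_integral \<mu> (\<lambda>x. fps_powr (deformed_product z x) (- \<nu> - 1))"

definition weighted_average :: "(real \<times> real \<Rightarrow> real) \<Rightarrow> complex \<Rightarrow> real fps" where
  "weighted_average a z =
    fps_const (\<nu> + 1) * fps_lebesgue_integral \<mu> (\<lambda>x. fps_const (a x) * fps_powr (deformed_product z x) (- \<nu> - 2))"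

abbreviation "full_average \<equiv> weighted_average (\<lambda>_. 1)"

abbreviation "class_average j \<equiv> weighted_average (\<lambda>x. 1 - class_coord j x)"

lemma fps_continuous_on_weighted_power:
  "continuous_on UNIV a \<Longrightarrow> fps_continuous_on UNIV (\<lambda>x. fps_const (a x) * fps_powr (deformed_product z x) c)"
  by (intro fps_continuous_intros continuous_intros)

lemma integral_linear_combination:
  "fps_lebesgue_integral \<mu> (\<lambda>x. fps_const (\<nu> + 1) * fps_powr (deformed_product z x) (- \<nu> - 2)
      * (A + (\<Sum>j<2. fps_const (1 - class_coord j x) * B j)))
    = A * full_average z + (\<Sum>j<2. B j * class_average j z)"
proof -
  let ?P = "\<lambda>a x. fps_const (a x) * fps_powr (deformed_product z x) (- \<nu> - 2)"
  have continuous: "fps_continuous_on UNIV (\<lambda>x. C * ?P a x)" if "continuous_on UNIV a" for a C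
    using that by (intro fps_continuous_intros continuous_intros)
  have integral_weighted: "fps_lebesgue_integral \<mu> (\<lambda>x. (C * fps_const (\<nu> + 1)) * ?P a x) = C * weighted_average a z"
    if "continuous_on UNIV a" for a C
    using mu.fps_lebesgue_integral_mult[OF fps_continuous_on_weighted_power[OF that], of "C * fps_const (\<nu> + 1)"]
    by (simp only: weighted_average_def mult.assoc)
  have continuous_weight: "continuous_on UNIV (\<lambda>x. 1 - class_coord j x)" for j
    by (intro continuous_intros)
  have "fps_const (\<nu> + 1) * fps_powr (deformed_product z x) (- \<nu> - 2)
      * (A + (\<Sum>j<2. fps_const (1 - class_coord j x) * B j))
    = (A * fps_const (\<nu> + 1)) * ?P (\<lambda>_. 1) x
      + (\<Sum>j<2. (B j * fps_const (\<nu> + 1)) * ?P (\<lambda>x. 1 - class_coord j x) x)" for x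
    by (simp only: distrib_left sum_distrib_left fps_const_1_eq_1 mult_1 mult_ac)
  then show ?thesis
    by (simp only: mu.fps_lebesgue_integral_add[OF continuous[OF continuous_on_const] fps_continuous_on_sum[OF continuous[OF continuous_weight]]]
        mu.fps_lebesgue_integral_sum[OF continuous[OF continuous_weight]] integral_weighted[OF continuous_weight] integral_weighted[OF continuous_on_const])
qed

lemma power_average_recurrence:
  "fps_const (\<nu> + 1) * power_average z
    = orbit_product z * full_average z + (\<Sum>j<2. class_term j z * class_average j z)"
proof -
  have shift: "deformed_product z x * fps_powr (deformed_product z x) (- \<nu> - 2)
      = fps_powr (deformed_product z x) (- \<nu> - 1)" for x
    using mult_fps_powr[OF deformed_product_nth_0, of z x "- \<nu> - 2"] by simp
  have "fps_const (\<nu> + 1) * fps_powr (deformed_product z x) (- \<nu> - 1)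
      = fps_const (\<nu> + 1) * fps_powr (deformed_product z x) (- \<nu> - 2) * deformed_product z x" for x
    unfolding shift[symmetric] by (simp only: mult_ac)
  moreover have "fps_continuous_on UNIV (\<lambda>x. fps_powr (deformed_product z x) (- \<nu> - 1))"
    by (intro fps_continuous_intros continuous_intros)
  ultimately have "fps_const (\<nu> + 1) * power_average z
    = fps_lebesgue_integral \<mu> (\<lambda>x. fps_const (\<nu> + 1) * fps_powr (deformed_product z x) (- \<nu> - 2) * deformed_product z x)"
    unfolding power_average_def by (simp only: flip: mu.fps_lebesgue_integral_mult)
  then show ?thesis
    using integral_linear_combination[of z "orbit_product z" "\<lambda>j. class_term j z"]
    by (simp only: deformed_product_def[symmetric])
qed

lemma fps_const_minus_\<nu>_minus_1: "fps_const (- \<nu> - 1) = - fps_const (\<nu> + 1)"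
  by simp

lemma power_average_integrand_has_derivative:
  "fps_has_derivative (\<lambda>z. fps_powr (deformed_product z x) (- \<nu> - 1))
    (\<lambda>h. - (fps_const (\<nu> + 1) * fps_powr (deformed_product z x) (- \<nu> - 2) * deformed_product' z h x)) z"
proof -
  have "- \<nu> - 1 - 1 = - \<nu> - 2"
    by simp
  then show ?thesis
    using fps_has_derivative_fps_powr[OF deformed_product_has_derivative deformed_product_nth_0, where c = "- \<nu> - 1"]
    by (simp only: fps_const_minus_\<nu>_minus_1 mult_minus_left)
qed

definition power_average' :: "complex \<Rightarrow> complex \<Rightarrow> real fps" where
  "power_average' z h = - (orbit_product' z h * full_average z + (\<Sum>j<2. class_term' j z h * class_average j z))"

lemma power_average_has_derivative: "fps_has_derivative power_average (power_average' z) z"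
proof -
  let ?f' = "\<lambda>z h x. - (fps_const (\<nu> + 1) * fps_powr (deformed_product z x) (- \<nu> - 2) * deformed_product' z h x)"
  have "fps_has_derivative power_average (\<lambda>h. fps_lebesgue_integral \<mu> (?f' z h)) z"
    unfolding power_average_def
  proof (rule mu.fps_has_derivative_fps_lebesgue_integral[OF power_average_integrand_has_derivative])
    show "fps_continuous_on UNIV (\<lambda>x. fps_powr (deformed_product z x) (- \<nu> - 1))" for z
      by (intro fps_continuous_intros continuous_intros)
    show "fps_continuous_on UNIV (\<lambda>(z, x). ?f' z h x)" for h
      unfolding case_prod_unfold by (intro fps_continuous_intros continuous_intros)
  qed
  moreover have "fps_lebesgue_integral \<mu> (?f' z h) = power_average' z h" for h
  proof -
    have "fps_lebesgue_integral \<mu> (?f' z h) = - fps_lebesgue_integral \<mu>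
        (\<lambda>x. fps_const (\<nu> + 1) * fps_powr (deformed_product z x) (- \<nu> - 2) * deformed_product' z h x)"
      by (rule fps_ext) simp
    then show ?thesis
      unfolding power_average'_def deformed_product'_def integral_linear_combination .
  qed
  ultimately show ?thesis
    by simp
qed

lemma fps_XD_power_average:
  "fps_XD (power_average z)
    = - (fps_XD (orbit_product z) * full_average z + (\<Sum>j<2. fps_XD (class_term j z) * class_average j z))"
proof -
  have "- \<nu> - 1 - 1 = - \<nu> - 2"
    by simp
  then have "fps_XD (power_average z) = fps_lebesgue_integral \<mu> (\<lambda>x.
      - (fps_const (\<nu> + 1) * fps_powr (deformed_product z x) (- \<nu> - 2) * fps_XD (deformed_product z x)))"
    unfolding power_average_def fps_XD_fps_lebesgue_integral fps_XD_fps_powr[OF deformed_product_nth_0]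
    by (simp only: fps_const_minus_\<nu>_minus_1 mult_minus_left)
  also have "\<dots> = - fps_lebesgue_integral \<mu>
      (\<lambda>x. fps_const (\<nu> + 1) * fps_powr (deformed_product z x) (- \<nu> - 2) * fps_XD (deformed_product z x))"
    by (rule fps_ext) simp
  finally show ?thesis
    unfolding fps_XD_deformed_product integral_linear_combination .
qed

lemma deformed_power_has_class_axis_derivative:
  "((\<lambda>t. fps_powr (deformed_product z (x + t *\<^sub>R class_axis j)) (- \<nu> - 1) $ n) has_real_derivative
    (fps_const (\<nu> + 1) * fps_powr (deformed_product z x) (- \<nu> - 2) * class_term j z) $ n) (at 0)"
proof -
  let ?F = "\<lambda>t. deformed_product z (x + t *\<^sub>R class_axis j)"
  have "fps_has_derivative ?F (\<lambda>h. 0 - fps_const h * class_term j z) (0::real)"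
    unfolding deformed_product_add_class_axis
    by (intro fps_has_derivative_diff fps_has_derivative_const fps_has_derivative_mult_right
        fps_has_derivative_fps_const has_derivative_ident)
  note this[THEN fps_has_derivative_fps_powr, OF deformed_product_nth_0, where c = "- \<nu> - 1"]
  moreover have "- \<nu> - 1 - 1 = - \<nu> - 2"
    by simp
  moreover have "- c * p * (0 - a * t) = a * (c * p * t)" for a c p t :: "real fps"
    by simp
  ultimately have "fps_has_derivative (\<lambda>t. fps_powr (?F t) (- \<nu> - 1))
      (\<lambda>h. fps_const h * (fps_const (\<nu> + 1) * fps_powr (deformed_product z x) (- \<nu> - 2) * class_term j z)) 0"
    by (simp only: fps_const_minus_\<nu>_minus_1 scaleR_zero_left add_0_right)
  from fps_has_derivative_nth[OF this, of n] show ?thesis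
    by (simp add: has_field_derivative_def mult_commute_abs)
qed

text \<open>This is integration by parts in the coordinate of the class of \<open>j\<close>.\<close>
lemma power_average_dih_refl:
  "fps_const (\<kappa> j) * power_average (dih_refl k j z)
    = fps_const (\<kappa> j) * power_average z - class_term j z * class_average j z"
proof (rule fps_ext)
  fix n
  let ?F = "deformed_product z" and ?T = "class_term j z"
  let ?g = "\<lambda>x. fps_powr (?F x) (- \<nu> - 1)" and ?g' = "\<lambda>x. fps_const (\<nu> + 1) * fps_powr (?F x) (- \<nu> - 2) * ?T"
  have "(\<integral>x. (1 - class_coord j x) * ?g' x $ n \<partial>\<mu>)
      = \<kappa> j * ((\<integral>x. ?g x $ n \<partial>\<mu>) - (\<integral>x. ?g (class_flip j x) $ n \<partial>\<mu>))"
    by (intro integral_by_parts_class_coord \<alpha>_pos \<beta>_pos deformed_power_has_class_axis_derivative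
        fps_continuous_on_nth fps_continuous_intros continuous_intros)
  moreover have "(?T * class_average j z) $ n = (\<integral>x. (1 - class_coord j x) * ?g' x $ n \<partial>\<mu>)"
  proof -
    have "?T * class_average j z = fps_lebesgue_integral \<mu> (\<lambda>x. (?T * fps_const (\<nu> + 1)) *
        (fps_const (1 - class_coord j x) * fps_powr (?F x) (- \<nu> - 2)))"
      unfolding weighted_average_def mult.assoc[symmetric, of ?T]
      by (intro mu.fps_lebesgue_integral_mult[symmetric] fps_continuous_on_weighted_power continuous_intros)
    also have "\<dots> = fps_lebesgue_integral \<mu> (\<lambda>x. fps_const (1 - class_coord j x) * ?g' x)"
      by (simp only: mult_ac)
    finally show ?thesis
      by simp
  qed
  ultimately show "(fps_const (\<kappa> j) * power_average (dih_refl k j z)) $ n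
      = (fps_const (\<kappa> j) * power_average z - ?T * class_average j z) $ n"
    by (simp add: power_average_def deformed_product_dih_refl right_diff_distrib)
qed

end

section \<open>The Dunkl equation of the generating series\<close>

lemma sum_lessThan_double:
  fixes f :: "nat \<Rightarrow> 'a::comm_monoid_add"
  shows "(\<Sum>j<2 * n. f j) = (\<Sum>e<2. \<Sum>i<n. f (2 * i + e))"
  by (induction n) (simp_all add: numeral_2_eq_2 ac_simps)

text \<open>The derivation \<open>\<delta>\<close> acts as \<open>dX\<close> on each series \<open>X\<close> with a prefixed name, and \<open>D + 2 * T e\<close> is \<open>D\<close> at
  the point reflected in the class \<open>e\<close>.\<close>
lemma reflection_derivation_identity:
  fixes D J I dD dJ :: "'a::comm_ring_1" and \<kappa> s T dT X Jr :: "'e \<Rightarrow> 'a"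
  assumes recurrence: "(1 + (\<Sum>e\<in>E. \<kappa> e)) * J = D * I + (\<Sum>e\<in>E. T e * X e)"
    and dJ: "dJ = - (dD * I + (\<Sum>e\<in>E. dT e * X e))"
    and Jr: "\<And>e. e \<in> E \<Longrightarrow> \<kappa> e * Jr e = \<kappa> e * J - T e * X e"
    and dT: "\<And>e. e \<in> E \<Longrightarrow> s e * T e = dT e"
  shows "dD * J + D * dJ + (\<Sum>e\<in>E. \<kappa> e * (s e * (D * J - (D + 2 * T e) * Jr e) + Jr e * (dD + 2 * dT e))) = 0"
proof -
  have summand: "\<kappa> e * (s e * (D * J - (D + 2 * T e) * Jr e) + Jr e * (dD + 2 * dT e))
      = D * (dT e * X e) + dD * (\<kappa> e * J - T e * X e)" if "e \<in> E" for e
  proof -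
    have "\<kappa> e * (s e * (D * J - (D + 2 * T e) * Jr e) + Jr e * (dD + 2 * dT e))
        = s e * (D * (\<kappa> e * J) - (D + 2 * T e) * (\<kappa> e * Jr e)) + (\<kappa> e * Jr e) * (dD + 2 * dT e)"
      by (simp add: algebra_simps)
    also have "\<dots> = D * (dT e * X e) + dD * (\<kappa> e * J - T e * X e)"
      unfolding Jr[OF that] dT[OF that, symmetric] by (simp add: algebra_simps)
    finally show ?thesis .
  qed
  have "(\<Sum>e\<in>E. \<kappa> e * (s e * (D * J - (D + 2 * T e) * Jr e) + Jr e * (dD + 2 * dT e)))
      = D * (\<Sum>e\<in>E. dT e * X e) + dD * ((\<Sum>e\<in>E. \<kappa> e) * J - (\<Sum>e\<in>E. T e * X e))"
    unfolding sum_distrib_left sum_distrib_right sum_subtractf[symmetric] sum.distrib[symmetric]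
    by (intro sum.cong summand refl)
  then have "dD * J + D * dJ + (\<Sum>e\<in>E. \<kappa> e * (s e * (D * J - (D + 2 * T e) * Jr e) + Jr e * (dD + 2 * dT e)))
      = dD * ((1 + (\<Sum>e\<in>E. \<kappa> e)) * J - D * I - (\<Sum>e\<in>E. T e * X e))"
    unfolding dJ by (simp add: algebra_simps)
  then show ?thesis
    unfolding recurrence by simp
qed

context dihedral_kernel
begin

definition dunkl_series :: "complex \<Rightarrow> real fps" where
  "dunkl_series z = orbit_cofactor z * power_average z"

definition dunkl_series' :: "complex \<Rightarrow> complex \<Rightarrow> real fps" where
  "dunkl_series' z h = orbit_cofactor z * power_average' z h + orbit_cofactor' z h * power_average z"

text \<open>The derivation along the vector field \<open>h \<cdot> \<nabla> - \<langle>h, w\<rangle> X\<^sup>2 d/dX\<close>, for a series \<open>f\<close> with derivative \<open>f'\<close> in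
  the direction \<open>h\<close>; it multiplies \<open>pairing_factor\<close> by \<open>- \<langle>h, w\<rangle> X\<close>.\<close>
definition dunkl_derivation :: "complex \<Rightarrow> real fps \<Rightarrow> real fps \<Rightarrow> real fps" where
  "dunkl_derivation h f f' = f' - fps_const (cinner h w) * fps_X * fps_XD f"

lemma dunkl_derivation_mult:
  "dunkl_derivation h (f * g) (f * g' + f' * g) = f * dunkl_derivation h g g' + dunkl_derivation h f f' * g"
  by (simp add: dunkl_derivation_def fps_XD_mult algebra_simps)

lemma dunkl_series_has_derivative: "fps_has_derivative dunkl_series (dunkl_series' z) z"
  unfolding dunkl_series_def dunkl_series'_def
  by (intro fps_has_derivative_mult orbit_cofactor_has_derivative power_average_has_derivative)

lemma pairing_factor_mult_dunkl_series: "pairing_factor z * dunkl_series z = orbit_product z * power_average z"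
  unfolding dunkl_series_def mult.assoc[symmetric] pairing_factor_mult_orbit_cofactor ..

lemma power_average_dih_rot: "power_average (dih_rot k i z) = power_average z"
  by (simp add: power_average_def deformed_product_def orbit_product_dih_rot class_term_def power_dih_rot[OF k_ge_1])

lemma dunkl_derivation_dunkl_series:
  "pairing_factor z * dunkl_derivation h (dunkl_series z) (dunkl_series' z h)
    = dunkl_derivation h (orbit_product z) (orbit_product' z h) * power_average z
      + orbit_product z * dunkl_derivation h (power_average z) (power_average' z h)
      + fps_const (cinner h w) * fps_X * (orbit_product z * power_average z)"
proof -
  let ?W = "fps_const (cinner h w) * fps_X"
  have "fps_has_derivative (\<lambda>z. pairing_factor z * dunkl_series z)
      (\<lambda>h. pairing_factor z * dunkl_series' z h + - (fps_const (cinner h w) * fps_X) * dunkl_series z) z"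
    using fps_has_derivative_mult[OF pairing_factor_has_derivative[of 0] dunkl_series_has_derivative] by simp
  moreover have "fps_has_derivative (\<lambda>z. pairing_factor z * dunkl_series z)
      (\<lambda>h. orbit_product z * power_average' z h + orbit_product' z h * power_average z) z"
    unfolding pairing_factor_mult_dunkl_series
    by (intro fps_has_derivative_mult orbit_product_has_derivative power_average_has_derivative)
  ultimately have derivatives_agree: "pairing_factor z * dunkl_series' z h + - ?W * dunkl_series z
      = orbit_product z * power_average' z h + orbit_product' z h * power_average z"
    by (rule fps_has_derivative_unique)
  have "dunkl_derivation h (pairing_factor z) (- ?W) = - ?W * pairing_factor z"
    by (simp add: dunkl_derivation_def fps_XD_pairing_factor algebra_simps)
  then have "pairing_factor z * dunkl_derivation h (dunkl_series z) (dunkl_series' z h)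
      = dunkl_derivation h (pairing_factor z * dunkl_series z)
          (pairing_factor z * dunkl_series' z h + - ?W * dunkl_series z)
        + ?W * (pairing_factor z * dunkl_series z)"
    unfolding dunkl_derivation_mult by (simp add: algebra_simps)
  also have "\<dots> = dunkl_derivation h (orbit_product z * power_average z)
          (orbit_product z * power_average' z h + orbit_product' z h * power_average z)
        + ?W * (orbit_product z * power_average z)"
    unfolding derivatives_agree pairing_factor_mult_dunkl_series ..
  finally show ?thesis
    unfolding dunkl_derivation_mult by (simp add: algebra_simps)
qed

lemma dunkl_derivation_power_average:
  "dunkl_derivation h (power_average z) (power_average' z h)
    = - (dunkl_derivation h (orbit_product z) (orbit_product' z h) * full_average z
        + (\<Sum>j<2. dunkl_derivation h (class_term j z) (class_term' j z h) * class_average j z))"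
  unfolding dunkl_derivation_def power_average'_def fps_XD_power_average
  by (simp add: numeral_2_eq_2 algebra_simps)

lemma dunkl_derivation_orbit_product_dih_refl:
  "dunkl_derivation h (orbit_product (dih_refl k j z)) (orbit_product' (dih_refl k j z) (dih_refl k j h))
    = dunkl_derivation h (orbit_product z) (orbit_product' z h)
      + 2 * dunkl_derivation h (class_term j z) (class_term' j z h)"
  unfolding dunkl_derivation_def orbit_product_dih_refl orbit_product'_dih_refl mult_2 fps_XD_add
  by (simp only: distrib_left diff_conv_add_uminus minus_add_distrib ac_simps)

definition root_quotient_sum :: "nat \<Rightarrow> complex \<Rightarrow> complex \<Rightarrow> real" where
  "root_quotient_sum e z h = (\<Sum>i<k. cinner (dih_root k (2 * i + e)) h / cinner (dih_root k (2 * i + e)) z)"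

lemma dunkl_derivation_class_term:
  assumes "dih_regular k z" "e < 2"
  shows "(fps_const (root_quotient_sum e z h)
      - of_nat k * (fps_const (cinner h w) * fps_X)) * class_term e z
    = dunkl_derivation h (class_term e z) (class_term' e z h)"
proof -
  let ?S = "root_quotient_sum e z h"
  have "?S * (2 / 2 ^ k * class_part e (z ^ k) * class_part e (w ^ k))
      = 2 / 2 ^ k * (?S * class_part e (z ^ k)) * class_part e (w ^ k)"
    by (simp only: mult_ac)
  also have "?S * class_part e (z ^ k) = class_part e (of_nat k * z ^ (k - 1) * h)"
    unfolding root_quotient_sum_def by (rule sum_root_quotients_mult_class_part[OF k_ge_1 assms])
  finally have "fps_const ?S * class_term e z = class_term' e z h"
    unfolding class_term_def class_term'_def mult.assoc[of "fps_const _" "fps_const _", symmetric] fps_const_mult by simp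
  then show ?thesis
    unfolding dunkl_derivation_def fps_XD_class_term left_diff_distrib by (simp only: mult_ac)
qed

lemma sum_root_products_mult_orbit_cofactor:
  fixes z h :: complex and e :: nat
  defines "y \<equiv> dih_refl k e z"
  shows "(\<Sum>i<k. fps_const (2 * cinner (dih_root k (2 * i + e)) h * cinner (dih_root k (2 * i + e)) w) * fps_X
        * orbit_cofactor (dih_rot k i y))
    = dunkl_derivation h (orbit_product y) (orbit_product' y (dih_refl k e h))
      + fps_const (cinner h w) * fps_X * (of_nat k * orbit_product y)"
proof -
  let ?W = "fps_const (cinner h w) * fps_X" and ?M = "\<lambda>i. orbit_cofactor (dih_rot k i y)"
  have "2 * cinner (dih_root k (2 * i + e)) h * cinner (dih_root k (2 * i + e)) w
      = cinner h w - cinner (dih_rot k i (dih_refl k e h)) w" for i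
    unfolding dih_refl_eq_dih_rot[OF k_ge_1, symmetric] cinner_dih_refl by simp
  then have "(\<Sum>i<k. fps_const (2 * cinner (dih_root k (2 * i + e)) h * cinner (dih_root k (2 * i + e)) w) * fps_X * ?M i)
      = ?W * (\<Sum>i<k. ?M i) + orbit_product' y (dih_refl k e h)"
    by (simp add: orbit_product'_def sum_distrib_left sum_subtractf left_diff_distrib flip: fps_const_sub)
  also have "(\<Sum>i<k. ?M i) = of_nat k * orbit_product y - fps_XD (orbit_product y)"
    by (simp add: fps_XD_orbit_product)
  finally show ?thesis
    by (simp add: dunkl_derivation_def algebra_simps)
qed

lemma pairing_factor_mult_reflection_difference:
  fixes z h :: complex and e i :: nat
  assumes "cinner (dih_root k (2 * i + e)) z \<noteq> 0"
  defines "y \<equiv> dih_refl k e z" and "q \<equiv> cinner (dih_root k (2 * i + e)) h / cinner (dih_root k (2 * i + e)) z"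
  shows "pairing_factor z * (fps_const q * (dunkl_series z - dunkl_series (dih_refl k (2 * i + e) z)))
    = fps_const q * (orbit_product z * power_average z - orbit_product y * power_average y)
      + power_average y * (fps_const (2 * cinner (dih_root k (2 * i + e)) h * cinner (dih_root k (2 * i + e)) w) * fps_X
          * orbit_cofactor (dih_rot k i y))"
proof -
  let ?r = "dih_root k (2 * i + e)" and ?A = "pairing_factor (dih_rot k i y)" and ?M = "orbit_cofactor (dih_rot k i y)"
  let ?c = "2 * cinner ?r z * cinner ?r w"
  have "pairing_factor z = ?A - fps_const ?c * fps_X"
    unfolding y_def dih_refl_eq_dih_rot[OF k_ge_1, symmetric] pairing_factor_def cinner_dih_refl
    by (simp add: algebra_simps flip: fps_const_sub)
  moreover have "dunkl_series (dih_refl k (2 * i + e) z) = ?M * power_average y"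
    unfolding dunkl_series_def dih_refl_eq_dih_rot[OF k_ge_1] y_def[symmetric] power_average_dih_rot ..
  ultimately have reflected: "pairing_factor z * dunkl_series (dih_refl k (2 * i + e) z)
      = orbit_product y * power_average y - fps_const ?c * (fps_X * ?M * power_average y)"
    using pairing_factor_mult_orbit_cofactor[of "dih_rot k i y"]
    by (simp add: left_diff_distrib orbit_product_dih_rot mult.assoc flip: mult.assoc[of ?A])
  have "fps_const q * (fps_const ?c * (fps_X * ?M * power_average y))
      = power_average y * ((fps_const q * fps_const ?c) * fps_X * ?M)"
    by (simp only: mult_ac)
  also have "fps_const q * fps_const ?c = fps_const (2 * cinner ?r h * cinner ?r w)"
    using assms(1) by (simp add: q_def)
  finally have "fps_const q * (fps_const ?c * (fps_X * ?M * power_average y))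
      = power_average y * (fps_const (2 * cinner ?r h * cinner ?r w) * fps_X * ?M)" .
  moreover have "pairing_factor z * (fps_const q * (dunkl_series z - dunkl_series (dih_refl k (2 * i + e) z)))
      = fps_const q * (pairing_factor z * dunkl_series z - pairing_factor z * dunkl_series (dih_refl k (2 * i + e) z))"
    by (simp only: right_diff_distrib mult_ac)
  ultimately show ?thesis
    unfolding reflected pairing_factor_mult_dunkl_series by (simp add: right_diff_distrib)
qed

lemma reflection_class_sum:
  fixes z h :: complex and e :: nat
  assumes regular: "dih_regular k z" and "e < 2"
  defines "y \<equiv> dih_refl k e z" and "W \<equiv> fps_const (cinner h w) * fps_X"
  shows "pairing_factor z * (\<Sum>i<k. fps_const (cinner (dih_root k (2 * i + e)) h / cinner (dih_root k (2 * i + e)) z)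
        * (dunkl_series z - dunkl_series (dih_refl k (2 * i + e) z)))
    = (fps_const (root_quotient_sum e z h) - of_nat k * W)
        * (orbit_product z * power_average z - orbit_product y * power_average y)
      + power_average y * dunkl_derivation h (orbit_product y) (orbit_product' y (dih_refl k e h))
      + of_nat k * W * (orbit_product z * power_average z)"
proof -
  let ?r = "\<lambda>i. dih_root k (2 * i + e)"
  have sum_const: "fps_const (\<Sum>i<n. f i) = (\<Sum>i<n. fps_const (f i))" for f :: "nat \<Rightarrow> real" and n
    by (induction n) (auto simp flip: fps_const_add)
  have "pairing_factor z * (\<Sum>i<k. fps_const (cinner (?r i) h / cinner (?r i) z)
        * (dunkl_series z - dunkl_series (dih_refl k (2 * i + e) z)))
    = (\<Sum>i<k. fps_const (cinner (?r i) h / cinner (?r i) z)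
          * (orbit_product z * power_average z - orbit_product y * power_average y)
        + power_average y * (fps_const (2 * cinner (?r i) h * cinner (?r i) w) * fps_X * orbit_cofactor (dih_rot k i y)))"
    unfolding sum_distrib_left y_def
    by (intro sum.cong refl pairing_factor_mult_reflection_difference dih_regular_cinner_nonzero[OF regular _ \<open>e < 2\<close>]) simp
  also have "\<dots> = fps_const (root_quotient_sum e z h) * (orbit_product z * power_average z - orbit_product y * power_average y)
      + power_average y * (dunkl_derivation h (orbit_product y) (orbit_product' y (dih_refl k e h))
        + W * (of_nat k * orbit_product y))"
    unfolding y_def W_def sum_root_products_mult_orbit_cofactor[symmetric] root_quotient_sum_def sum_const
    by (simp only: sum.distrib sum_distrib_left sum_distrib_right)
  finally show ?thesis
    by (simp add: algebra_simps)
qed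

lemma reflection_class_sums_vanish:
  fixes z h :: complex
  assumes regular: "dih_regular k z"
  defines "y \<equiv> \<lambda>e. dih_refl k e z" and "W \<equiv> fps_const (cinner h w) * fps_X"
  shows "dunkl_derivation h (orbit_product z) (orbit_product' z h) * power_average z
      + orbit_product z * dunkl_derivation h (power_average z) (power_average' z h)
      + (\<Sum>e<2. fps_const (\<kappa> e)
        * ((fps_const (root_quotient_sum e z h) - of_nat k * W)
            * (orbit_product z * power_average z - orbit_product (y e) * power_average (y e))
          + power_average (y e) * dunkl_derivation h (orbit_product (y e)) (orbit_product' (y e) (dih_refl k e h)))) = 0"
  unfolding y_def dunkl_derivation_orbit_product_dih_refl
  unfolding orbit_product_dih_refl
proof (rule reflection_derivation_identity[OF _ dunkl_derivation_power_average power_average_dih_refl])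
  have "fps_const (\<nu> + 1) = 1 + (\<Sum>e<2. fps_const (\<kappa> e))"
    by (simp add: numeral_2_eq_2 dih_mult_def)
  then show "(1 + (\<Sum>e<2. fps_const (\<kappa> e))) * power_average z
      = orbit_product z * full_average z + (\<Sum>e<2. class_term e z * class_average e z)"
    using power_average_recurrence[of z] by simp
  show "(fps_const (root_quotient_sum e z h) - of_nat k * W)
      * class_term e z = dunkl_derivation h (class_term e z) (class_term' e z h)" if "e \<in> {..<2}" for e
    unfolding W_def using that by (intro dunkl_derivation_class_term regular) simp
qed

lemma dunkl_equation_dunkl_series:
  assumes regular: "dih_regular k z"
  shows "dunkl_series' z h + (\<Sum>j<2*k. fps_const (\<kappa> j * cinner (dih_root k j) h / cinner (dih_root k j) z)
        * (dunkl_series z - dunkl_series (dih_refl k j z)))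
    = fps_const (cinner h w) * (fps_X * fps_XDp (real k * \<nu> + 1) (dunkl_series z))" (is "?lhs = ?rhs")
proof -
  let ?A = "pairing_factor z" and ?L = "dunkl_series z" and ?DJ = "orbit_product z * power_average z"
  let ?W = "fps_const (cinner h w) * fps_X"
  let ?q = "\<lambda>j. cinner (dih_root k j) h / cinner (dih_root k j) z"
  have derivative: "?A * dunkl_series' z h = ?A * dunkl_derivation h ?L (dunkl_series' z h) + ?W * (?A * fps_XD ?L)"
    by (simp add: dunkl_derivation_def algebra_simps)
  have "(\<Sum>j<2*k. fps_const (\<kappa> j * cinner (dih_root k j) h / cinner (dih_root k j) z) * (?L - dunkl_series (dih_refl k j z)))
      = (\<Sum>e<2. fps_const (\<kappa> e) * (\<Sum>i<k. fps_const (?q (2 * i + e)) * (?L - dunkl_series (dih_refl k (2 * i + e) z))))"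
    unfolding sum_lessThan_double sum_distrib_left mult.assoc[symmetric] fps_const_mult
    by (intro sum.cong refl) (simp add: dih_mult_def)
  then have "?A * ?lhs = ?A * dunkl_series' z h
      + (\<Sum>e<2. fps_const (\<kappa> e) * (?A * (\<Sum>i<k. fps_const (?q (2 * i + e)) * (?L - dunkl_series (dih_refl k (2 * i + e) z)))))"
    by (simp only: distrib_left sum_distrib_left mult.left_commute[of ?A])
  also have "\<dots> = ?W * (?A * fps_XD ?L) + ?W * ?DJ + (\<Sum>e<2. fps_const (\<kappa> e) * (of_nat k * ?W * ?DJ))"
    using reflection_class_sums_vanish[OF regular, of h]
    unfolding derivative dunkl_derivation_dunkl_series
    by (simp add: reflection_class_sum[OF regular] distrib_left[of "fps_const (\<kappa> _)"] sum.distrib add.assoc)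
  also have "(\<Sum>e<2. fps_const (\<kappa> e) * (of_nat k * ?W * ?DJ)) = (of_nat k * (\<Sum>e<2. fps_const (\<kappa> e))) * (?W * ?DJ)"
    by (simp only: sum_distrib_left sum_distrib_right mult_ac)
  also have "of_nat k * (\<Sum>e<2. fps_const (\<kappa> e)) = fps_const (real k * \<nu>)"
    by (simp add: numeral_2_eq_2 dih_mult_def flip: fps_of_nat)
  also have "?W * (?A * fps_XD ?L) + ?W * ?DJ + fps_const (real k * \<nu>) * (?W * ?DJ) = ?A * ?rhs"
    unfolding pairing_factor_mult_dunkl_series[symmetric] fps_XDp_def by (simp add: algebra_simps flip: fps_const_add)
  finally show ?thesis
    by simp
qed

end

section \<open>The Dunkl kernel as a sum over Pochhammer symbols\<close>

lemma abs_xi_uv_le_1: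
  assumes "\<bar>u\<bar> \<le> 1" "\<bar>v\<bar> \<le> 1"
  shows "\<bar>xi_uv u v a b\<bar> \<le> 1"
proof -
  have "\<bar>xi_uv u v a b\<bar> \<le> \<bar>v\<bar> * \<bar>cos a * cos b\<bar> + \<bar>u\<bar> * \<bar>sin a * sin b\<bar>"
    unfolding xi_uv_def by (rule order.trans[OF abs_triangle_ineq]) (simp add: abs_mult mult.assoc)
  also have "\<dots> \<le> 1 * \<bar>cos a * cos b\<bar> + 1 * \<bar>sin a * sin b\<bar>"
    using assms by (intro add_mono mult_right_mono) auto
  also have "\<dots> = \<bar>cos (a + b)\<bar> \<or> \<dots> = \<bar>cos (a - b)\<bar>"
    unfolding cos_add cos_diff by linarith
  then have "1 * \<bar>cos a * cos b\<bar> + 1 * \<bar>sin a * sin b\<bar> \<le> 1"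
    by (metis abs_cos_le_one)
  finally show ?thesis .
qed

lemma cos_q_uv: "\<bar>u\<bar> \<le> 1 \<Longrightarrow> \<bar>v\<bar> \<le> 1 \<Longrightarrow> cos (q_uv u v a b) = xi_uv u v a b"
  unfolding q_uv_def using abs_xi_uv_le_1[of u v a b] by (intro cos_arccos) linarith+

lemma abs_a_coef_le: "j < k \<Longrightarrow> \<bar>a_coef k z w u v j\<bar> \<le> cmod z * cmod w"
  by (simp add: a_coef_def abs_mult mult_left_le)

context dihedral_kernel
begin

lemma deformed_product_eq_prod_linear_factor:
  assumes "(v, u) \<in> centered_square"
  shows "deformed_product z (v, u) = (\<Prod>j<k. linear_factor (a_coef k z w u v j))"
proof -
  let ?q = "q_uv u v (real k * Arg z) (real k * Arg w)"
  have "(\<Prod>j<k. linear_factor (a_coef k z w u v j))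
      = (\<Prod>j<k. linear_factor (cmod z * cmod w * cos ((?q + 2 * pi * real j) / real k)))"
    by (intro prod.cong refl) (simp add: a_coef_def)
  also have "\<dots> = chebyshev_fps k (cmod z * cmod w) - fps_const (2 / 2 ^ k * (cmod z * cmod w) ^ k * cos ?q) * fps_X ^ k"
    by (rule prod_linear_factor_cos[OF k_ge_1])
  also have "cos ?q = xi_uv u v (real k * Arg z) (real k * Arg w)"
    using assms by (intro cos_q_uv) auto
  finally show ?thesis
    using sum_class_terms_eq_xi_uv[of "\<lambda>j. class_coord j (v, u)" z]
    by (simp add: deformed_product_eq_chebyshev class_coord_def)
qed

lemma geometrically_bounded_on_deformed_power:
  assumes "bounded S" "c > 0"
  shows "geometrically_bounded_on (S \<times> centered_square) (\<lambda>(z, x). fps_powr (deformed_product z x) (- c))"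
proof -
  obtain R where R: "\<And>z. z \<in> S \<Longrightarrow> cmod z \<le> R"
    using assms(1) by (auto simp: bounded_iff)
  let ?P = "\<lambda>(z, v, u). \<Prod>j<k. fps_powr (linear_factor (a_coef k z w u v j)) (- c)"
  have "geometrically_bounded_on (S \<times> centered_square) ?P"
    unfolding case_prod_unfold
  proof (intro geometrically_bounded_on_prod geometrically_bounded_on_fps_powr_linear_factor assms(2))
    fix j p assume "j \<in> {..<k}" "p \<in> S \<times> centered_square"
    then show "\<bar>a_coef k (fst p) w (snd (snd p)) (fst (snd p)) j\<bar> \<le> R * cmod w"
      using R by (intro order.trans[OF abs_a_coef_le] mult_right_mono) auto
  qed
  moreover have "?P p = (case p of (z, x) \<Rightarrow> fps_powr (deformed_product z x) (- c))" if "p \<in> S \<times> centered_square" for p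
    using that by (auto simp: deformed_product_eq_prod_linear_factor fps_powr_prod_distrib)
  ultimately show ?thesis
    by (simp cong: geometrically_bounded_on_cong)
qed

lemma geometrically_bounded_on_pairing_factor [geometrically_bounded_intros]:
  "compact S \<Longrightarrow> continuous_on S f \<Longrightarrow> geometrically_bounded_on S (\<lambda>z. pairing_factor (f z))"
  unfolding pairing_factor_def cinner_def
  by (intro geometrically_bounded_intros continuous_intros)

lemma geometrically_bounded_on_orbit_cofactor [geometrically_bounded_intros]:
  "compact S \<Longrightarrow> continuous_on S f \<Longrightarrow> geometrically_bounded_on S (\<lambda>z. orbit_cofactor (f z))"
  unfolding orbit_cofactor_def by (intro geometrically_bounded_intros continuous_intros)

lemma geometrically_bounded_on_power_average:
  assumes "compact S"
  shows "geometrically_bounded_on S power_average"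
  unfolding power_average_def
proof (rule mu.geometrically_bounded_on_fps_lebesgue_integral)
  show "geometrically_bounded_on (S \<times> centered_square) (\<lambda>(z, x). fps_powr (deformed_product z x) (- \<nu> - 1))"
    using geometrically_bounded_on_deformed_power[of S "\<nu> + 1"] assms \<alpha>_pos \<beta>_pos by (simp add: compact_imp_bounded)
  show "fps_continuous_on UNIV (\<lambda>x. fps_powr (deformed_product z x) (- \<nu> - 1))" for z
    by (intro fps_continuous_intros continuous_intros)
qed

lemma geometrically_bounded_on_weighted_average:
  assumes "compact S" and a: "continuous_on UNIV a"
  shows "geometrically_bounded_on S (weighted_average a)"
proof -
  have "geometrically_bounded_on S
      (\<lambda>z. fps_lebesgue_integral \<mu> (\<lambda>x. fps_const (a x) * fps_powr (deformed_product z x) (- \<nu> - 2)))"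
  proof (rule mu.geometrically_bounded_on_fps_lebesgue_integral)
    have "continuous_on (S \<times> centered_square) (\<lambda>p. a (snd p))"
      by (intro continuous_on_compose2[OF a] continuous_intros) auto
    moreover have "geometrically_bounded_on (S \<times> centered_square) (\<lambda>p. fps_powr (deformed_product (fst p) (snd p)) (- \<nu> - 2))"
      using geometrically_bounded_on_deformed_power[of S "\<nu> + 2"] assms \<alpha>_pos \<beta>_pos
      by (simp add: compact_imp_bounded case_prod_unfold)
    ultimately show "geometrically_bounded_on (S \<times> centered_square)
        (\<lambda>(z, x). fps_const (a x) * fps_powr (deformed_product z x) (- \<nu> - 2))"
      unfolding case_prod_unfold using assms
      by (intro geometrically_bounded_intros compact_Times compact_centered_square)
  qed (rule fps_continuous_on_weighted_power[OF a])
  then show ?thesis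
    unfolding weighted_average_def[abs_def] by (intro geometrically_bounded_intros assms continuous_intros)
qed

lemma geometrically_bounded_on_dunkl_series:
  "compact S \<Longrightarrow> geometrically_bounded_on S dunkl_series"
  unfolding dunkl_series_def[abs_def]
  by (intro geometrically_bounded_intros geometrically_bounded_on_power_average continuous_intros)

lemma geometrically_bounded_on_dunkl_series':
  "compact S \<Longrightarrow> geometrically_bounded_on S (\<lambda>z. dunkl_series' z h)"
  unfolding dunkl_series'_def orbit_cofactor'_def power_average'_def orbit_product'_def class_term'_def
  by (intro geometrically_bounded_intros geometrically_bounded_on_power_average
      geometrically_bounded_on_weighted_average continuous_intros)

lemma fps_continuous_on_weighted_average:
  assumes "continuous_on UNIV a"
  shows "fps_continuous_on UNIV (weighted_average a)"
proof -
  let ?f' = "\<lambda>z h x. fps_const (a x) *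
    (fps_const (- \<nu> - 2) * fps_powr (deformed_product z x) (- \<nu> - 2 - 1) * deformed_product' z h x)"
  have continuous_weight: "continuous_on UNIV (\<lambda>p. a (snd p))"
    by (intro continuous_on_compose2[OF assms] continuous_intros) auto
  have "fps_has_derivative
      (\<lambda>z. fps_lebesgue_integral \<mu> (\<lambda>x. fps_const (a x) * fps_powr (deformed_product z x) (- \<nu> - 2)))
      (\<lambda>h. fps_lebesgue_integral \<mu> (?f' z h)) z" for z
  proof (rule mu.fps_has_derivative_fps_lebesgue_integral)
    show "fps_has_derivative (\<lambda>z. fps_const (a x) * fps_powr (deformed_product z x) (- \<nu> - 2)) (\<lambda>h. ?f' z h x) z" for z x
      by (intro fps_has_derivative_mult_left fps_has_derivative_fps_powr deformed_product_has_derivative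
          deformed_product_nth_0)
    show "fps_continuous_on UNIV (\<lambda>x. fps_const (a x) * fps_powr (deformed_product z x) (- \<nu> - 2))" for z
      by (rule fps_continuous_on_weighted_power[OF assms])
    show "fps_continuous_on UNIV (\<lambda>(z, x). ?f' z h x)" for h
      unfolding case_prod_unfold by (intro fps_continuous_intros continuous_intros continuous_weight)
  qed
  from fps_has_derivative_imp_continuous_on[OF this] show ?thesis
    unfolding weighted_average_def[abs_def] by (intro fps_continuous_intros continuous_intros)
qed

lemma fps_continuous_on_dunkl_series': "fps_continuous_on UNIV (\<lambda>z. dunkl_series' z h)"
  unfolding dunkl_series'_def orbit_cofactor'_def power_average'_def
  by (intro fps_continuous_intros continuous_intros fps_continuous_on_weighted_average
      fps_has_derivative_imp_continuous_on[OF power_average_has_derivative])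

definition dunkl_sum :: "complex \<Rightarrow> real" where
  "dunkl_sum z = pochhammer_sum (real k * \<nu> + 1) (dunkl_series z)"

lemma pochhammer_parameter_ge_1: "real k * \<nu> + 1 \<ge> 1"
  using \<alpha>_pos \<beta>_pos by simp

lemma dunkl_sum_has_derivative:
  "(dunkl_sum has_derivative (\<lambda>h. pochhammer_sum (real k * \<nu> + 1) (dunkl_series' z h))) (at z)"
  unfolding dunkl_sum_def[abs_def]
proof (rule pochhammer_sum_has_derivative[OF pochhammer_parameter_ge_1 open_ball convex_ball _ dunkl_series_has_derivative])
  show "z \<in> ball 0 (cmod z + 1)"
    by simp
  show "geometrically_bounded_on (ball 0 (cmod z + 1)) dunkl_series"
    by (rule geometrically_bounded_on_subset[OF geometrically_bounded_on_dunkl_series[OF compact_cball] ball_subset_cball])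
  show "geometrically_bounded_on (ball 0 (cmod z + 1)) (\<lambda>z. dunkl_series' z h)" for h
    by (rule geometrically_bounded_on_subset[OF geometrically_bounded_on_dunkl_series'[OF compact_cball] ball_subset_cball])
qed

lemma frechet_derivative_dunkl_sum:
  "frechet_derivative dunkl_sum (at z) h = pochhammer_sum (real k * \<nu> + 1) (dunkl_series' z h)"
  by (simp add: frechet_derivative_at[OF dunkl_sum_has_derivative, symmetric])

lemma continuous_on_frechet_derivative_dunkl_sum: "continuous_on UNIV (\<lambda>z. frechet_derivative dunkl_sum (at z) h)"
proof (intro continuous_at_imp_continuous_on ballI)
  fix z :: complex
  have "continuous_on (cball z 1) (\<lambda>z. pochhammer_sum (real k * \<nu> + 1) (dunkl_series' z h))"
    using fps_continuous_on_dunkl_series'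
    by (intro continuous_on_pochhammer_sum pochhammer_parameter_ge_1 geometrically_bounded_on_dunkl_series' compact_cball)
      (auto simp: fps_continuous_on_def intro: continuous_on_subset)
  then show "isCont (\<lambda>z. frechet_derivative dunkl_sum (at z) h) z"
    unfolding frechet_derivative_dunkl_sum by (rule continuous_on_interior) simp
qed

lemma dunkl_sum_0: "dunkl_sum 0 = 1"
proof -
  have factor: "pairing_factor (dih_rot k i 0) = 1" for i
    by (simp add: pairing_factor_def cinner_def dih_rot_def)
  then have "orbit_product 0 = 1"
    by (simp add: orbit_product_def)
  moreover have "class_term j 0 = 0" for j
    using k_ge_1 by (simp add: class_term_def class_part_def power_0_left)
  ultimately have "deformed_product 0 x = 1" for x
    by (simp add: deformed_product_def)
  moreover have "measure \<mu> (space \<mu>) = 1"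
    using prob_space_mu_square[OF \<alpha>_pos \<beta>_pos] by (rule prob_space.prob_space)
  ultimately have "power_average 0 = 1"
    by (intro fps_ext) (simp add: power_average_def)
  then show ?thesis
    using factor by (simp add: dunkl_sum_def dunkl_series_def orbit_cofactor_def pochhammer_sum_1)
qed

lemma dunkl_op_dunkl_sum:
  assumes "dih_regular k z"
  shows "dunkl_op k \<alpha> \<beta> h dunkl_sum z = cinner h w * dunkl_sum z"
proof -
  let ?c = "real k * \<nu> + 1" and ?L = dunkl_series
  let ?q = "\<lambda>j. \<kappa> j * cinner (dih_root k j) h / cinner (dih_root k j) z"
  have summable: "pochhammer_summable ?c (?L y)" for y
    by (rule geometrically_bounded_imp_pochhammer_summable[OF geometrically_bounded_on_dunkl_series
          _ pochhammer_parameter_ge_1, of "{y}"]) auto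
  have summable': "pochhammer_summable ?c (dunkl_series' z h)"
    by (rule geometrically_bounded_imp_pochhammer_summable[OF geometrically_bounded_on_dunkl_series'
          _ pochhammer_parameter_ge_1, of "{z}"]) auto
  have "(\<lambda>n. dunkl_series' z h $ n / pochhammer ?c n
        + (\<Sum>j<2*k. ?q j * (?L z $ n / pochhammer ?c n - ?L (dih_refl k j z) $ n / pochhammer ?c n)))
      sums (frechet_derivative dunkl_sum (at z) h + (\<Sum>j<2*k. ?q j * (dunkl_sum z - dunkl_sum (dih_refl k j z))))"
    unfolding frechet_derivative_dunkl_sum dunkl_sum_def
    by (intro sums_add sums_sum sums_mult sums_diff pochhammer_sums summable summable')
  moreover have "dunkl_series' z h $ n / pochhammer ?c n
        + (\<Sum>j<2*k. ?q j * (?L z $ n / pochhammer ?c n - ?L (dih_refl k j z) $ n / pochhammer ?c n))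
      = cinner h w * ((fps_X * fps_XDp ?c (?L z)) $ n / pochhammer ?c n)" for n
  proof -
    have "dunkl_series' z h $ n / pochhammer ?c n
        + (\<Sum>j<2*k. ?q j * (?L z $ n / pochhammer ?c n - ?L (dih_refl k j z) $ n / pochhammer ?c n))
      = (dunkl_series' z h + (\<Sum>j<2*k. fps_const (?q j) * (?L z - ?L (dih_refl k j z)))) $ n / pochhammer ?c n"
      by (simp add: fps_sum_nth add_divide_distrib sum_divide_distrib diff_divide_distrib right_diff_distrib)
    then show ?thesis
      unfolding dunkl_equation_dunkl_series[OF assms] by simp
  qed
  moreover have "(\<lambda>n. cinner h w * ((fps_X * fps_XDp ?c (?L z)) $ n / pochhammer ?c n)) sums (cinner h w * dunkl_sum z)"
    unfolding dunkl_sum_def using pochhammer_parameter_ge_1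
    by (intro sums_mult pochhammer_sum_X_mult_XDp summable) linarith
  ultimately have "frechet_derivative dunkl_sum (at z) h + (\<Sum>j<2*k. ?q j * (dunkl_sum z - dunkl_sum (dih_refl k j z)))
      = cinner h w * dunkl_sum z"
    by (simp only:) (rule sums_unique2)
  then show ?thesis
    by (simp add: dunkl_op_def)
qed

lemma is_dunkl_kernel_dunkl_sum: "is_dunkl_kernel k \<alpha> \<beta> w dunkl_sum"
  unfolding is_dunkl_kernel_def
  using dunkl_sum_0 dunkl_op_dunkl_sum continuous_on_frechet_derivative_dunkl_sum
    differentiableI[OF dunkl_sum_has_derivative] by blast

lemma dunkl_kernel_eq_pochhammer_sum:
  "dunkl_kernel k \<alpha> \<beta> z w = pochhammer_sum (real k * \<nu> + 1) (dunkl_series z)"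
  using dunkl_kernel_eqI[OF less_imp_le[OF \<alpha>_pos] less_imp_le[OF \<beta>_pos] is_dunkl_kernel_dunkl_sum]
  unfolding dunkl_sum_def .

end

section \<open>Integral formulas\<close>

lemma h_fun_eq_simplex_integral:
  assumes "\<gamma> > 0"
  shows "h_fun k \<gamma> z w u v = Gamma (real k * \<gamma> + 1) / Gamma \<gamma> ^ k *
    (LINT t:simplexT k|PiM {..<k} (\<lambda>_. lborel).
      exp ((\<Sum>j<k. a_coef k z w u v j * t j) + a_coef k z w u v k * (1 - (\<Sum>j<k. t j)))
      * (\<Prod>j<k. t j powr (\<gamma> - 1)))"
  unfolding simplex_integral_eq_humbert2[OF assms] h_fun_def
  using assms by (simp add: Gamma_real_nonzero add_nonneg_pos)

context dihedral_kernel
begin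

definition h_series :: "real \<Rightarrow> complex \<Rightarrow> real \<times> real \<Rightarrow> real fps" where
  "h_series \<gamma> z x = inverse (pairing_factor z) * fps_powr (deformed_product z x) (- \<gamma>)"

definition correction_series :: "complex \<Rightarrow> real \<times> real \<Rightarrow> real fps" where
  "correction_series z x = (\<Sum>j<2. fps_const (class_coord j x - 1) * class_term j z) * h_series (\<nu> + 1) z x"

lemma fps_continuous_on_h_series [fps_continuous_intros]:
  "fps_continuous_on UNIV (h_series \<gamma> z)"
  unfolding h_series_def[abs_def] by (intro fps_continuous_intros continuous_intros)

lemma fps_continuous_on_correction_series: "fps_continuous_on UNIV (correction_series z)"
  unfolding correction_series_def[abs_def] by (intro fps_continuous_intros continuous_intros)

lemma geometrically_bounded_on_h_series:
  assumes "\<gamma> > 0"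
  shows "geometrically_bounded_on centered_square (h_series \<gamma> z)"
proof -
  have "geometrically_bounded_on centered_square (\<lambda>x. fps_powr (linear_factor (cinner z w)) (- 1))"
    by (rule geometrically_bounded_on_fps_powr_linear_factor) auto
  moreover have "geometrically_bounded_on centered_square (\<lambda>x. fps_powr (deformed_product z x) (- \<gamma>))"
    using geometrically_bounded_on_compose[OF geometrically_bounded_on_deformed_power[OF bounded_cball assms],
        of "Pair z" centered_square 0 "cmod z"] by force
  ultimately show ?thesis
    unfolding h_series_def[abs_def] pairing_factor_def by (simp add: fps_powr_minus_1 geometrically_bounded_on_mult)
qed

lemma geometrically_bounded_on_correction_series:
  "geometrically_bounded_on centered_square (correction_series z)"
  unfolding correction_series_def[abs_def] class_term_def using \<alpha>_pos \<beta>_pos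
  by (intro geometrically_bounded_intros geometrically_bounded_on_h_series compact_centered_square continuous_intros) auto

lemma h_fun_eq_pochhammer_sum:
  assumes "\<gamma> > 0" "(v, u) \<in> centered_square"
  shows "h_fun k \<gamma> z w u v = pochhammer_sum (real k * \<gamma> + 1) (h_series \<gamma> z (v, u))"
proof -
  let ?b = "\<lambda>i. if i < k then \<gamma> else 1"
  have "h_fun k \<gamma> z w u v
      = pochhammer_sum (real k * \<gamma> + 1) (\<Prod>i<k + 1. fps_powr (linear_factor (a_coef k z w u v i)) (- ?b i))"
    unfolding h_fun_def using assms(1) by (intro humbert2_eq_pochhammer_sum) auto
  also have "(\<Prod>i<k + 1. fps_powr (linear_factor (a_coef k z w u v i)) (- ?b i))
      = (\<Prod>i<k. fps_powr (linear_factor (a_coef k z w u v i)) (- \<gamma>)) * fps_powr (pairing_factor z) (- 1)"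
    by (simp add: pairing_factor_def a_coef_def[of k z w u v k] cinner_def)
  also have "\<dots> = h_series \<gamma> z (v, u)"
    by (simp add: h_series_def deformed_product_eq_prod_linear_factor[OF assms(2)] fps_powr_prod_distrib
        fps_powr_minus_1 mult.commute)
  finally show ?thesis .
qed

lemma h_fun_correction_eq_pochhammer_sum:
  assumes "(v, u) \<in> centered_square"
  shows "2 powr (1 - real k) * Gamma (real k * \<nu> + 1) / Gamma (real k * (\<nu> + 1) + 1)
      * (cmod z * cmod w) ^ k * xi_uv (u - 1) (v - 1) (real k * Arg z) (real k * Arg w) * h_fun k (\<nu> + 1) z w u v
    = pochhammer_sum (real k * \<nu> + 1) (correction_series z (v, u))"
proof -
  let ?c = "real k * \<nu> + 1" and ?H = "h_series (\<nu> + 1) z"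
  define \<zeta> where "\<zeta> = 2 / 2 ^ k * (cmod z * cmod w) ^ k * xi_uv (u - 1) (v - 1) (real k * Arg z) (real k * Arg w)"
  have shift: "real k * (\<nu> + 1) + 1 = ?c + real k"
    by (simp add: algebra_simps)
  have parameter_ge_1: "?c + real k \<ge> 1"
    using pochhammer_parameter_ge_1 by linarith
  have H_bounded: "geometrically_bounded_on centered_square ?H"
    using \<alpha>_pos \<beta>_pos by (intro geometrically_bounded_on_h_series) simp
  then have scaled_bounded: "geometrically_bounded_on centered_square (\<lambda>x. fps_const \<zeta> * ?H x)"
    by (intro geometrically_bounded_intros compact_centered_square continuous_intros)
  have "correction_series z (v, u) = fps_X ^ k * (fps_const \<zeta> * ?H (v, u))"
    unfolding correction_series_def sum_class_terms_eq_xi_uv \<zeta>_def by (simp add: class_coord_def mult_ac)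
  then have "pochhammer_sum ?c (correction_series z (v, u))
      = pochhammer_sum (?c + real k) (fps_const \<zeta> * ?H (v, u)) / pochhammer ?c k"
    using geometrically_bounded_imp_pochhammer_summable[OF scaled_bounded assms parameter_ge_1] by (simp add: pochhammer_sum_X_power_mult)
  also have "\<dots> = \<zeta> * h_fun k (\<nu> + 1) z w u v / pochhammer ?c k"
    using geometrically_bounded_imp_pochhammer_summable[OF H_bounded assms parameter_ge_1] \<alpha>_pos \<beta>_pos
    by (simp add: pochhammer_sum_const_mult h_fun_eq_pochhammer_sum[OF _ assms] flip: shift)
  also have "pochhammer ?c k = Gamma (real k * (\<nu> + 1) + 1) / Gamma ?c"
    using Gamma_add_nat_eq_pochhammer[of ?c k] pochhammer_parameter_ge_1 by (simp add: shift Gamma_real_nonzero)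
  finally show ?thesis
    by (simp add: \<zeta>_def powr_diff powr_realpow)
qed

lemma h_series_add_correction_series:
  "h_series \<nu> z x + correction_series z x = orbit_cofactor z * fps_powr (deformed_product z x) (- \<nu> - 1)"
proof -
  let ?A = "pairing_factor z" and ?F = "deformed_product z x"
  let ?C = "\<Sum>j<2. fps_const (class_coord j x - 1) * class_term j z"
  have "fps_powr ?F (- \<nu>) = ?F * fps_powr ?F (- \<nu> - 1)"
    using mult_fps_powr[of ?F "- \<nu> - 1"] by simp
  moreover have "- (\<nu> + 1) = - \<nu> - 1"
    by simp
  ultimately have "h_series \<nu> z x + correction_series z x = inverse ?A * (?F + ?C) * fps_powr ?F (- \<nu> - 1)"
    unfolding h_series_def correction_series_def by (simp only: distrib_left distrib_right mult_ac)
  also have "?F + ?C = ?A * orbit_cofactor z"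
    by (simp add: deformed_product_def pairing_factor_mult_orbit_cofactor numeral_2_eq_2 algebra_simps flip: fps_const_sub)
  finally show ?thesis
    by (simp add: inverse_mult_eq_1 flip: mult.assoc)
qed

abbreviation "h_sum z x \<equiv> pochhammer_sum (real k * \<nu> + 1) (h_series \<nu> z x)"

abbreviation "correction_sum z x \<equiv> pochhammer_sum (real k * \<nu> + 1) (correction_series z x)"

lemma geometrically_bounded_on_h_series_\<nu>: "geometrically_bounded_on centered_square (h_series \<nu> z)"
  using \<alpha>_pos \<beta>_pos by (intro geometrically_bounded_on_h_series) simp

lemma integrable_h_sum: "integrable \<mu> (h_sum z)"
  by (intro mu.integrable_pochhammer_sum pochhammer_parameter_ge_1 fps_continuous_on_h_series
      geometrically_bounded_on_h_series_\<nu>)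

lemma integrable_correction_sum: "integrable \<mu> (correction_sum z)"
  by (intro mu.integrable_pochhammer_sum pochhammer_parameter_ge_1 fps_continuous_on_correction_series
      geometrically_bounded_on_correction_series)

lemma dunkl_kernel_eq_integral_sums:
  "dunkl_kernel k \<alpha> \<beta> z w = (\<integral>x. h_sum z x + correction_sum z x \<partial>\<mu>)"
proof -
  let ?c = "real k * \<nu> + 1" and ?f = "\<lambda>x. h_series \<nu> z x + correction_series z x"
  have f_continuous_bounded: "fps_continuous_on UNIV ?f" "geometrically_bounded_on centered_square ?f"
    by (intro fps_continuous_intros fps_continuous_on_correction_series geometrically_bounded_on_add
        geometrically_bounded_on_h_series_\<nu> geometrically_bounded_on_correction_series)+
  have "fps_continuous_on UNIV (\<lambda>x. fps_powr (deformed_product z x) (- \<nu> - 1))"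
    by (intro fps_continuous_intros continuous_intros)
  then have "dunkl_series z = fps_lebesgue_integral \<mu> ?f"
    unfolding h_series_add_correction_series dunkl_series_def power_average_def
    by (rule mu.fps_lebesgue_integral_mult[symmetric])
  then have "dunkl_kernel k \<alpha> \<beta> z w = (\<integral>x. pochhammer_sum ?c (?f x) \<partial>\<mu>)"
    unfolding dunkl_kernel_eq_pochhammer_sum
    by (simp only: mu.integral_pochhammer_sum[OF pochhammer_parameter_ge_1 f_continuous_bounded])
  also have "\<dots> = (\<integral>x. h_sum z x + correction_sum z x \<partial>\<mu>)"
  proof (rule integral_cong_AE)
    show "AE x in \<mu>. pochhammer_sum ?c (?f x) = h_sum z x + correction_sum z x"
      using mu.AE_in_support
    proof eventually_elim
      case (elim x)
      then show ?case
        by (intro pochhammer_sum_add geometrically_bounded_imp_pochhammer_summable[OF _ elim pochhammer_parameter_ge_1]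
            geometrically_bounded_on_h_series_\<nu> geometrically_bounded_on_correction_series)
    qed
  qed (intro borel_measurable_integrable mu.integrable_pochhammer_sum pochhammer_parameter_ge_1
      f_continuous_bounded Bochner_Integration.integrable_add integrable_h_sum integrable_correction_sum)+
  finally show ?thesis .
qed

lemma h_fun_eq_h_sum: "(v, u) \<in> centered_square \<Longrightarrow> h_fun k \<nu> z w u v = h_sum z (v, u)"
  using \<alpha>_pos \<beta>_pos by (intro h_fun_eq_pochhammer_sum) simp

lemma dunkl_kernel_eq_integral_h_fun:
  "dunkl_kernel k \<alpha> \<beta> z w = iterated_mu_integral \<alpha> \<beta> (\<lambda>u v. h_fun k \<nu> z w u v
    + 2 powr (1 - real k) * Gamma (real k * \<nu> + 1) / Gamma (real k * (\<nu> + 1) + 1)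
      * (cmod z * cmod w) ^ k * xi_uv (u - 1) (v - 1) (real k * Arg z) (real k * Arg w) * h_fun k (\<nu> + 1) z w u v)"
  unfolding dunkl_kernel_eq_integral_sums
  by (rule iterated_mu_integral_eq[OF \<alpha>_pos \<beta>_pos, symmetric])
    (intro Bochner_Integration.integrable_add integrable_h_sum integrable_correction_sum,
      simp only: h_fun_eq_h_sum h_fun_correction_eq_pochhammer_sum mem_centered_square)

lemma dunkl_kernel_eq_simplex_integrals:
  "dunkl_kernel k \<alpha> \<beta> z w =
    Gamma (real k * \<nu> + 1) / Gamma \<nu> ^ k * iterated_mu_integral \<alpha> \<beta> (\<lambda>u v.
      LINT t:simplexT k|PiM {..<k} (\<lambda>_. lborel).
        exp ((\<Sum>j<k. a_coef k z w u v j * t j) + a_coef k z w u v k * (1 - (\<Sum>j<k. t j)))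
        * (\<Prod>j<k. t j powr (\<nu> - 1)))
    + 2 powr (1 - real k) * Gamma (real k * \<nu> + 1) / Gamma (\<nu> + 1) ^ k * iterated_mu_integral \<alpha> \<beta> (\<lambda>u v.
      LINT t:simplexT k|PiM {..<k} (\<lambda>_. lborel).
        (cmod z * cmod w) ^ k * xi_uv (u - 1) (v - 1) (real k * Arg z) (real k * Arg w)
        * exp ((\<Sum>j<k. a_coef k z w u v j * t j) + a_coef k z w u v k * (1 - (\<Sum>j<k. t j)))
        * (\<Prod>j<k. t j powr \<nu>))"
    (is "_ = ?C * iterated_mu_integral \<alpha> \<beta> ?I + ?C' * iterated_mu_integral \<alpha> \<beta> ?I'")
proof -
  have \<nu>: "\<nu> > 0" "\<nu> + 1 > 0" "Gamma (real k * (\<nu> + 1) + 1) \<noteq> 0"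
    using \<alpha>_pos \<beta>_pos by (auto intro!: Gamma_real_nonzero add_nonneg_pos)
  have "?C * iterated_mu_integral \<alpha> \<beta> ?I = (\<integral>x. h_sum z x \<partial>\<mu>)"
    unfolding iterated_mu_integral_mult_left[symmetric] h_fun_eq_simplex_integral[OF \<nu>(1), symmetric]
    by (rule iterated_mu_integral_eq[OF \<alpha>_pos \<beta>_pos integrable_h_sum]) (simp add: h_fun_eq_h_sum)
  moreover have "?C' * iterated_mu_integral \<alpha> \<beta> ?I' = (\<integral>x. correction_sum z x \<partial>\<mu>)"
    unfolding iterated_mu_integral_mult_left[symmetric]
  proof (rule iterated_mu_integral_eq[OF \<alpha>_pos \<beta>_pos integrable_correction_sum])
    fix u v :: real assume "u \<in> {-1..1}" "v \<in> {-1..1}"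
    then have "correction_sum z (v, u) = 2 powr (1 - real k) * Gamma (real k * \<nu> + 1) / Gamma (real k * (\<nu> + 1) + 1)
      * (cmod z * cmod w) ^ k * xi_uv (u - 1) (v - 1) (real k * Arg z) (real k * Arg w) * h_fun k (\<nu> + 1) z w u v"
      by (simp only: h_fun_correction_eq_pochhammer_sum mem_centered_square)
    then show "?C' * ?I' u v = correction_sum z (v, u)"
      unfolding h_fun_eq_simplex_integral[OF \<nu>(2)] using \<nu>(3)
      by (simp add: mult.assoc[of "_ ^ _ * _"] set_integral_mult_right)
  qed
  ultimately show ?thesis
    unfolding dunkl_kernel_eq_integral_sums
    by (simp add: Bochner_Integration.integral_add integrable_h_sum integrable_correction_sum)
qed

end

theorem mainTheorem11:
  fixes k :: nat and \<alpha> \<beta> :: real and z w :: complex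
  assumes "k \<ge> 1" and "\<alpha> > 0" and "\<beta> > 0"
  shows
   "(\<forall>\<gamma>>0. \<forall>u v. h_fun k \<gamma> z w u v =
       exp (a_coef k z w u v k) *
       humbert2 k (\<lambda>_. \<gamma>) (real k * \<gamma> + 1) (\<lambda>j. a_coef k z w u v j - a_coef k z w u v k))
    \<and> dunkl_kernel k \<alpha> \<beta> z w =
      (LINT v:{-1..1}|lborel. (LINT u:{-1..1}|lborel.
         (h_fun k (\<alpha> + \<beta>) z w u v
          + 2 powr (1 - real k) * Gamma (real k * (\<alpha> + \<beta>) + 1) / Gamma (real k * (\<alpha> + \<beta> + 1) + 1)
            * (cmod z * cmod w) ^ k * xi_uv (u - 1) (v - 1) (real k * Arg z) (real k * Arg w)
            * h_fun k (\<alpha> + \<beta> + 1) z w u v) * mu_dens \<alpha> u) * mu_dens \<beta> v)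
    \<and> dunkl_kernel k \<alpha> \<beta> z w =
      Gamma (real k * (\<alpha> + \<beta>) + 1) / Gamma (\<alpha> + \<beta>) ^ k *
      (LINT v:{-1..1}|lborel. (LINT u:{-1..1}|lborel.
         (LINT t:simplexT k|PiM {..<k} (\<lambda>_. lborel).
            exp ((\<Sum>j<k. a_coef k z w u v j * t j) + a_coef k z w u v k * (1 - (\<Sum>j<k. t j)))
            * (\<Prod>j<k. t j powr (\<alpha> + \<beta> - 1))) * mu_dens \<alpha> u) * mu_dens \<beta> v)
      + 2 powr (1 - real k) * Gamma (real k * (\<alpha> + \<beta>) + 1) / Gamma (\<alpha> + \<beta> + 1) ^ k *
      (LINT v:{-1..1}|lborel. (LINT u:{-1..1}|lborel.
         (LINT t:simplexT k|PiM {..<k} (\<lambda>_. lborel).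
            (cmod z * cmod w) ^ k * xi_uv (u - 1) (v - 1) (real k * Arg z) (real k * Arg w)
            * exp ((\<Sum>j<k. a_coef k z w u v j * t j) + a_coef k z w u v k * (1 - (\<Sum>j<k. t j)))
            * (\<Prod>j<k. t j powr (\<alpha> + \<beta>))) * mu_dens \<alpha> u) * mu_dens \<beta> v)"
proof -
  interpret dihedral_kernel k \<alpha> \<beta> w
    by unfold_locales (rule assms)+
  show ?thesis
  proof (intro conjI allI impI)
    show "h_fun k \<gamma> z w u v = exp (a_coef k z w u v k) *
        humbert2 k (\<lambda>_. \<gamma>) (real k * \<gamma> + 1) (\<lambda>j. a_coef k z w u v j - a_coef k z w u v k)" if "\<gamma> > 0" for \<gamma> u v
      unfolding h_fun_def by (rule humbert2_eq_exp_mult_humbert2[OF that])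
  qed (rule dunkl_kernel_eq_integral_h_fun[unfolded iterated_mu_integral_def]
      dunkl_kernel_eq_simplex_integrals[unfolded iterated_mu_integral_def])+
qed

end
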